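(* Let $\mathrm{U},\mathrm{V},\mathrm{W}$ be Banach spaces, $2\le p<3$, $q\ge1$, $1\le r<p$, $0<\gamma\le1$, $0<\kappa<1$, $\overline{\kappa}:=1-\kappa$, and let $\mathbf{x}\in\mathrm{R}_p(\mathrm{U})$ be a rough path. Set $$\mathrm{P}\mathrm{V}:=\mathrm{P}_{p,q,r}(\mathbf{x},\mathrm{V}),\qquad \mathrm{Q}\mathrm{W}:=\mathrm{P}_{p,\frac{q\vee p}{\kappa\gamma},\,r\vee\frac{p}{1+\kappa\gamma}}(\mathbf{x},\mathrm{W}),$$ $$\mathrm{P}^\star\mathrm{V}:=\{y\in\mathrm{P}\mathrm{V}:(y_0,y_0^\dagger)=(0,0)\},\qquad\mathrm{Q}^\star\mathrm{W}:=\{y\in\mathrm{Q}\mathrm{W}:(y_0,y_0^\dagger)=(0,0)\}.$$ Let $k\ge0$ be an integer and assume that $f\in\mathcal{C}^{k+1+\gamma}(\mathrm{V},\mathrm{W})$. Then the map $\mathfrak{O}f:y\mapsto(f(y_t))_{t\in[0,T]}$ is locally of class $\mathcal{C}^{k+\overline{\kappa}\gamma}$ from $\mathrm{P}\mathrm{V}$ to $\mathrm{Q}\mathrm{W}$, with $\mathfrak{O}f(y)^\dagger=\mathrm{D}f(y)y^\dagger$, i.e. $\mathfrak{O}f(y)^\dagger_t=\mathrm{D}f(y_t)y^\dagger_t$. Besides (when $k\ge1$, so that $\mathfrak{O}f$ is differentiable), its Fréchet derivative is $$\mathrm{D}\mathfrak{O}f(y)\cdot z=\big(\mathrm{D}f(y_t)\cdot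 z_t\big)_{t\in[0,T]}\in\mathrm{Q}\mathrm{W},\quad\forall y,z\in\mathrm{P}\mathrm{V}.$$ In addition, if $z\in\mathrm{P}^\star\mathrm{V}$, then $\mathrm{D}\mathfrak{O}f(y)\cdot z\in\mathrm{Q}^\star\mathrm{W}$ for any $y\in\mathrm{P}\mathrm{V}$.
   Context: $T>0$ is fixed. A control is a non-negative function $\omega=(\omega_{s,t})_{0\le s\le t\le T}$ that is continuous close to the diagonal and super-additive: $\omega_{r,s}+\omega_{s,t}\leq\omega_{r,t}$ for $0\le r\le s\le t\le T$. A control $\omega$ is fixed. For a path $x$ with values in a Banach space, $x_{s,t}:=x_t-x_s$. For a path or two-parameter family $(x_{s,t})_{0\le s\le t\le T}$ and $p>0$, $\|x\|_p:=\sup_{s<t}|x_{s,t}|/\omega_{s,t}^{1/p}$ (the smallest $C$ with $|x_{s,t}|\le C\omega_{s,t}^{1/p}$). $\mathrm{C}_p(\mathrm{V})$ is the space of paths $x:[0,T]\to\mathrm{V}$ with $\|x\|_p<\infty$. Tensor products of Banach spaces are completed for the projective norm; $L(\cdot,\cdot)$ denotes continuous linear maps. $a\vee b:=\max\{a,b\}$. Rough paths: $\mathbf{x}\in\mathrm{R}_p(\mathrm{U})$ is given by its increments $\mathbf{x}_{s,t}=1+\mathbf{x}^1_{s,t}+\mathbf{x}^2_{s,t}$, $\mathbf{x}^1_{s,t}\in\mathrm{U}$, $\mathbf{x}^2_{s,t}\in\mathrm{U}\otimes\mathrm{U}$, which are multiplicative, i.e. $\mathbf{x}^1_{r,t}=\mathbf{x}^1_{r,s}+\mathbf{x}^1_{s,t}$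 and $\mathbf{x}^2_{r,t}=\mathbf{x}^2_{r,s}+\mathbf{x}^2_{s,t}+\mathbf{x}^1_{r,s}\otimes\mathbf{x}^1_{s,t}$ for $r\le s\le t$, and satisfy $\|\mathbf{x}^1\|_p<\infty$, $\|\mathbf{x}^2\|_{p/2}<\infty$. Controlled rough paths: $\mathrm{P}_{p,q,r}(\mathbf{x},\mathrm{V})$ is the Banach space of paths $y:[0,T]\to\mathrm{V}$, identified with pairs $(y,y^\dagger)$, such that $y_{s,t}=y^\dagger_s\mathbf{x}^1_{s,t}+y^\sharp_{s,t}$ with $y^\dagger\in\mathrm{C}_q(L(\mathrm{U},\mathrm{V}))$ and $\|y^\sharp\|_r<\infty$, with norm $|y_0|+|y_0^\dagger|+\|y^\dagger\|_q+\|y^\sharp\|_r$. For an integer $k\ge0$ and $\gamma\in(0,1]$, a function between Banach spaces (or on an open subset of one) is of class $\mathcal{C}^{k+\gamma}$ if it is bounded and continuous, has bounded continuous Fréchet derivatives up to order $k$, and its derivative of order $k$ is globally $\gamma$-Hölder continuous on the domain; $\mathcal{C}^{k+\gamma}(\mathrm{V},\mathrm{W})$ is the space of such functions from $\mathrm{V}$ to $\mathrm{W}$. A map is locally of class $\mathcal{C}^\alpha$ if every point of its domain has an open neighbourhood on which it is of class $\mathcal{C}^\alpha$. *)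

theory Defs
  imports "HOL-Analysis.Analysis" "HOL-Library.Function_Algebras"
begin

section \<open>The completed projective tensor product\<close>

text \<open>
  The elements of the completed projective tensor product of two normed spaces are the sums of
  series \<open>\<Sum>n. u n \<otimes> v n\<close> with \<open>\<Sum>n. norm (u n) * norm (v n) < \<infinity>\<close>, normed by the infimum of
  \<open>\<Sum>n. norm (u n) * norm (v n)\<close> over all such series.  As usual, the elementary tensor \<open>u \<otimes> v\<close> is
  realised as the functional \<open>B \<mapsto> B u v\<close> on the bounded bilinear forms; by the Hahn-Banach theorem
  these forms separate the points of the completed tensor product.
\<close>

definition tensor_series ::
  "(nat \<Rightarrow> 'a::real_normed_vector) \<Rightarrow> (nat \<Rightarrow> 'b::real_normed_vector)
    \<Rightarrow> (('a \<Rightarrow>\<^sub>L 'b \<Rightarrow>\<^sub>L real) \<Rightarrow>\<^sub>L real) \<Rightarrow> bool"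
  where "tensor_series u v \<phi> \<longleftrightarrow>
    summable (\<lambda>n. norm (u n) * norm (v n)) \<and> (\<forall>B. (\<lambda>n. blinfun_apply (blinfun_apply B (u n)) (v n)) sums blinfun_apply \<phi> B)"

lemma tensor_series_term_bound:
  fixes B :: "'a::real_normed_vector \<Rightarrow>\<^sub>L 'b::real_normed_vector \<Rightarrow>\<^sub>L real"
  shows "norm (B u v) \<le> norm B * (norm u * norm v)"
  using order_trans[OF norm_blinfun mult_right_mono[OF norm_blinfun norm_ge_zero], of B u v]
  by (simp add: mult.assoc)

lemma tensor_series_summable:
  fixes B :: "'a::real_normed_vector \<Rightarrow>\<^sub>L 'b::real_normed_vector \<Rightarrow>\<^sub>L real"
  assumes "summable (\<lambda>n. norm (u n) * norm (v n))"
  shows "summable (\<lambda>n. B (u n) (v n) :: real)" "summable (\<lambda>n. norm (B (u n) (v n)))"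
proof -
  have "summable (\<lambda>n. norm B * (norm (u n) * norm (v n)))"
    using assms by (rule summable_mult)
  then show "summable (\<lambda>n. norm (B (u n) (v n)))"
    by (rule summable_comparison_test[rotated]) (auto intro!: exI[of _ 0] tensor_series_term_bound[simplified])
  then show "summable (\<lambda>n. B (u n) (v n))" by (rule summable_norm_cancel)
qed

lemma tensor_series_bound:
  assumes "tensor_series u v \<phi>"
  shows "norm (\<phi> B) \<le> norm B * (\<Sum>n. norm (u n) * norm (v n))"
proof -
  have s: "summable (\<lambda>n. norm (u n) * norm (v n))" and e: "\<phi> B = (\<Sum>n. B (u n) (v n))"
    using assms by (auto simp: tensor_series_def sums_iff)
  have "norm (\<phi> B) \<le> (\<Sum>n. norm (B (u n) (v n)))"
    unfolding e by (rule summable_norm[OF tensor_series_summable(2)[OF s]])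
  also have "\<dots> \<le> (\<Sum>n. norm B * (norm (u n) * norm (v n)))"
    by (intro suminf_le tensor_series_term_bound tensor_series_summable(2)[OF s] summable_mult s)
  also have "\<dots> = norm B * (\<Sum>n. norm (u n) * norm (v n))"
    by (rule suminf_mult[OF s])
  finally show ?thesis .
qed

lemma tensor_series_ex:
  assumes s: "summable (\<lambda>n. norm (u n) * norm (v n))"
  shows "\<exists>\<phi>. tensor_series u v \<phi>"
proof -
  define g where "g B = (\<Sum>n. blinfun_apply (blinfun_apply B (u n)) (v n))" for B :: "'a \<Rightarrow>\<^sub>L 'b \<Rightarrow>\<^sub>L real"
  note S = tensor_series_summable[OF s]
  have "bounded_linear g"
  proof (rule bounded_linear_intro[where K = "\<Sum>n. norm (u n) * norm (v n)"])
    show "g (B + C) = g B + g C" for B C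
      by (simp add: g_def blinfun.add_left suminf_add S(1))
    show "g (r *\<^sub>R B) = r *\<^sub>R g B" for r B
      by (simp add: g_def blinfun.scaleR_left suminf_mult S(1))
    fix B :: "'a \<Rightarrow>\<^sub>L 'b \<Rightarrow>\<^sub>L real"
    have "norm (g B) \<le> (\<Sum>n. norm (B (u n) (v n)))"
      unfolding g_def by (rule summable_norm[OF S(2)])
    also have "\<dots> \<le> (\<Sum>n. norm B * (norm (u n) * norm (v n)))"
      by (intro suminf_le tensor_series_term_bound S(2) summable_mult s)
    also have "\<dots> = norm B * (\<Sum>n. norm (u n) * norm (v n))"
      by (rule suminf_mult[OF s])
    finally show "norm (g B) \<le> norm B * (\<Sum>n. norm (u n) * norm (v n))" .
  qed
  then have "tensor_series u v (Blinfun g)"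
    using s S(1) by (auto simp: tensor_series_def bounded_linear_Blinfun_apply g_def summable_sums)
  then show ?thesis ..
qed

lemma tensor_series_countable_sum:
  assumes r: "\<And>n. tensor_series (u n) (v n) (\<phi> n)"
    and le: "\<And>n. (\<Sum>m. norm (u n m) * norm (v n m)) \<le> c n" and c: "summable c"
  shows "\<exists>U V \<Phi>. tensor_series U V \<Phi> \<and> (\<Sum>n. norm (U n) * norm (V n)) \<le> suminf c \<and>
    (\<forall>B. (\<lambda>n. blinfun_apply (\<phi> n) B) sums blinfun_apply \<Phi> B)"
proof -
  define a where "a n m = norm (u n m) * norm (v n m)" for n m
  have a0: "a n m \<ge> 0" for n m by (simp add: a_def)
  have sa: "summable (a n)" for n
    using r[of n] by (simp add: tensor_series_def a_def[abs_def])
  have suma: "suminf (a n) \<le> c n" for n using le[of n] by (simp add: a_def[abs_def])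
  have c0: "c n \<ge> 0" for n using suma[of n] suminf_nonneg[OF sa a0, of n] by linarith
  have ha: "(a n has_sum suminf (a n)) UNIV" for n
    using norm_summable_imp_has_sum[OF _ summable_sums[OF sa[of n]]] sa[of n] a0 by simp
  have ssa: "summable (\<lambda>n. suminf (a n))"
    by (rule summable_comparison_test[OF _ c])
       (use suma a0 sa in \<open>auto intro!: exI[of _ 0] simp: suminf_nonneg\<close>)
  have "(\<lambda>n. suminf (a n)) summable_on UNIV"
    by (rule norm_summable_imp_summable_on) (use ssa a0 sa in \<open>simp add: suminf_nonneg\<close>)
  then have Sig: "(\<lambda>(n, m). a n m) summable_on (UNIV \<times> UNIV)"
    by (rule summable_on_SigmaI[rotated]) (use ha a0 in auto)
  define U where "U k = (case prod_decode k of (n, m) \<Rightarrow> u n m)" for k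
  define V where "V k = (case prod_decode k of (n, m) \<Rightarrow> v n m)" for k
  have bij: "bij_betw prod_decode UNIV (UNIV \<times> UNIV)"
    using bij_prod_decode by simp
  have aUV: "norm (U k) * norm (V k) = (\<lambda>(n, m). a n m) (prod_decode k)" for k
    by (simp add: U_def V_def a_def split: prod.splits)
  have "(\<lambda>k. norm (U k) * norm (V k)) summable_on UNIV"
    unfolding aUV using Sig by (subst summable_on_reindex_bij_betw[OF bij])
  then have sUV: "summable (\<lambda>k. norm (U k) * norm (V k))"
    by (rule summable_on_imp_summable)
  obtain \<Phi> where Phi: "tensor_series U V \<Phi>" using tensor_series_ex[OF sUV] ..
  have hs: "((\<lambda>(n, m). a n m) has_sum (\<Sum>k. norm (U k) * norm (V k))) (UNIV \<times> UNIV)"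
  proof -
    have "((\<lambda>k. norm (U k) * norm (V k)) has_sum (\<Sum>k. norm (U k) * norm (V k))) UNIV"
      by (rule norm_summable_imp_has_sum) (use sUV in \<open>auto simp: summable_sums\<close>)
    then show ?thesis
      unfolding aUV by (subst (asm) has_sum_reindex_bij_betw[OF bij])
  qed
  have "((\<lambda>n. suminf (a n)) has_sum (\<Sum>k. norm (U k) * norm (V k))) UNIV"
    by (rule has_sum_SigmaD[OF hs]) (use ha in auto)
  then have "(\<Sum>k. norm (U k) * norm (V k)) = (\<Sum>n. suminf (a n))"
    using has_sum_imp_sums sums_unique by blast
  also have "\<dots> \<le> suminf c" by (rule suminf_le[OF suma ssa c])
  finally have bnd: "(\<Sum>k. norm (U k) * norm (V k)) \<le> suminf c" .
  have "(\<lambda>n. blinfun_apply (\<phi> n) B) sums blinfun_apply \<Phi> B" for B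
  proof -
    define b where "b = (\<lambda>(n, m). blinfun_apply (blinfun_apply B (u n m)) (v n m))"
    have "((\<lambda>k. blinfun_apply (blinfun_apply B (U k)) (V k)) has_sum \<Phi> B) UNIV"
      using Phi tensor_series_summable(2)[OF sUV, of B]
      by (intro norm_summable_imp_has_sum) (simp_all add: tensor_series_def)
    moreover have "blinfun_apply (blinfun_apply B (U k)) (V k) = b (prod_decode k)" for k
      by (simp add: U_def V_def b_def split: prod.splits)
    ultimately have "((\<lambda>k. b (prod_decode k)) has_sum \<Phi> B) UNIV" by simp
    then have bs: "(b has_sum \<Phi> B) (UNIV \<times> UNIV)"
      by (subst (asm) has_sum_reindex_bij_betw[OF bij])
    have "((\<lambda>m. b (n, m)) has_sum \<phi> n B) UNIV" for n
    proof -
      have "(\<lambda>m. blinfun_apply (blinfun_apply B (u n m)) (v n m)) sums \<phi> n B"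
        and "summable (\<lambda>m. norm (u n m) * norm (v n m))"
        using r[of n] by (simp_all add: tensor_series_def)
      then show ?thesis unfolding b_def prod.case
        by (intro norm_summable_imp_has_sum tensor_series_summable(2))
    qed
    from has_sum_SigmaD[OF bs this] have "((\<lambda>n. \<phi> n B) has_sum \<Phi> B) UNIV" .
    then show ?thesis by (rule has_sum_imp_sums)
  qed
  then have "\<forall>B. (\<lambda>n. blinfun_apply (\<phi> n) B) sums blinfun_apply \<Phi> B" ..
  with Phi bnd show ?thesis by (intro exI conjI)
qed

lemma le_mult_if_greater:
  fixes a c x :: real
  assumes le: "\<And>e. x < e \<Longrightarrow> a \<le> c * e" and c: "c \<ge> 0"
  shows "a \<le> c * x"
proof (rule field_le_epsilon)
  fix d :: real assume d: "d > 0"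
  have "c * (d / (c + 1)) = d * (c / (c + 1))" by simp
  also have "\<dots> \<le> d * 1" using d c by (intro mult_left_mono) auto
  finally have "c * (d / (c + 1)) \<le> d" by simp
  moreover have "a \<le> c * (x + d / (c + 1))" using d c by (intro le) auto
  ultimately show "a \<le> c * x + d" by (simp add: distrib_left)
qed

lemma tensor_series_0: "tensor_series (\<lambda>_. 0) (\<lambda>_. 0) 0"
  by (simp add: tensor_series_def)

lemma tensor_series_scaleR:
  "tensor_series u v \<phi> \<Longrightarrow> tensor_series (\<lambda>n. c *\<^sub>R u n) v (c *\<^sub>R \<phi>)"
  by (auto simp: tensor_series_def blinfun.scaleR_left blinfun.scaleR_right mult.assoc
      intro: summable_mult sums_mult)

lemma tensor_series_add:
  assumes "tensor_series u v \<phi>" "tensor_series u' v' \<psi>"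
  shows "\<exists>U V. tensor_series U V (\<phi> + \<psi>) \<and> (\<Sum>n. norm (U n) * norm (V n)) \<le>
    (\<Sum>n. norm (u n) * norm (v n)) + (\<Sum>n. norm (u' n) * norm (v' n))"
proof -
  define S where "S = (\<Sum>n. norm (u n) * norm (v n))"
  define S' where "S' = (\<Sum>n. norm (u' n) * norm (v' n))"
  define uu where "uu = (\<lambda>n::nat. if n = 0 then u else if n = 1 then u' else (\<lambda>_. 0))"
  define vv where "vv = (\<lambda>n::nat. if n = 0 then v else if n = 1 then v' else (\<lambda>_. 0))"
  define ff where "ff = (\<lambda>n::nat. if n = 0 then \<phi> else if n = 1 then \<psi> else 0)"
  define c where "c = (\<lambda>n::nat. if n = 0 then S else if n = 1 then S' else 0)"
  have two: "h sums (h 0 + h 1)" if "\<And>n. n > 1 \<Longrightarrow> h n = 0" for h :: "nat \<Rightarrow> real"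
    using sums_finite[of "{0, 1}" h] that by (simp add: not_less_iff_gr_or_eq)
  have sc: "c sums (S + S')" using two[of c] by (simp add: c_def)
  have "\<exists>U V \<Phi>. tensor_series U V \<Phi> \<and> (\<Sum>n. norm (U n) * norm (V n)) \<le> suminf c \<and>
    (\<forall>B. (\<lambda>n. blinfun_apply (ff n) B) sums blinfun_apply \<Phi> B)"
  proof (rule tensor_series_countable_sum)
    show "tensor_series (uu n) (vv n) (ff n)" for n
      using assms by (simp add: uu_def vv_def ff_def tensor_series_0)
    show "(\<Sum>m. norm (uu n m) * norm (vv n m)) \<le> c n" for n
      by (simp add: uu_def vv_def c_def S_def S'_def)
    show "summable c" using sc by (rule sums_summable)
  qed
  then obtain U V \<Phi> where P: "tensor_series U V \<Phi>" "(\<Sum>n. norm (U n) * norm (V n)) \<le> suminf c"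
    "\<And>B. (\<lambda>n. blinfun_apply (ff n) B) sums blinfun_apply \<Phi> B" by blast
  have "\<Phi> B = (\<phi> + \<psi>) B" for B
    using two[of "\<lambda>n. ff n B"] P(3)[of B] sums_unique2
    by (fastforce simp: ff_def blinfun.add_left)
  then have "\<Phi> = \<phi> + \<psi>" by (rule blinfun_eqI)
  with P(1,2) show ?thesis using sums_unique[OF sc] unfolding S_def S'_def by auto
qed

typedef (overloaded) ('a, 'b) ptensor =
  "{\<phi> :: ('a::real_normed_vector \<Rightarrow>\<^sub>L 'b::real_normed_vector \<Rightarrow>\<^sub>L real) \<Rightarrow>\<^sub>L real.
      \<exists>u v. tensor_series u v \<phi>}"
  using tensor_series_0 by blast

setup_lifting type_definition_ptensor

instantiation ptensor :: (real_normed_vector, real_normed_vector) real_vector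
begin

lift_definition zero_ptensor :: "('a, 'b) ptensor" is 0
  using tensor_series_0 by blast

lift_definition plus_ptensor :: "('a, 'b) ptensor \<Rightarrow> ('a, 'b) ptensor \<Rightarrow> ('a, 'b) ptensor" is "(+)"
  using tensor_series_add by blast

lift_definition scaleR_ptensor :: "real \<Rightarrow> ('a, 'b) ptensor \<Rightarrow> ('a, 'b) ptensor" is "(*\<^sub>R)"
  using tensor_series_scaleR by blast

lift_definition uminus_ptensor :: "('a, 'b) ptensor \<Rightarrow> ('a, 'b) ptensor" is uminus
  using tensor_series_scaleR[of _ _ _ "-1"] by fastforce

definition minus_ptensor :: "('a, 'b) ptensor \<Rightarrow> ('a, 'b) ptensor \<Rightarrow> ('a, 'b) ptensor"
  where "minus_ptensor x y = x + - y"

instance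
  by standard (transfer; simp add: algebra_simps minus_ptensor_def)+

end

lemma Rep_ptensor_minus: "Rep_ptensor (x - y) = Rep_ptensor x - Rep_ptensor y"
  unfolding minus_ptensor_def plus_ptensor.rep_eq uminus_ptensor.rep_eq by simp

instantiation ptensor :: (real_normed_vector, real_normed_vector) real_normed_vector
begin

definition norm_ptensor :: "('a, 'b) ptensor \<Rightarrow> real" where
  "norm_ptensor x =
    Inf {(\<Sum>n. norm (u n) * norm (v n)) | u v. tensor_series u v (Rep_ptensor x)}"

definition dist_ptensor :: "('a, 'b) ptensor \<Rightarrow> ('a, 'b) ptensor \<Rightarrow> real"
  where "dist_ptensor x y = norm (x - y)"

definition sgn_ptensor :: "('a, 'b) ptensor \<Rightarrow> ('a, 'b) ptensor"
  where "sgn_ptensor x = inverse (norm x) *\<^sub>R x"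

definition uniformity_ptensor :: "(('a, 'b) ptensor \<times> ('a, 'b) ptensor) filter"
  where "uniformity_ptensor = (INF e\<in>{0<..}. principal {(x, y). dist x y < e})"

definition open_ptensor :: "('a, 'b) ptensor set \<Rightarrow> bool"
  where "open_ptensor S = (\<forall>x\<in>S. \<forall>\<^sub>F (x', y) in uniformity. x' = x \<longrightarrow> y \<in> S)"

lemma norm_ptensor_le:
  fixes x :: "('a, 'b) ptensor"
  assumes "tensor_series u v (Rep_ptensor x)"
  shows "norm x \<le> (\<Sum>n. norm (u n) * norm (v n))"
  unfolding norm_ptensor_def
proof (rule cInf_lower)
  show "bdd_below {(\<Sum>n. norm (u n) * norm (v n)) | u v. tensor_series u v (Rep_ptensor x)}"
    by (rule bdd_belowI[of _ 0]) (auto simp: tensor_series_def intro: suminf_nonneg)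
qed (use assms in blast)

lemma ptensor_rep_less:
  fixes x :: "('a, 'b) ptensor"
  assumes "norm x < e"
  shows "\<exists>u v. tensor_series u v (Rep_ptensor x) \<and> (\<Sum>n. norm (u n) * norm (v n)) < e"
proof -
  have "{(\<Sum>n. norm (u n) * norm (v n)) | u v. tensor_series u v (Rep_ptensor x)} \<noteq> {}"
    using Rep_ptensor[of x] by blast
  from cInf_lessD[OF this assms[unfolded norm_ptensor_def]] show ?thesis by blast
qed

lemma norm_Rep_ptensor_le:
  fixes x :: "('a, 'b) ptensor"
  shows "norm (Rep_ptensor x B) \<le> norm B * norm x"
proof -
  have "norm (Rep_ptensor x B) \<le> norm B * e" if e: "norm x < e" for e
  proof -
    obtain u v where uv: "tensor_series u v (Rep_ptensor x)" "(\<Sum>n. norm (u n) * norm (v n)) < e"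
      using ptensor_rep_less[OF e] by blast
    have "norm (Rep_ptensor x B) \<le> norm B * (\<Sum>n. norm (u n) * norm (v n))"
      by (rule tensor_series_bound[OF uv(1)])
    also have "\<dots> \<le> norm B * e" using uv(2) by (intro mult_left_mono) auto
    finally show ?thesis .
  qed
  then show ?thesis by (rule le_mult_if_greater) auto
qed

lemma norm_ptensor_nonneg: "norm (x :: ('a, 'b) ptensor) \<ge> 0"
  unfolding norm_ptensor_def
proof (rule cInf_greatest)
  show "{(\<Sum>n. norm (u n) * norm (v n)) | u v. tensor_series u v (Rep_ptensor x)} \<noteq> {}"
    using Rep_ptensor[of x] by blast
qed (auto simp: tensor_series_def intro: suminf_nonneg)

lemma norm_ptensor_scaleR_le: "norm (a *\<^sub>R x) \<le> \<bar>a\<bar> * norm (x :: ('a, 'b) ptensor)"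
proof -
  have "norm (a *\<^sub>R x) \<le> \<bar>a\<bar> * e" if e: "norm x < e" for e
  proof -
    obtain u v where uv: "tensor_series u v (Rep_ptensor x)" "(\<Sum>n. norm (u n) * norm (v n)) < e"
      using ptensor_rep_less[OF e] by blast
    have s: "summable (\<lambda>n. norm (u n) * norm (v n))"
      using uv(1) by (simp add: tensor_series_def)
    have "norm (a *\<^sub>R x) \<le> (\<Sum>n. norm (a *\<^sub>R u n) * norm (v n))"
      by (rule norm_ptensor_le) (simp add: scaleR_ptensor.rep_eq tensor_series_scaleR uv(1))
    also have "\<dots> = \<bar>a\<bar> * (\<Sum>n. norm (u n) * norm (v n))"
      by (simp add: mult.assoc suminf_mult[OF s])
    also have "\<dots> \<le> \<bar>a\<bar> * e" using uv(2) by (intro mult_left_mono) auto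
    finally show ?thesis .
  qed
  then show ?thesis by (rule le_mult_if_greater) auto
qed

instance
proof
  fix x y :: "('a, 'b) ptensor" and a :: real
  show "dist x y = norm (x - y)" by (rule dist_ptensor_def)
  show "sgn x = inverse (norm x) *\<^sub>R x" by (rule sgn_ptensor_def)
  show "uniformity = (INF e\<in>{0<..}. principal {(x, y). dist (x :: ('a, 'b) ptensor) y < e})"
    by (rule uniformity_ptensor_def)
  show "open U = (\<forall>x\<in>U. \<forall>\<^sub>F (x', y) in uniformity. x' = x \<longrightarrow> y \<in> U)"
    for U :: "('a, 'b) ptensor set"
    by (rule open_ptensor_def)
  show "norm x = 0 \<longleftrightarrow> x = 0"
  proof
    assume "norm x = 0"
    then have "Rep_ptensor x B = 0" for B using norm_Rep_ptensor_le[of x B] by simp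
    then have "Rep_ptensor x = Rep_ptensor 0"
      by (intro blinfun_eqI) (simp add: zero_ptensor.rep_eq)
    then show "x = 0" by (simp add: Rep_ptensor_inject)
  next
    assume "x = 0"
    then have "norm x \<le> 0"
      using norm_ptensor_le[of "\<lambda>_. 0" "\<lambda>_. 0" x] tensor_series_0
      by (simp add: zero_ptensor.rep_eq)
    then show "norm x = 0" using norm_ptensor_nonneg[of x] by simp
  qed
  show "norm (x + y) \<le> norm x + norm y"
  proof (rule field_le_epsilon)
    fix e :: real assume "e > 0"
    then have "norm x < norm x + e / 2" "norm y < norm y + e / 2" by simp_all
    then obtain u v u' v' where
      uv: "tensor_series u v (Rep_ptensor x)" "(\<Sum>n. norm (u n) * norm (v n)) < norm x + e / 2"
      and uv': "tensor_series u' v' (Rep_ptensor y)" "(\<Sum>n. norm (u' n) * norm (v' n)) < norm y + e / 2"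
      using ptensor_rep_less by meson
    obtain U V where "tensor_series U V (Rep_ptensor (x + y))"
      "(\<Sum>n. norm (U n) * norm (V n)) \<le>
        (\<Sum>n. norm (u n) * norm (v n)) + (\<Sum>n. norm (u' n) * norm (v' n))"
      using tensor_series_add[OF uv(1) uv'(1)] unfolding plus_ptensor.rep_eq by blast
    then show "norm (x + y) \<le> norm x + norm y + e"
      using norm_ptensor_le[of U V "x + y"] uv(2) uv'(2) by linarith
  qed
  show "norm (a *\<^sub>R x) = \<bar>a\<bar> * norm x"
  proof (rule antisym[OF norm_ptensor_scaleR_le])
    show "\<bar>a\<bar> * norm x \<le> norm (a *\<^sub>R x)"
    proof (cases "a = 0")
      case False
      then have "norm x \<le> \<bar>inverse a\<bar> * norm (a *\<^sub>R x)"
        using norm_ptensor_scaleR_le[of "inverse a" "a *\<^sub>R x"] by simp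
      with False show ?thesis by (simp add: field_simps)
    qed (simp add: norm_ptensor_nonneg)
  qed
qed

end

lemma ptensor_summable:
  fixes d :: "nat \<Rightarrow> ('a::real_normed_vector, 'b::real_normed_vector) ptensor"
  assumes "\<And>n. norm (d n) < c n" "summable c"
  shows "\<exists>S. norm S \<le> suminf c \<and> (\<forall>B. (\<lambda>n. blinfun_apply (Rep_ptensor (d n)) B) sums blinfun_apply (Rep_ptensor S) B)"
proof -
  have "\<forall>n. \<exists>u v. tensor_series u v (Rep_ptensor (d n)) \<and> (\<Sum>m. norm (u m) * norm (v m)) < c n"
    using ptensor_rep_less assms(1) by blast
  then obtain u v where uv: "\<And>n. tensor_series (u n) (v n) (Rep_ptensor (d n))"
    "\<And>n. (\<Sum>m. norm (u n m) * norm (v n m)) < c n" by metis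
  obtain U V \<Phi> where P: "tensor_series U V \<Phi>" "(\<Sum>n. norm (U n) * norm (V n)) \<le> suminf c"
    "\<And>B. (\<lambda>n. Rep_ptensor (d n) B) sums \<Phi> B"
    using tensor_series_countable_sum[OF uv(1) less_imp_le[OF uv(2)] assms(2)] by blast
  have "Rep_ptensor (Abs_ptensor \<Phi>) = \<Phi>" using P(1) by (intro Abs_ptensor_inverse) auto
  with P norm_ptensor_le[of U V "Abs_ptensor \<Phi>"] show ?thesis
    by (intro exI[of _ "Abs_ptensor \<Phi>"]) auto
qed

instance ptensor :: (real_normed_vector, real_normed_vector) banach
proof
  fix X :: "nat \<Rightarrow> ('a, 'b) ptensor" assume C: "Cauchy X"
  have "\<forall>n. \<exists>N. \<forall>i\<ge>N. \<forall>j\<ge>N. norm (X i - X j) < (1/2) ^ n"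
    using C unfolding Cauchy_def dist_norm by simp
  then obtain N where N: "\<And>n i j. i \<ge> N n \<Longrightarrow> j \<ge> N n \<Longrightarrow> norm (X i - X j) < (1/2) ^ n"
    by metis
  define s where "s n = n + (\<Sum>i\<le>n. N i)" for n
  have s: "strict_mono s" by (auto simp: strict_mono_Suc_iff s_def)
  have sN: "s n \<ge> N n" for n unfolding s_def by (simp add: sum.atMost_Suc trans_le_add2 member_le_sum)
  define d where "d n = X (s (Suc n)) - X (s n)" for n
  have d: "norm (d n) < (1/2) ^ n" for n
    unfolding d_def using sN[of n] strict_mono_less[OF s, of n "Suc n"] by (intro N) auto
  have tele: "(\<Sum>n<m. d n) = X (s m) - X (s 0)" for m
    unfolding d_def by (rule sum_lessThan_telescope)
  have geo: "summable (\<lambda>n. (1/2::real) ^ (n + m))" for m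
    by (simp add: power_add summable_mult2 summable_geometric)
  have ge: "(\<Sum>n. (1/2::real) ^ (n + m)) = 2 * (1/2) ^ m" for m
    by (simp add: power_add suminf_mult2[symmetric] summable_geometric suminf_geometric)
  have "\<exists>S. norm S \<le> 2 * (1/2) ^ m \<and> (\<forall>B. (\<lambda>n. Rep_ptensor (d (n + m)) B) sums Rep_ptensor S B)" for m
    using ptensor_summable[of "\<lambda>n. d (n + m)" "\<lambda>n. (1/2) ^ (n + m)", OF d geo] unfolding ge .
  then obtain S where S: "\<And>m. norm (S m) \<le> 2 * (1/2) ^ m"
    "\<And>m B. (\<lambda>n. blinfun_apply (Rep_ptensor (d (n + m))) B) sums blinfun_apply (Rep_ptensor (S m)) B"
    by metis
  have Rsum: "blinfun_apply (Rep_ptensor (sum d {..<m})) B = (\<Sum>n<m. Rep_ptensor (d n) B)" for m B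
    by (induction m) (simp_all add: zero_ptensor.rep_eq plus_ptensor.rep_eq blinfun.add_left)
  have Sm: "S m = S 0 - (\<Sum>n<m. d n)" for m
  proof -
    have "Rep_ptensor (S m) B = Rep_ptensor (S 0 - (\<Sum>n<m. d n)) B" for B
    proof -
      have "(\<lambda>n. Rep_ptensor (d n) B) sums Rep_ptensor (S 0) B" using S(2)[of 0 B] by simp
      then have "(\<lambda>n. Rep_ptensor (d (n + m)) B) sums
          (Rep_ptensor (S 0) B - (\<Sum>n<m. Rep_ptensor (d n) B))"
        by (rule sums_split_initial_segment)
      from sums_unique2[OF S(2)[of m B] this] show ?thesis
        by (simp only: Rep_ptensor_minus blinfun.diff_left Rsum)
    qed
    then have "Rep_ptensor (S m) = Rep_ptensor (S 0 - (\<Sum>n<m. d n))" by (rule blinfun_eqI)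
    then show ?thesis by (simp add: Rep_ptensor_inject)
  qed
  have diff: "X (s m) - (S 0 + X (s 0)) = - S m" for m
    unfolding Sm[of m] tele by (simp only: minus_diff_eq diff_diff_eq add.commute)
  have "(\<lambda>m. X (s m) - (S 0 + X (s 0))) \<longlonglongrightarrow> 0"
  proof (rule Lim_null_comparison)
    show "\<forall>\<^sub>F m in sequentially. norm (X (s m) - (S 0 + X (s 0))) \<le> 2 * (1/2) ^ m"
      unfolding diff norm_minus_cancel using S(1) by (intro always_eventually allI)
    show "(\<lambda>m. 2 * (1/2::real) ^ m) \<longlonglongrightarrow> 0"
      using tendsto_mult_right_zero[OF LIMSEQ_power_zero[of "1/2::real"], of 2] by simp
  qed
  then have "(X \<circ> s) \<longlonglongrightarrow> S 0 + X (s 0)" unfolding o_def by (rule LIM_zero_cancel)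
  from Cauchy_converges_subseq[OF C s this] show "convergent X" by (auto simp: convergent_def)
qed

lift_definition tensor ::
  "'a::real_normed_vector \<Rightarrow> 'b::real_normed_vector \<Rightarrow> ('a, 'b) ptensor" (infixl "\<otimes>\<^sub>\<pi>" 70)
  is "\<lambda>u v. Blinfun (\<lambda>B. blinfun_apply (blinfun_apply B u) v)"
proof -
  fix u :: 'a and v :: 'b
  have bl: "bounded_linear (\<lambda>B::'a \<Rightarrow>\<^sub>L 'b \<Rightarrow>\<^sub>L real. blinfun_apply (blinfun_apply B u) v)"
    by (intro bounded_linear_intros)
  define a where "a = (\<lambda>n::nat. if n = 0 then u else 0)"
  define b where "b = (\<lambda>n::nat. if n = 0 then v else 0)"
  have "summable (\<lambda>n. norm (a n) * norm (b n))"
    by (rule summable_finite[of "{0}"]) (simp_all add: a_def)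
  moreover have "(\<lambda>n. blinfun_apply (blinfun_apply B (a n)) (b n)) sums blinfun_apply (blinfun_apply B u) v"
    for B :: "'a \<Rightarrow>\<^sub>L 'b \<Rightarrow>\<^sub>L real"
    using sums_finite[of "{0}" "\<lambda>n. blinfun_apply (blinfun_apply B (a n)) (b n)"]
    by (simp add: a_def b_def)
  ultimately have "tensor_series a b (Blinfun (\<lambda>B. blinfun_apply (blinfun_apply B u) v))"
    by (simp add: tensor_series_def bounded_linear_Blinfun_apply[OF bl])
  then show "\<exists>a b. tensor_series a b (Blinfun (\<lambda>B. blinfun_apply (blinfun_apply B u) v))" by blast
qed


section \<open>Normed spaces with explicit carrier, and maps of class \<open>C\<^bsup>k+\<gamma>\<^esup>\<close>\<close>

instantiation "fun" :: (type, real_vector) real_vector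
begin

definition scaleR_fun :: "real \<Rightarrow> ('a \<Rightarrow> 'b) \<Rightarrow> 'a \<Rightarrow> 'b"
  where "scaleR_fun c f = (\<lambda>x. c *\<^sub>R f x)"

instance
  by standard (simp_all add: scaleR_fun_def fun_eq_iff scaleR_add_right scaleR_add_left)

end

text \<open>
  Spaces of controlled paths depend on a rough path and on real parameters, so they cannot be types.
  A normed space is therefore given by a carrier, a linear subspace of some real vector space,
  together with a norm on it.
\<close>

record 'a nspace =
  carr :: "'a set"
  nrm :: "'a \<Rightarrow> real"

definition type_nspace :: "'a::real_normed_vector nspace"
  where "type_nspace = \<lparr>carr = UNIV, nrm = norm\<rparr>"

definition nspace_open :: "'a::real_vector nspace \<Rightarrow> 'a set \<Rightarrow> bool"
  where "nspace_open E \<Omega> \<longleftrightarrow>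
    \<Omega> \<subseteq> carr E \<and> (\<forall>x\<in>\<Omega>. \<exists>\<delta>>0. \<forall>y\<in>carr E. nrm E (y - x) < \<delta> \<longrightarrow> y \<in> \<Omega>)"

definition nspace_continuous_on ::
  "'a::real_vector nspace \<Rightarrow> 'b::real_vector nspace \<Rightarrow> 'a set \<Rightarrow> ('a \<Rightarrow> 'b) \<Rightarrow> bool"
  where "nspace_continuous_on E F \<Omega> g \<longleftrightarrow>
    (\<forall>x\<in>\<Omega>. \<forall>\<epsilon>>0. \<exists>\<delta>>0. \<forall>y\<in>\<Omega>. nrm E (y - x) < \<delta> \<longrightarrow> nrm F (g y - g x) < \<epsilon>)"

definition nspace_bounded_linear ::
  "'a::real_vector nspace \<Rightarrow> 'b::real_vector nspace \<Rightarrow> ('a \<Rightarrow> 'b) \<Rightarrow> bool"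
  where "nspace_bounded_linear E F L \<longleftrightarrow>
    (\<forall>a\<in>carr E. L a \<in> carr F) \<and>
    (\<forall>a\<in>carr E. \<forall>b\<in>carr E. L (a + b) = L a + L b) \<and>
    (\<forall>c. \<forall>a\<in>carr E. L (c *\<^sub>R a) = c *\<^sub>R L a) \<and>
    (\<exists>C. \<forall>a\<in>carr E. nrm F (L a) \<le> C * nrm E a)"

definition has_fderiv ::
  "'a::real_vector nspace \<Rightarrow> 'b::real_vector nspace \<Rightarrow> 'a set \<Rightarrow> ('a \<Rightarrow> 'b) \<Rightarrow> ('a \<Rightarrow> 'b) \<Rightarrow> 'a \<Rightarrow> bool"
  where "has_fderiv E F \<Omega> g L x \<longleftrightarrow>
    nspace_bounded_linear E F L \<and>
    (\<forall>\<epsilon>>0. \<exists>\<delta>>0. \<forall>h\<in>carr E. x + h \<in> \<Omega> \<and> nrm E h < \<delta> \<longrightarrow>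
      nrm F (g (x + h) - g x - L h) \<le> \<epsilon> * nrm E h)"

lemma has_fderiv_type_nspace:
  "has_fderiv type_nspace type_nspace UNIV f L x \<longleftrightarrow> (f has_derivative L) (at x)"
proof -
  have "nspace_bounded_linear type_nspace type_nspace L \<longleftrightarrow> bounded_linear L"
    by (auto simp: nspace_bounded_linear_def type_nspace_def bounded_linear_def linear_iff
        bounded_linear_axioms_def mult.commute)
  moreover have "(\<forall>h. norm h < \<delta> \<longrightarrow> norm (f (x + h) - f x - L h) \<le> \<epsilon> * norm h) \<longleftrightarrow>
    (\<forall>y. norm (y - x) < \<delta> \<longrightarrow> norm (f y - f x - L (y - x)) \<le> \<epsilon> * norm (y - x))" (is "?A \<longleftrightarrow> ?B")
    for \<delta> \<epsilon>
  proof
    assume A: ?A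
    show ?B
    proof
      fix y show "norm (y - x) < \<delta> \<longrightarrow> norm (f y - f x - L (y - x)) \<le> \<epsilon> * norm (y - x)"
        using A[rule_format, of "y - x"] by simp
    qed
  next
    assume B: ?B
    show ?A
    proof
      fix h show "norm h < \<delta> \<longrightarrow> norm (f (x + h) - f x - L h) \<le> \<epsilon> * norm h"
        using B[rule_format, of "x + h"] by simp
    qed
  qed
  ultimately show ?thesis
    unfolding has_fderiv_def has_derivative_at_alt by (simp add: type_nspace_def)
qed

definition tuples :: "'a nspace \<Rightarrow> nat \<Rightarrow> 'a list set"
  where "tuples E n = {hs. length hs = n \<and> set hs \<subseteq> carr E}"

text \<open>
  The space of continuous \<open>n\<close>-linear maps with the operator norm.  It serves as the space
  \<open>L(E, L(E, \<dots>))\<close> in which the derivative of order \<open>n\<close> takes its values.  Forms are extended by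
  zero outside of \<open>tuples E n\<close>, so that they are determined by their values on this set.
\<close>

definition multilinear_nspace ::
  "'a::real_vector nspace \<Rightarrow> nat \<Rightarrow> 'b::real_vector nspace \<Rightarrow> ('a list \<Rightarrow> 'b) nspace"
  where "multilinear_nspace E n F =
    \<lparr>carr = {M.
       (\<forall>hs\<in>tuples E n. M hs \<in> carr F) \<and>
       (\<forall>hs. hs \<notin> tuples E n \<longrightarrow> M hs = 0) \<and>
       (\<forall>hs\<in>tuples E n. \<forall>i<n. \<forall>a\<in>carr E. \<forall>b\<in>carr E.
          M (hs[i := a + b]) = M (hs[i := a]) + M (hs[i := b])) \<and>
       (\<forall>hs\<in>tuples E n. \<forall>i<n. \<forall>c. \<forall>a\<in>carr E. M (hs[i := c *\<^sub>R a]) = c *\<^sub>R M (hs[i := a])) \<and>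
       (\<exists>C. \<forall>hs\<in>tuples E n. nrm F (M hs) \<le> C * prod_list (map (nrm E) hs))},
     nrm = (\<lambda>M. Inf {C. 0 \<le> C \<and>
       (\<forall>hs\<in>tuples E n. nrm F (M hs) \<le> C * prod_list (map (nrm E) hs))})\<rparr>"

text \<open>
  \<open>holder_class E F \<Omega> k \<gamma> f\<close> says that \<open>f\<close> is of class \<open>C\<^bsup>k+\<gamma>\<^esup>\<close> from the open set \<open>\<Omega>\<close> of \<open>E\<close> to \<open>F\<close>;
  \<open>D j x [h\<^sub>1, \<dots>, h\<^sub>j]\<close> is the derivative of order \<open>j\<close> at \<open>x\<close> applied to \<open>h\<^sub>1, \<dots>, h\<^sub>j\<close>, the
  differentiation that is performed last acting on \<open>h\<^sub>1\<close>.
\<close>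

definition holder_class ::
  "'a::real_vector nspace \<Rightarrow> 'b::real_vector nspace \<Rightarrow> 'a set \<Rightarrow> nat \<Rightarrow> real \<Rightarrow> ('a \<Rightarrow> 'b) \<Rightarrow> bool"
  where "holder_class E F \<Omega> k \<gamma> f \<longleftrightarrow>
    (\<exists>D :: nat \<Rightarrow> 'a \<Rightarrow> 'a list \<Rightarrow> 'b.
      (\<forall>x\<in>\<Omega>. D 0 x [] = f x) \<and>
      (\<forall>j\<le>k. \<forall>x\<in>\<Omega>. D j x \<in> carr (multilinear_nspace E j F)) \<and>
      (\<forall>j<k. \<forall>x\<in>\<Omega>.
         has_fderiv E (multilinear_nspace E j F) \<Omega> (D j) (\<lambda>h hs. D (Suc j) x (h # hs)) x) \<and>
      (\<forall>j\<le>k. \<exists>C. \<forall>x\<in>\<Omega>. nrm (multilinear_nspace E j F) (D j x) \<le> C) \<and>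
      (\<forall>j\<le>k. nspace_continuous_on E (multilinear_nspace E j F) \<Omega> (D j)) \<and>
      (\<exists>C. \<forall>x\<in>\<Omega>. \<forall>y\<in>\<Omega>.
         nrm (multilinear_nspace E k F) (D k x - D k y) \<le> C * nrm E (x - y) powr \<gamma>))"

definition locally_holder_class ::
  "'a::real_vector nspace \<Rightarrow> 'b::real_vector nspace \<Rightarrow> 'a set \<Rightarrow> nat \<Rightarrow> real \<Rightarrow> ('a \<Rightarrow> 'b) \<Rightarrow> bool"
  where "locally_holder_class E F A k \<gamma> f \<longleftrightarrow>
    (\<forall>x\<in>A. \<exists>\<Omega>. nspace_open E \<Omega> \<and> x \<in> \<Omega> \<and> \<Omega> \<subseteq> A \<and> holder_class E F \<Omega> k \<gamma> f)"


section \<open>Rough paths and controlled rough paths\<close>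

text \<open>
  Continuity close to the diagonal is continuity on a neighbourhood of the diagonal of the compact
  simplex, which may be taken to be a strip.
\<close>

definition control :: "real \<Rightarrow> (real \<Rightarrow> real \<Rightarrow> real) \<Rightarrow> bool"
  where "control T \<omega> \<longleftrightarrow>
    (\<forall>s t. 0 \<le> s \<and> s \<le> t \<and> t \<le> T \<longrightarrow> 0 \<le> \<omega> s t) \<and>
    (\<forall>r s t. 0 \<le> r \<and> r \<le> s \<and> s \<le> t \<and> t \<le> T \<longrightarrow> \<omega> r s + \<omega> s t \<le> \<omega> r t) \<and>
    (\<exists>\<delta>>0. continuous_on {(s, t). 0 \<le> s \<and> s \<le> t \<and> t \<le> T \<and> t - s < \<delta>} (\<lambda>(s, t). \<omega> s t))"

definition increment :: "(real \<Rightarrow> 'a::real_normed_vector) \<Rightarrow> real \<Rightarrow> real \<Rightarrow> 'a"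
  where "increment y s t = y t - y s"

definition pvar_bounds ::
  "real \<Rightarrow> (real \<Rightarrow> real \<Rightarrow> real) \<Rightarrow> real \<Rightarrow> (real \<Rightarrow> real \<Rightarrow> 'a::real_normed_vector) \<Rightarrow> real set"
  where "pvar_bounds T \<omega> p X =
    {C. 0 \<le> C \<and> (\<forall>s t. 0 \<le> s \<and> s < t \<and> t \<le> T \<longrightarrow> norm (X s t) \<le> C * \<omega> s t powr (1 / p))}"

definition pvar_finite ::
  "real \<Rightarrow> (real \<Rightarrow> real \<Rightarrow> real) \<Rightarrow> real \<Rightarrow> (real \<Rightarrow> real \<Rightarrow> 'a::real_normed_vector) \<Rightarrow> bool"
  where "pvar_finite T \<omega> p X \<longleftrightarrow> pvar_bounds T \<omega> p X \<noteq> {}"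

text \<open>The seminorm \<open>\<parallel>X\<parallel>\<^sub>p\<close>, to be used only for \<open>X\<close> with \<open>pvar_finite T \<omega> p X\<close>.\<close>

definition pvar_norm ::
  "real \<Rightarrow> (real \<Rightarrow> real \<Rightarrow> real) \<Rightarrow> real \<Rightarrow> (real \<Rightarrow> real \<Rightarrow> 'a::real_normed_vector) \<Rightarrow> real"
  where "pvar_norm T \<omega> p X = Inf (pvar_bounds T \<omega> p X)"

type_synonym 'u two_level = "(real \<Rightarrow> real \<Rightarrow> 'u) \<times> (real \<Rightarrow> real \<Rightarrow> ('u, 'u) ptensor)"

definition rough_path ::
  "real \<Rightarrow> (real \<Rightarrow> real \<Rightarrow> real) \<Rightarrow> real \<Rightarrow> 'u::banach two_level \<Rightarrow> bool"
  where "rough_path T \<omega> p x \<longleftrightarrow>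
    (\<forall>r s t. 0 \<le> r \<and> r \<le> s \<and> s \<le> t \<and> t \<le> T \<longrightarrow>
      fst x r t = fst x r s + fst x s t \<and>
      snd x r t = snd x r s + snd x s t + fst x r s \<otimes>\<^sub>\<pi> fst x s t) \<and>
    pvar_finite T \<omega> p (fst x) \<and> pvar_finite T \<omega> (p / 2) (snd x)"

text \<open>
  A controlled path is a pair \<open>(y, y\<^sup>\<dagger>)\<close>; \<open>remainder x (y, y\<^sup>\<dagger>)\<close> is \<open>y\<^sup>\<sharp>\<close>.
\<close>

type_synonym ('u, 'v) cpath = "(real \<Rightarrow> 'v) \<times> (real \<Rightarrow> 'u \<Rightarrow>\<^sub>L 'v)"

definition remainder ::
  "'u::banach two_level \<Rightarrow> ('u, 'v::banach) cpath \<Rightarrow> real \<Rightarrow> real \<Rightarrow> 'v"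
  where "remainder x y s t = increment (fst y) s t - blinfun_apply (snd y s) (fst x s t)"

text \<open>
  \<open>controlled_nspace T \<omega> q r x\<close> is \<open>P\<^bsub>p,q,r\<^esub>(x, V)\<close>; the regularity \<open>p\<close> of \<open>x\<close> does not occur in its
  definition.  Paths on \<open>[0, T]\<close> are represented by functions that vanish outside of \<open>[0, T]\<close>, which
  makes the norm definite.
\<close>

definition controlled_nspace ::
  "real \<Rightarrow> (real \<Rightarrow> real \<Rightarrow> real) \<Rightarrow> real \<Rightarrow> real \<Rightarrow> 'u::banach two_level \<Rightarrow> ('u, 'v::banach) cpath nspace"
  where "controlled_nspace T \<omega> q r x =
    \<lparr>carr = {y. (\<forall>t. t \<notin> {0..T} \<longrightarrow> fst y t = 0 \<and> snd y t = 0) \<and>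
       pvar_finite T \<omega> q (increment (snd y)) \<and> pvar_finite T \<omega> r (remainder x y)},
     nrm = (\<lambda>y. norm (fst y 0) + norm (snd y 0) +
       pvar_norm T \<omega> q (increment (snd y)) + pvar_norm T \<omega> r (remainder x y))\<rparr>"

definition starred :: "('u::banach, 'v::banach) cpath nspace \<Rightarrow> ('u, 'v) cpath set"
  where "starred P = {y \<in> carr P. fst y 0 = 0 \<and> snd y 0 = 0}"

definition nemytskii ::
  "real \<Rightarrow> ('v::banach \<Rightarrow> 'w::banach) \<Rightarrow> ('u::banach, 'v) cpath \<Rightarrow> ('u, 'w) cpath"
  where "nemytskii T f y =
    ((\<lambda>t. if t \<in> {0..T} then f (fst y t) else 0),
     (\<lambda>t. if t \<in> {0..T} then Blinfun (frechet_derivative f (at (fst y t))) o\<^sub>L snd y t else 0))"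

end

theory Submission
  imports Defs
begin

text \<open>
  The derivative of order \<open>j\<close> of \<open>y \<mapsto> f(y)\<close> in the directions \<open>z\<^sub>1, \<dots>, z\<^sub>j\<close> is the path
  \<open>D\<^sup>jf(y\<^sub>t)[z\<^sub>1\<^sub>t, \<dots>, z\<^sub>j\<^sub>t]\<close>, controlled with the Gubinelli derivative given by the Leibniz rule.
  Two estimates carry the proof.  First, for \<open>g\<close> of class \<open>C\<^bsup>1+\<gamma>\<^esup>\<close>, every increment of
  \<open>g(y) - g(z)\<close> is bounded both by a full power of the control and by \<open>\<parallel>y - z\<parallel>\<^sup>\<gamma>\<close> times a smaller
  power of the control, and interpolation gives the exponent \<open>(1 - \<kappa>)\<gamma>\<close>; this is applied to
  \<open>g = D\<^sup>jf(\<cdot>)[h\<^sub>1, \<dots>, h\<^sub>j]\<close>.  Second, the product of controlled paths is bounded, which replaces the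
  constant \<open>h\<^sub>i\<close> by paths.  Differentiability then follows from the mean value theorem along
  \<open>y + \<theta>h\<close>, since the norm is a supremum of norms of linear functions of the path and its Gubinelli
  derivative; here the symmetry of second derivatives identifies the Gubinelli derivatives.
\<close>

section \<open>Mean value estimates and powers\<close>

text \<open>Why interpolation cannot be avoided: for one path the Taylor error of
  \<open>g(y)\<close> has order (1 + \<gamma>) / p in the control but ignores the distance of two
  paths, while the mean value bound for \<open>g(y) - g(z)\<close> contains the power \<gamma> of
  the distance but only the order 1 / p, no better than that of the rough path. Their weighted
  geometric mean has order \<kappa> (1 + \<gamma>) / p + (1 - \<kappa>) / p = (1 + \<kappa>
  \<gamma>) / p. For the Gubinelli derivative the order is \<kappa> times \<gamma> min(1 / p, 1 /
  q). These are the reciprocal exponents of the target space, up to the minimum with 1 / r. One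
  derivative of \<open>f\<close> is spent on the path structure: the Gubinelli derivative of
  \<open>D^k f(y)\<close> contains \<open>D^(k+1) f\<close>. A single constant \<open>N\<close>
  bounds values, increments and remainder together, so that constants multiply under products. The
  control is bounded by some \<open>W \<ge> 1\<close>, hence any of its powers may be lowered by at
  most 1 at the price of a factor \<open>W\<close>. Bounds on a single lifted derivative come from
  bounds on differences, with the zero path as second path.\<close>

lemma mean_value_affine_bound:
  fixes f :: "real \<Rightarrow> 'b::real_normed_vector"
  assumes f': "\<And>\<theta>. \<theta> \<in> {0..1} \<Longrightarrow> (f has_vector_derivative f' \<theta>) (at \<theta> within {0..1})"
    and B: "\<And>\<theta>. \<theta> \<in> {0..1} \<Longrightarrow> norm (f' \<theta> - L) \<le> B"
  shows "norm (f 1 - f 0 - L) \<le> B"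
proof -
  \<comment> \<open>Subtracting \<open>\<theta> *\<^sub>R L\<close> turns the derivative into
    \<open>f' \<theta> - L\<close>, which \<open>B\<close> bounds.\<close>
  have "norm ((f 1 - 1 *\<^sub>R L) - (f 0 - 0 *\<^sub>R L)) \<le> B * norm (1 - 0 :: real)"
  proof (rule differentiable_bound[where S = "{0..1}" and f' = "\<lambda>\<theta> h. h *\<^sub>R (f' \<theta> - L)"])
    fix \<theta> :: real assume \<theta>: "\<theta> \<in> {0..1}"
    show "((\<lambda>\<theta>. f \<theta> - \<theta> *\<^sub>R L) has_derivative (\<lambda>h. h *\<^sub>R (f' \<theta> - L))) (at \<theta> within {0..1})"
      using f'[OF \<theta>] unfolding has_vector_derivative_def
      by (auto intro!: derivative_eq_intros simp: scaleR_diff_right)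
    show "onorm (\<lambda>h. h *\<^sub>R (f' \<theta> - L)) \<le> B"
      by (rule onorm_le) (use B[OF \<theta>] in \<open>simp add: mult.commute[of B] mult_left_mono\<close>)
  qed auto
  then show ?thesis by (simp add: algebra_simps)
qed

lemma has_derivative_along_line:
  assumes "\<And>v. (g has_derivative g' v) (at v)"
  shows "((\<lambda>\<theta>::real. g (a + \<theta> *\<^sub>R b)) has_vector_derivative g' (a + \<theta> *\<^sub>R b) b) (at \<theta> within S)"
proof -
  have "((\<lambda>\<theta>. a + \<theta> *\<^sub>R b) has_derivative (\<lambda>h. h *\<^sub>R b)) (at \<theta> within S)"
    by (auto intro!: derivative_eq_intros)
  from has_derivative_compose[OF this assms]
  have "((\<lambda>\<theta>. g (a + \<theta> *\<^sub>R b)) has_derivative (\<lambda>h. g' (a + \<theta> *\<^sub>R b) (h *\<^sub>R b))) (at \<theta> within S)" .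
  then show ?thesis
    unfolding has_vector_derivative_def
    by (simp add: linear_scale[OF has_derivative_linear[OF assms]])
qed

lemma lipschitz_from_derivative_bound:
  fixes g :: "'a::real_normed_vector \<Rightarrow> 'b::real_normed_vector"
  assumes d: "\<And>v. (g has_derivative g' v) (at v)" and b: "\<And>v h. norm (g' v h) \<le> K * norm h"
  shows "norm (g v - g w) \<le> K * norm (v - w)"
  using mean_value_affine_bound[of "\<lambda>\<theta>. g (w + \<theta> *\<^sub>R (v - w))"
      "\<lambda>\<theta>. g' (w + \<theta> *\<^sub>R (v - w)) (v - w)" 0 "K * norm (v - w)"]
    has_derivative_along_line[OF d] b by simp

text \<open>Both mixed second derivatives are the limit of the symmetric second difference quotient.\<close>

lemma second_derivative_symmetric:
  fixes g :: "'a::real_normed_vector \<Rightarrow> 'b::real_normed_vector"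
  assumes g': "\<And>v. (g has_derivative g' v) (at v)"
    and g'': "\<And>v a. ((\<lambda>v. g' v a) has_derivative (\<lambda>b. g'' v b a)) (at v)"
    and cont: "\<And>a b. isCont (\<lambda>v. g'' v b a) v0"
  shows "g'' v0 a b = g'' v0 b a"
proof -
  define \<Delta> where "\<Delta> s = g (v0 + s *\<^sub>R a + s *\<^sub>R b) - g (v0 + s *\<^sub>R a) - g (v0 + s *\<^sub>R b) + g v0" for s :: real
  have lin: "g' v (s *\<^sub>R c) = s *\<^sub>R g' v c" for v c and s :: real
    by (rule linear_scale[OF has_derivative_linear[OF g']])
  have lin2: "g'' v (s *\<^sub>R c) d = s *\<^sub>R g'' v c d" for v c d and s :: real
    by (rule linear_scale[OF has_derivative_linear[OF g'']])
  \<comment> \<open>The second difference is an increment in direction \<open>s *\<^sub>R a\<close>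
    of an increment in direction \<open>s *\<^sub>R b\<close>. One mean value bound for each leaves
    \<open>g''\<close> at points within \<open>\<delta>\<close> of \<open>v0\<close>. The vectors
    are generalised because the estimate is used with both orders of \<open>a\<close> and
    \<open>b\<close>.\<close>
  have est: "norm ((g (v0 + s *\<^sub>R a + s *\<^sub>R b) - g (v0 + s *\<^sub>R a)) - (g (v0 + s *\<^sub>R b) - g v0) - (s * s) *\<^sub>R g'' v0 b a) \<le> s * (s * \<epsilon>)"
    if s: "0 < s" "s * (norm a + norm b) < \<delta>"
      and \<delta>: "\<And>v. norm (v - v0) < \<delta> \<Longrightarrow> norm (g'' v b a - g'' v0 b a) \<le> \<epsilon>" for s \<epsilon> \<delta> a b
  proof -
    have inner: "norm (g' (w + s *\<^sub>R b) a - g' w a - s *\<^sub>R g'' v0 b a) \<le> s * \<epsilon>"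
      if w: "w = v0 + \<theta> *\<^sub>R (s *\<^sub>R a)" and \<theta>: "\<theta> \<in> {0..1}" for w \<theta>
    proof -
      have "norm (g' (w + 1 *\<^sub>R (s *\<^sub>R b)) a - g' (w + 0 *\<^sub>R (s *\<^sub>R b)) a - s *\<^sub>R g'' v0 b a) \<le> s * \<epsilon>"
      proof (rule mean_value_affine_bound[OF has_derivative_along_line[OF g'']])
        fix \<tau> :: real assume \<tau>: "\<tau> \<in> {0..1}"
        have "norm (\<theta> *\<^sub>R s *\<^sub>R a + \<tau> *\<^sub>R s *\<^sub>R b) \<le> \<theta> * (s * norm a) + \<tau> * (s * norm b)"
          using s \<theta> \<tau> by (intro order_trans[OF norm_triangle_ineq]) simp
        also have "\<dots> \<le> s * norm a + s * norm b"
          using s \<theta> \<tau> by (intro add_mono mult_left_le_one_le) auto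
        finally have "norm (w + \<tau> *\<^sub>R s *\<^sub>R b - v0) < \<delta>"
          using s by (simp add: w algebra_simps)
        then have "norm (g'' (w + \<tau> *\<^sub>R s *\<^sub>R b) b a - g'' v0 b a) \<le> \<epsilon>" by (rule \<delta>)
        then have "norm (s *\<^sub>R (g'' (w + \<tau> *\<^sub>R s *\<^sub>R b) b a - g'' v0 b a)) \<le> s * \<epsilon>"
          using s by simp
        then show "norm (g'' (w + \<tau> *\<^sub>R s *\<^sub>R b) (s *\<^sub>R b) a - s *\<^sub>R g'' v0 b a) \<le> s * \<epsilon>"
          by (simp add: lin2 scaleR_diff_right)
      qed
      then show ?thesis by simp
    qed
    let ?\<phi> = "\<lambda>\<theta>::real. g (v0 + s *\<^sub>R b + \<theta> *\<^sub>R (s *\<^sub>R a)) - g (v0 + \<theta> *\<^sub>R (s *\<^sub>R a))"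
    have "norm (?\<phi> 1 - ?\<phi> 0 - (s * s) *\<^sub>R g'' v0 b a) \<le> s * (s * \<epsilon>)"
    proof (rule mean_value_affine_bound)
      fix \<theta> :: real assume \<theta>: "\<theta> \<in> {0..1}"
      show "(?\<phi> has_vector_derivative (g' (v0 + s *\<^sub>R b + \<theta> *\<^sub>R (s *\<^sub>R a)) (s *\<^sub>R a)
          - g' (v0 + \<theta> *\<^sub>R (s *\<^sub>R a)) (s *\<^sub>R a))) (at \<theta> within {0..1})"
        by (intro has_vector_derivative_diff has_derivative_along_line g')
      have "norm (s *\<^sub>R (g' (v0 + \<theta> *\<^sub>R (s *\<^sub>R a) + s *\<^sub>R b) a - g' (v0 + \<theta> *\<^sub>R (s *\<^sub>R a)) a - s *\<^sub>R g'' v0 b a)) \<le> s * (s * \<epsilon>)"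
        using inner[OF refl \<theta>] s by simp
      then show "norm (g' (v0 + s *\<^sub>R b + \<theta> *\<^sub>R (s *\<^sub>R a)) (s *\<^sub>R a)
          - g' (v0 + \<theta> *\<^sub>R (s *\<^sub>R a)) (s *\<^sub>R a) - (s * s) *\<^sub>R g'' v0 b a) \<le> s * (s * \<epsilon>)"
        by (simp add: lin scaleR_diff_right add_ac)
    qed
    then show ?thesis by (simp add: algebra_simps)
  qed
  have "norm (g'' v0 a b - g'' v0 b a) \<le> 0"
  proof (rule field_le_epsilon)
    fix e :: real assume e: "e > 0"
    have ex: "\<exists>\<delta>>0. \<forall>v. norm (v - v0) < \<delta> \<longrightarrow> norm (g'' v b a - g'' v0 b a) \<le> e / 2" for a b
      using cont[of b a] half_gt_zero[OF e] unfolding isCont_def LIM_eq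
      by (metis (no_types, lifting) diff_self less_eq_real_def norm_zero)
    obtain \<delta>1 where d1: "\<delta>1 > 0" "\<And>v. norm (v - v0) < \<delta>1 \<Longrightarrow> norm (g'' v b a - g'' v0 b a) \<le> e / 2"
      using ex by blast
    obtain \<delta>2 where d2: "\<delta>2 > 0" "\<And>v. norm (v - v0) < \<delta>2 \<Longrightarrow> norm (g'' v a b - g'' v0 a b) \<le> e / 2"
      using ex by blast
    \<comment> \<open>The summand 1 makes \<open>c\<close> positive and
      \<open>s * (norm a + norm b)\<close> strictly smaller than \<open>s * c\<close>, the smaller
      of the two radii.\<close>
    define c where "c = norm a + norm b + 1"
    define s where "s = min \<delta>1 \<delta>2 / c"
    have c: "c > 0" by (simp add: c_def add_nonneg_pos)
    have s: "s > 0" using d1 d2 c by (simp add: s_def)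
    have sc: "s * c = min \<delta>1 \<delta>2" using c by (simp add: s_def)
    have "s * (norm a + norm b) < s * c" using s by (simp add: c_def)
    then have s12: "s * (norm a + norm b) < \<delta>1" "s * (norm b + norm a) < \<delta>2"
      unfolding sc by (simp_all add: add.commute)
    have A: "norm (\<Delta> s - (s * s) *\<^sub>R g'' v0 b a) \<le> s * (s * (e / 2))"
      using est[OF s s12(1) d1(2)] by (simp add: \<Delta>_def algebra_simps)
    have B: "norm (\<Delta> s - (s * s) *\<^sub>R g'' v0 a b) \<le> s * (s * (e / 2))"
      using est[OF s s12(2) d2(2)] by (simp add: \<Delta>_def algebra_simps)
    have "(s * s) * norm (g'' v0 a b - g'' v0 b a)
        = norm ((\<Delta> s - (s * s) *\<^sub>R g'' v0 b a) - (\<Delta> s - (s * s) *\<^sub>R g'' v0 a b))"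
      using s by (simp flip: scaleR_diff_right)
    also have "\<dots> \<le> s * (s * (e / 2)) + s * (s * (e / 2))"
      by (rule order_trans[OF norm_triangle_ineq4 add_mono[OF A B]])
    also have "\<dots> = (s * s) * e" by simp
    finally show "norm (g'' v0 a b - g'' v0 b a) \<le> 0 + e"
      using s by simp
  qed
  then show ?thesis by simp
qed

text \<open>The surplus exponent \<open>a - b\<close> lies in [0, 1], so the surplus factor is at
  most \<open>W powr (a - b)\<close> and thus at most \<open>W\<close>. This is the only way in
  which powers of the control are lowered.\<close>

lemma powr_le_const_mult_powr:
  fixes w W a b :: real
  assumes "0 \<le> w" "w \<le> W" "1 \<le> W" "b \<le> a" "a \<le> b + 1"
  shows "w powr a \<le> W * w powr b"
proof -
  have "w powr (a - b) \<le> W powr (a - b)" using assms by (intro powr_mono2) auto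
  also have "\<dots> \<le> W powr 1" using assms by (intro powr_mono) auto
  finally have "w powr (a - b) * w powr b \<le> W * w powr b"
    using assms by (intro mult_right_mono) auto
  then show ?thesis by (simp add: powr_add[symmetric])
qed

text \<open>In \<open>c = c powr \<kappa> * c powr (1 - \<kappa>)\<close> each factor may use its
  own bound. The weights add up to 1, so the common constant \<open>C\<close> survives
  unchanged.\<close>

lemma le_powr_interpolation:
  fixes c C a b \<kappa> :: real
  assumes a: "c \<le> C * a" and b: "c \<le> C * b" and "0 \<le> c" "0 \<le> C" "0 \<le> a" "0 \<le> b" "0 < \<kappa>" "\<kappa> < 1"
  shows "c \<le> C * (a powr \<kappa> * b powr (1 - \<kappa>))"
proof (cases "c = 0")
  case False
  then have c: "c > 0" using assms by simp
  have "c = c powr \<kappa> * c powr (1 - \<kappa>)" using c by (simp flip: powr_add)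
  also have "\<dots> \<le> (C * a) powr \<kappa> * (C * b) powr (1 - \<kappa>)"
    using assms c by (intro mult_mono powr_mono2) auto
  also have "\<dots> = (C powr \<kappa> * C powr (1 - \<kappa>)) * (a powr \<kappa> * b powr (1 - \<kappa>))"
    using assms by (simp add: powr_mult)
  also have "C powr \<kappa> * C powr (1 - \<kappa>) = C" using assms by (simp flip: powr_add)
  finally show ?thesis .
qed (use assms in simp)

section \<open>Bounds on controlled paths\<close>

text \<open>\<open>X\<close> stands for the first level of the rough path, \<alpha> for 1 / p, and
  \<open>W\<close> for a bound of the control that is at least 1, as lowering its powers
  requires.\<close>

locale weighted_increments =
  fixes T :: real and \<omega> :: "real \<Rightarrow> real \<Rightarrow> real"
    and X :: "real \<Rightarrow> real \<Rightarrow> 'u::real_normed_vector" and W C\<^sub>X \<alpha> :: real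
  assumes T_nonneg: "0 \<le> T"
    and weight_nonneg: "\<And>s t. 0 \<le> s \<Longrightarrow> s < t \<Longrightarrow> t \<le> T \<Longrightarrow> 0 \<le> \<omega> s t"
    and weight_le: "\<And>s t. 0 \<le> s \<Longrightarrow> s < t \<Longrightarrow> t \<le> T \<Longrightarrow> \<omega> s t \<le> W"
    and W_ge_1: "1 \<le> W"
    and CX_nonneg: "0 \<le> C\<^sub>X"
    and X_le: "\<And>s t. 0 \<le> s \<Longrightarrow> s < t \<Longrightarrow> t \<le> T \<Longrightarrow> norm (X s t) \<le> C\<^sub>X * \<omega> s t powr \<alpha>"
    and \<alpha>_pos: "0 < \<alpha>" and \<alpha>_le_1: "\<alpha> \<le> 1"
begin

text \<open>
  \<open>Z\<close> plays the role of the Gubinelli derivative of \<open>Y\<close>; it is kept as a plain function so that the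
  multilinear formulas below need no bundling into bounded linear maps.
\<close>

definition controlled_bound ::
  "real \<Rightarrow> real \<Rightarrow> real \<Rightarrow> (real \<Rightarrow> 'b::real_normed_vector) \<Rightarrow> (real \<Rightarrow> 'u \<Rightarrow> 'b) \<Rightarrow> bool"
  where "controlled_bound \<beta> \<rho> N Y Z \<longleftrightarrow>
    (\<forall>t\<in>{0..T}. norm (Y t) \<le> N \<and> (\<forall>u. norm (Z t u) \<le> N * norm u)) \<and>
    (\<forall>s t. 0 \<le> s \<and> s < t \<and> t \<le> T \<longrightarrow>
      norm (Y t - Y s) \<le> N * \<omega> s t powr \<alpha> \<and>
      (\<forall>u. norm (Z t u - Z s u) \<le> N * norm u * \<omega> s t powr \<beta>) \<and>
      norm (Y t - Y s - Z s (X s t)) \<le> N * \<omega> s t powr \<rho>)"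

lemma controlled_boundD:
  assumes "controlled_bound \<beta> \<rho> N Y Z"
  shows "t \<in> {0..T} \<Longrightarrow> norm (Y t) \<le> N"
    and "t \<in> {0..T} \<Longrightarrow> norm (Z t u) \<le> N * norm u"
    and "0 \<le> s \<Longrightarrow> s < t \<Longrightarrow> t \<le> T \<Longrightarrow> norm (Y t - Y s) \<le> N * \<omega> s t powr \<alpha>"
    and "0 \<le> s \<Longrightarrow> s < t \<Longrightarrow> t \<le> T \<Longrightarrow> norm (Z t u - Z s u) \<le> N * norm u * \<omega> s t powr \<beta>"
    and "0 \<le> s \<Longrightarrow> s < t \<Longrightarrow> t \<le> T \<Longrightarrow> norm (Y t - Y s - Z s (X s t)) \<le> N * \<omega> s t powr \<rho>"
  using assms unfolding controlled_bound_def by auto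

lemma controlled_bound_nonneg: "controlled_bound \<beta> \<rho> N Y Z \<Longrightarrow> 0 \<le> N"
  using order_trans[OF norm_ge_zero controlled_boundD(1)[of \<beta> \<rho> N Y Z 0]] T_nonneg by simp

lemma controlled_bound_cong:
  assumes "\<And>t. t \<in> {0..T} \<Longrightarrow> Y t = Y' t" "\<And>t u. t \<in> {0..T} \<Longrightarrow> Z t u = Z' t u"
  shows "controlled_bound \<beta> \<rho> N Y Z \<longleftrightarrow> controlled_bound \<beta> \<rho> N Y' Z'"
  using assms unfolding controlled_bound_def by simp

lemma controlled_bound_mono:
  assumes "controlled_bound \<beta> \<rho> N Y Z" "N \<le> N'"
  shows "controlled_bound \<beta> \<rho> N' Y Z"
proof -
  have m: "a \<le> N * c \<Longrightarrow> 0 \<le> c \<Longrightarrow> a \<le> N' * c" for a c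
    using mult_right_mono[OF assms(2), of c] by linarith
  show ?thesis
    unfolding controlled_bound_def
    using controlled_boundD[OF assms(1)] order_trans[OF _ assms(2)]
    by (auto intro!: m simp: mult.assoc)
qed

text \<open>This brings the directions of differentiation, which have the exponents of the source
  space, to the smaller exponents of the target, where products are estimated.\<close>

lemma controlled_bound_weaken:
  assumes b: "controlled_bound \<beta> \<rho> N Y Z"
    and "\<beta>' \<le> \<beta>" "\<beta> \<le> \<beta>' + 1" "\<rho>' \<le> \<rho>" "\<rho> \<le> \<rho>' + 1"
  shows "controlled_bound \<beta>' \<rho>' (W * N) Y Z"
proof -
  note N = controlled_bound_nonneg[OF b]
  have NW: "N \<le> W * N" using N W_ge_1 mult_right_mono[of 1 W N] by simp
  have m: "a \<le> N * c \<Longrightarrow> 0 \<le> c \<Longrightarrow> a \<le> (W * N) * c" for a c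
    using mult_right_mono[OF NW, of c] by linarith
  have le: "N' * \<omega> s t powr e \<le> W * N' * \<omega> s t powr e'"
    if "0 \<le> s" "s < t" "t \<le> T" "e' \<le> e" "e \<le> e' + 1" "0 \<le> N'" for s t e e' N'
    using mult_left_mono[OF powr_le_const_mult_powr[OF weight_nonneg weight_le W_ge_1, of s t e' e] \<open>0 \<le> N'\<close>] that
    by (simp add: mult_ac)
  show ?thesis
    unfolding controlled_bound_def
  proof (intro conjI ballI allI impI; (elim conjE)?)
    fix t u assume "t \<in> {0..T}"
    then show "norm (Y t) \<le> W * N" "norm (Z t u) \<le> W * N * norm u"
      using controlled_boundD(1,2)[OF b] NW by (auto intro!: m intro: order_trans)
  next
    fix s t u assume st: "0 \<le> s" "s < t" "t \<le> T"
    show "norm (Y t - Y s) \<le> W * N * \<omega> s t powr \<alpha>"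
      using controlled_boundD(3)[OF b st] by (rule m) simp
    show "norm (Y t - Y s - Z s (X s t)) \<le> W * N * \<omega> s t powr \<rho>'"
      using controlled_boundD(5)[OF b st] le[OF st, of \<rho>' \<rho> N] assms N by linarith
    show "norm (Z t u - Z s u) \<le> W * N * norm u * \<omega> s t powr \<beta>'"
      using controlled_boundD(4)[OF b st, of u] le[OF st, of \<beta>' \<beta> "N * norm u"] assms N
      by (simp add: mult.assoc)
  qed
qed

lemma controlled_bound_add:
  fixes Y :: "real \<Rightarrow> 'b::real_normed_vector"
  assumes "controlled_bound \<beta> \<rho> N Y Z" "controlled_bound \<beta> \<rho> N' Y' Z'"
  shows "controlled_bound \<beta> \<rho> (N + N') (\<lambda>t. Y t + Y' t) (\<lambda>t u. Z t u + Z' t u)"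
proof -
  note a = controlled_boundD[OF assms(1)] and b = controlled_boundD[OF assms(2)]
  have t: "norm (c + d) \<le> (N + N') * e" if "norm c \<le> N * e" "norm d \<le> N' * e" for c d :: 'b and e
    using norm_triangle_mono[OF that] by (simp add: distrib_right)
  show ?thesis
    unfolding controlled_bound_def
  proof (intro conjI ballI allI impI; (elim conjE)?)
    fix s t u assume st: "0 \<le> s" "s < t" "t \<le> T"
    show "norm ((Y t + Y' t) - (Y s + Y' s)) \<le> (N + N') * \<omega> s t powr \<alpha>"
      using t[OF a(3) b(3), OF st st] by (simp add: algebra_simps)
    show "norm ((Y t + Y' t) - (Y s + Y' s) - (Z s (X s t) + Z' s (X s t))) \<le> (N + N') * \<omega> s t powr \<rho>"
      using t[OF a(5) b(5), OF st st] by (simp add: algebra_simps)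
    show "norm ((Z t u + Z' t u) - (Z s u + Z' s u)) \<le> (N + N') * norm u * \<omega> s t powr \<beta>"
      using norm_triangle_mono[OF a(4) b(4), OF st st, of u u] by (simp add: algebra_simps)
    next
    fix t u assume m: "t \<in> {0..T}"
    show "norm (Y t + Y' t) \<le> N + N'"
      by (rule norm_triangle_mono[OF a(1)[OF m] b(1)[OF m]])
    show "norm (Z t u + Z' t u) \<le> (N + N') * norm u"
      by (rule t[OF a(2)[OF m] b(2)[OF m]])
  qed
qed

lemma controlled_bound_scaleR:
  assumes "controlled_bound \<beta> \<rho> N Y Z"
  shows "controlled_bound \<beta> \<rho> (\<bar>c\<bar> * N) (\<lambda>t. c *\<^sub>R Y t) (\<lambda>t u. c *\<^sub>R Z t u)"
  using controlled_boundD[OF assms] unfolding controlled_bound_def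
  by (auto simp flip: scaleR_diff_right simp: mult.assoc intro!: mult_left_mono)

lemma controlled_bound_const:
  assumes "norm c \<le> N" shows "controlled_bound \<beta> \<rho> N (\<lambda>t. c) (\<lambda>t u. 0)"
  using assms order_trans[OF norm_ge_zero assms] by (simp add: controlled_bound_def)

text \<open>The increment of \<open>Y\<close> is \<open>Z s (X s t)\<close> plus the remainder. The
  first part has order \<alpha> with factor \<open>C\<^sub>X\<close>; lowering \<rho> to \<alpha> in
  the second costs \<open>W\<close>. Hence the increments of \<open>Y\<close> come for free.\<close>

lemma controlled_boundI:
  assumes Y: "\<And>t. t \<in> {0..T} \<Longrightarrow> norm (Y t) \<le> N"
    and Z: "\<And>t u. t \<in> {0..T} \<Longrightarrow> norm (Z t u) \<le> N * norm u"
    and dZ: "\<And>s t u. 0 \<le> s \<Longrightarrow> s < t \<Longrightarrow> t \<le> T \<Longrightarrow> norm (Z t u - Z s u) \<le> N * norm u * \<omega> s t powr \<beta>"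
    and R: "\<And>s t. 0 \<le> s \<Longrightarrow> s < t \<Longrightarrow> t \<le> T \<Longrightarrow> norm (Y t - Y s - Z s (X s t)) \<le> N * \<omega> s t powr \<rho>"
    and \<rho>: "\<alpha> \<le> \<rho>" "\<rho> \<le> \<alpha> + 1"
  shows "controlled_bound \<beta> \<rho> ((C\<^sub>X + W) * N) Y Z"
proof -
  have N: "0 \<le> N" using order_trans[OF norm_ge_zero Y[of 0]] T_nonneg by simp
  have "1 * N \<le> (C\<^sub>X + W) * N" using N W_ge_1 CX_nonneg by (intro mult_right_mono) auto
  then have NC: "N \<le> (C\<^sub>X + W) * N" by simp
  have m: "a \<le> N * c \<Longrightarrow> 0 \<le> c \<Longrightarrow> a \<le> ((C\<^sub>X + W) * N) * c" for a c
    using mult_right_mono[OF NC, of c] by linarith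
  show ?thesis
    unfolding controlled_bound_def
  proof (intro conjI ballI allI impI; (elim conjE)?)
    fix t u assume "t \<in> {0..T}"
    then show "norm (Y t) \<le> (C\<^sub>X + W) * N" "norm (Z t u) \<le> (C\<^sub>X + W) * N * norm u"
      using Y Z NC by (auto intro!: m intro: order_trans)
  next
    fix s t u assume st: "0 \<le> s" "s < t" "t \<le> T"
    show "norm (Y t - Y s - Z s (X s t)) \<le> (C\<^sub>X + W) * N * \<omega> s t powr \<rho>"
      by (rule m[OF R[OF st]]) simp
    show "norm (Z t u - Z s u) \<le> (C\<^sub>X + W) * N * norm u * \<omega> s t powr \<beta>"
      using m[of _ "norm u * \<omega> s t powr \<beta>"] dZ[OF st, of u] by (simp add: mult.assoc)
    have "norm (Y t - Y s) \<le> norm (Y t - Y s - Z s (X s t)) + norm (Z s (X s t))"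
      using norm_triangle_ineq[of "Y t - Y s - Z s (X s t)" "Z s (X s t)"] by simp
    also have "\<dots> \<le> N * \<omega> s t powr \<rho> + N * norm (X s t)"
      using R[OF st] Z[of s] st by (intro add_mono) auto
    also have "\<dots> \<le> N * (W * \<omega> s t powr \<alpha>) + N * (C\<^sub>X * \<omega> s t powr \<alpha>)"
      using N \<rho> X_le[OF st] weight_nonneg[OF st] weight_le[OF st] W_ge_1
      by (intro add_mono mult_left_mono powr_le_const_mult_powr) auto
    finally show "norm (Y t - Y s) \<le> (C\<^sub>X + W) * N * \<omega> s t powr \<alpha>"
      by (simp add: algebra_simps)
  qed
qed

text \<open>The norm of a controlled path sees the values of \<open>Y\<close> and \<open>Z\<close>
  at time 0 only. Adding the increment from 0 bounds \<open>Z\<close> by \<open>(1 + W) * N\<close>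
  at all times; then \<open>Y 0\<close>, the remainder on [0, t] and \<open>Z 0 (X 0 t)\<close> give
  the three summands of the constant.\<close>

lemma controlled_boundI_initial:
  assumes Y: "norm (Y 0) \<le> N" and Z: "\<And>u. norm (Z 0 u) \<le> N * norm u"
    and dZ: "\<And>s t u. 0 \<le> s \<Longrightarrow> s < t \<Longrightarrow> t \<le> T \<Longrightarrow> norm (Z t u - Z s u) \<le> N * norm u * \<omega> s t powr \<beta>"
    and R: "\<And>s t. 0 \<le> s \<Longrightarrow> s < t \<Longrightarrow> t \<le> T \<Longrightarrow> norm (Y t - Y s - Z s (X s t)) \<le> N * \<omega> s t powr \<rho>"
    and \<rho>: "\<alpha> \<le> \<rho>" "\<rho> \<le> 1" and \<beta>: "0 \<le> \<beta>" "\<beta> \<le> 1"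
  shows "controlled_bound \<beta> \<rho> ((C\<^sub>X + W) * ((1 + W + (1 + W) * (C\<^sub>X * W)) * N)) Y Z"
proof -
  have N: "0 \<le> N" using Y norm_ge_zero[of "Y 0"] by linarith
  have W0: "0 \<le> W" using W_ge_1 by simp
  \<comment> \<open>The case \<open>\<omega> s t = 0\<close> is separate because
    \<open>0 powr 0\<close> is 0, so the factor \<open>\<omega> s t powr 0\<close> is 1 only where
    the control does not vanish.\<close>
  have wW: "\<omega> s t powr e \<le> W" if "0 \<le> s" "s < t" "t \<le> T" "0 \<le> e" "e \<le> 1" for s t e
    using powr_le_const_mult_powr[OF weight_nonneg weight_le W_ge_1, of s t 0 e] that
    by (cases "\<omega> s t = 0") (use W0 in auto)
  define N' where "N' = (1 + W + (1 + W) * (C\<^sub>X * W)) * N"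
  have NN': "N \<le> N'" "(1 + W) * N \<le> N'"
    using N W0 CX_nonneg by (auto simp: N'_def algebra_simps intro!: add_nonneg_nonneg)
  have m: "a \<le> N * c \<Longrightarrow> 0 \<le> c \<Longrightarrow> a \<le> N' * c" for a c
    using mult_right_mono[OF NN'(1), of c] by linarith
  have Zt: "norm (Z t u) \<le> (1 + W) * N * norm u" if t: "t \<in> {0..T}" for t u
  proof (cases "t = 0")
    case True
    then show ?thesis using Z[of u] mult_nonneg_nonneg[OF mult_nonneg_nonneg[OF W0 N] norm_ge_zero[of u]]
      by (simp add: algebra_simps)
  next
    case False
    then have t: "0 < t" "t \<le> T" using t by auto
    have "norm (Z t u) \<le> norm (Z 0 u) + norm (Z t u - Z 0 u)"
      using norm_triangle_ineq[of "Z 0 u" "Z t u - Z 0 u"] by simp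
    also have "\<dots> \<le> N * norm u + N * norm u * \<omega> 0 t powr \<beta>"
      using Z dZ[of 0 t u] t by (intro add_mono) auto
    also have "\<dots> \<le> N * norm u + N * norm u * W"
      using N t \<beta> by (intro add_mono mult_left_mono wW) auto
    finally show ?thesis by (simp add: algebra_simps)
  qed
  have Yt: "norm (Y t) \<le> N'" if t: "t \<in> {0..T}" for t
  proof (cases "t = 0")
    case True then show ?thesis using Y NN' by simp
  next
    case False
    then have t: "0 < t" "t \<le> T" using t by auto
    have "norm (Y t) \<le> norm (Y 0) + norm (Y t - Y 0 - Z 0 (X 0 t)) + norm (Z 0 (X 0 t))"
      using norm_triangle_ineq[of "Y t - Y 0 - Z 0 (X 0 t)" "Z 0 (X 0 t)"] norm_triangle_ineq[of "Y 0" "Y t - Y 0"]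
      by simp
    also have "\<dots> \<le> N + N * \<omega> 0 t powr \<rho> + (1 + W) * N * norm (X 0 t)"
      using Y R[of 0 t] t Zt[of 0] T_nonneg by (intro add_mono) auto
    also have "\<dots> \<le> N + N * W + (1 + W) * N * (C\<^sub>X * \<omega> 0 t powr \<alpha>)"
      using N t \<rho> \<alpha>_pos W0 X_le[of 0 t] by (intro add_mono mult_left_mono wW) auto
    also have "\<dots> \<le> N + N * W + (1 + W) * N * (C\<^sub>X * W)"
      using N t \<alpha>_pos \<alpha>_le_1 W0 CX_nonneg by (intro add_mono mult_left_mono wW) auto
    finally show ?thesis by (simp add: N'_def algebra_simps)
  qed
  have "controlled_bound \<beta> \<rho> ((C\<^sub>X + W) * N') Y Z"
  proof (rule controlled_boundI)
    show "norm (Z t u) \<le> N' * norm u" if "t \<in> {0..T}" for t u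
      using Zt[OF that, of u] mult_right_mono[OF NN'(2) norm_ge_zero[of u]] by linarith
    show "norm (Z t u - Z s u) \<le> N' * norm u * \<omega> s t powr \<beta>" if "0 \<le> s" "s < t" "t \<le> T" for s t u
      using m[of _ "norm u * \<omega> s t powr \<beta>"] dZ[OF that, of u] by (simp add: mult.assoc)
    show "norm (Y t - Y s - Z s (X s t)) \<le> N' * \<omega> s t powr \<rho>" if "0 \<le> s" "s < t" "t \<le> T" for s t
      by (rule m[OF R[OF that]]) simp
  qed (use \<rho> \<alpha>_pos Yt in auto)
  then show ?thesis by (simp add: N'_def)
qed

text \<open>Every quantity bounded in \<open>controlled_bound\<close> is a norm of a linear function of the pair \<open>(Y, Z)\<close>.\<close>

lemma controlled_bound_mean_value:
  assumes Y': "\<And>t \<theta>. t \<in> {0..T} \<Longrightarrow> \<theta> \<in> {0..1} \<Longrightarrow>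
      ((\<lambda>\<theta>. Y \<theta> t) has_vector_derivative Y' \<theta> t) (at \<theta> within {0..1})"
    and Z': "\<And>t u \<theta>. t \<in> {0..T} \<Longrightarrow> \<theta> \<in> {0..1} \<Longrightarrow>
      ((\<lambda>\<theta>. Z \<theta> t u) has_vector_derivative Z' \<theta> t u) (at \<theta> within {0..1})"
    and b: "\<And>\<theta>. \<theta> \<in> {0..1} \<Longrightarrow>
      controlled_bound \<beta> \<rho> N (\<lambda>t. Y' \<theta> t - L t) (\<lambda>t u. Z' \<theta> t u - M t u)"
  shows "controlled_bound \<beta> \<rho> N (\<lambda>t. Y (1::real) t - Y 0 t - L t) (\<lambda>t u. Z 1 t u - Z 0 t u - M t u)"
  unfolding controlled_bound_def
proof (intro conjI ballI allI impI; (elim conjE)?)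
  fix t u assume t: "t \<in> {0..T}"
  show "norm (Y 1 t - Y 0 t - L t) \<le> N"
    by (rule mean_value_affine_bound[OF Y'[OF t]]) (use controlled_boundD(1)[OF b t] in auto)
  show "norm (Z 1 t u - Z 0 t u - M t u) \<le> N * norm u"
    by (rule mean_value_affine_bound[OF Z'[OF t]]) (use controlled_boundD(2)[OF b t] in auto)
next
  fix s t u assume st: "0 \<le> s" "s < t" "t \<le> T"
  then have m: "s \<in> {0..T}" "t \<in> {0..T}" by auto
  have "norm ((Y 1 t - Y 1 s) - (Y 0 t - Y 0 s) - (L t - L s)) \<le> N * \<omega> s t powr \<alpha>"
    by (rule mean_value_affine_bound[OF has_vector_derivative_diff[OF Y'[OF m(2)] Y'[OF m(1)]]])
       (use controlled_boundD(3)[OF b st] in \<open>simp_all add: algebra_simps\<close>)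
  then show "norm (Y 1 t - Y 0 t - L t - (Y 1 s - Y 0 s - L s)) \<le> N * \<omega> s t powr \<alpha>"
    by (simp add: algebra_simps)
  have "norm ((Z 1 t u - Z 1 s u) - (Z 0 t u - Z 0 s u) - (M t u - M s u)) \<le> N * norm u * \<omega> s t powr \<beta>"
    by (rule mean_value_affine_bound[OF has_vector_derivative_diff[OF Z'[OF m(2)] Z'[OF m(1)]]])
       (use controlled_boundD(4)[OF b st] in \<open>simp_all add: algebra_simps\<close>)
  then show "norm (Z 1 t u - Z 0 t u - M t u - (Z 1 s u - Z 0 s u - M s u)) \<le> N * norm u * \<omega> s t powr \<beta>"
    by (simp add: algebra_simps)
  have "norm ((Y 1 t - Y 1 s - Z 1 s (X s t)) - (Y 0 t - Y 0 s - Z 0 s (X s t)) - (L t - L s - M s (X s t)))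
      \<le> N * \<omega> s t powr \<rho>"
    by (rule mean_value_affine_bound[OF has_vector_derivative_diff[OF
          has_vector_derivative_diff[OF Y'[OF m(2)] Y'[OF m(1)]] Z'[OF m(1)]]])
       (use controlled_boundD(5)[OF b st] in \<open>simp_all add: algebra_simps\<close>)
  then show "norm (Y 1 t - Y 0 t - L t - (Y 1 s - Y 0 s - L s) - (Z 1 s (X s t) - Z 0 s (X s t) - M s (X s t)))
      \<le> N * \<omega> s t powr \<rho>"
    by (simp add: algebra_simps)
qed

text \<open>
  Each increment of the difference is bounded once by its size for two separate paths, with the
  full power of \<open>\<omega>\<close>, and once by the distance \<open>\<delta>\<close> of the paths; interpolating with weights \<open>\<kappa>\<close> and
  \<open>1 - \<kappa>\<close> trades a part of the regularity in time for Hoelder continuity.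
\<close>

lemma controlled_bound_compose_diff:
  fixes g :: "'b::real_normed_vector \<Rightarrow> 'c::real_normed_vector"
  assumes g': "\<And>v. (g has_derivative g' v) (at v)"
    and K: "\<And>v h. norm (g' v h) \<le> K * norm h"
    and H: "\<And>v w h. norm (g' v h - g' w h) \<le> K * norm (v - w) powr \<gamma> * norm h"
    and K0: "0 \<le> K" and \<gamma>: "0 < \<gamma>" "\<gamma> \<le> 1" and \<kappa>: "0 < \<kappa>" "\<kappa> < 1"
    and y: "controlled_bound \<beta> \<rho> R y y'" and z: "controlled_bound \<beta> \<rho> R z z'"
    and yz: "controlled_bound \<beta> \<rho> \<delta> (\<lambda>t. y t - z t) (\<lambda>t u. y' t u - z' t u)"
    and R: "1 \<le> R" "\<delta> \<le> R" and \<beta>: "0 < \<beta>" "\<beta> \<le> 1" and \<rho>: "\<alpha> < \<rho>" "\<rho> \<le> 1"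
    and \<beta>'_def: "\<beta>' = \<kappa> * \<gamma> * min \<alpha> \<beta>" and \<rho>'_def: "\<rho>' = min \<rho> ((1 + \<kappa> * \<gamma>) * \<alpha>)"
  shows "controlled_bound \<beta>' \<rho>' ((C\<^sub>X + W) * (6 * (K * R * R * W) * \<delta> powr ((1 - \<kappa>) * \<gamma>)))
    (\<lambda>t. g (y t) - g (z t)) (\<lambda>t u. g' (y t) (y' t u) - g' (z t) (z' t u))"
proof (rule controlled_boundI)
  define \<eta> where "\<eta> = (1 - \<kappa>) * \<gamma>"
  define \<mu> where "\<mu> = min \<alpha> \<beta>"
  define e where "e = \<delta> powr \<eta>"
  have \<delta>0: "0 \<le> \<delta>" by (rule controlled_bound_nonneg[OF yz])
  have W0: "0 \<le> W" using W_ge_1 by simp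
  have R0: "0 \<le> R" using R by simp
  have \<mu>: "0 < \<mu>" "\<mu> \<le> \<alpha>" "\<mu> \<le> \<beta>" "\<mu> \<le> 1" using \<alpha>_pos \<beta> by (auto simp: \<mu>_def)
  have \<eta>: "0 < \<eta>" "\<eta> \<le> \<gamma>" "\<eta> \<le> 1"
    using \<kappa> \<gamma> mult_mono[of "1 - \<kappa>" 1 \<gamma> 1] mult_right_mono[of "1 - \<kappa>" 1 \<gamma>] by (auto simp: \<eta>_def)
  have \<kappa>\<gamma>: "0 < \<kappa> * \<gamma>" "\<kappa> * \<gamma> \<le> 1" using \<kappa> \<gamma> mult_mono[of \<kappa> 1 \<gamma> 1] by auto
  \<comment> \<open>Since \<open>\<delta> \<le> R\<close> and \<open>1 \<le> R\<close>, lowering the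
    exponent of \<delta> from 1 to \<gamma>, and then to \<eta>, costs a factor \<open>R\<close>
    each time.\<close>
  have \<delta>_le: "\<delta> \<le> R * \<delta> powr \<gamma>"
    using powr_le_const_mult_powr[of \<delta> R \<gamma> 1] \<delta>0 R \<gamma> by simp
  have \<delta>\<gamma>_le: "\<delta> powr \<gamma> \<le> R * e"
    using powr_le_const_mult_powr[of \<delta> R \<eta> \<gamma>] \<delta>0 R \<gamma> \<eta> by (simp add: e_def)
  have e0: "0 \<le> e" by (simp add: e_def)
  have KR: "0 \<le> K * R" using K0 R0 by simp
  have KRR: "K * R \<le> K * R * R" using mult_left_mono[OF R(1) KR] by simp
  have KRRW: "K * R * R \<le> K * R * R * W"
    using mult_left_mono[OF W_ge_1, of "K * R * R"] KR R0 by simp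
  have P0: "0 \<le> K * R * R * W" using K0 R0 W0 by simp
  have lin: "linear (g' v)" for v by (rule has_derivative_linear[OF g'])
  note y = controlled_boundD[OF y] and z = controlled_boundD[OF z] and yz = controlled_boundD[OF yz]
  have \<omega>_le: "\<omega> s t powr a \<le> W * \<omega> s t powr b" if "0 \<le> s" "s < t" "t \<le> T" "b \<le> a" "a \<le> b + 1" for s t a b
    using powr_le_const_mult_powr[OF weight_nonneg weight_le W_ge_1] that by blast

  \<comment> \<open>Moving the base point uses the Hoelder bound, moving the argument uses
    linearity. The scale \<open>c\<close> of the argument stays free: it is \<open>norm u\<close>
    for the Gubinelli derivative, a power \<alpha> of the control for increments and a power \<rho>
    for remainders.\<close>
  have g'diff: "norm (g' v a - g' w b) \<le> K * R * (\<delta> powr \<gamma> * c) + K * R * (\<delta> powr \<gamma> * c)"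
    if "norm (v - w) \<le> \<delta>" "norm a \<le> R * c" "norm (a - b) \<le> \<delta> * c" "0 \<le> c" for v w a b c
  proof -
    have "norm (g' v a - g' w b) \<le> norm (g' v a - g' w a) + norm (g' w (a - b))"
      using norm_triangle_ineq[of "g' v a - g' w a" "g' w (a - b)"]
      by (simp add: linear_diff[OF lin])
    also have "\<dots> \<le> K * norm (v - w) powr \<gamma> * norm a + K * norm (a - b)"
      by (intro add_mono H K)
    also have "\<dots> \<le> K * \<delta> powr \<gamma> * (R * c) + K * ((R * \<delta> powr \<gamma>) * c)"
      using that K0 \<gamma> R0 \<delta>_le
      by (intro add_mono mult_mono powr_mono2 mult_left_mono order_trans[OF that(3)] mult_right_mono
          mult_nonneg_nonneg) auto
    finally show ?thesis by (simp add: mult_ac)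
  qed
  have g'diff_e: "norm (g' v a - g' w b) \<le> 2 * (K * R * R * W) * e * c"
    if "norm (v - w) \<le> \<delta>" "norm a \<le> R * c" "norm (a - b) \<le> \<delta> * c" "0 \<le> c" for v w a b c
  proof -
    have "norm (g' v a - g' w b) \<le> 2 * (K * R * (\<delta> powr \<gamma> * c))" using g'diff[OF that] by linarith
    also have "\<dots> \<le> 2 * (K * R * ((R * e) * c))"
      using \<delta>\<gamma>_le KR that by (intro mult_left_mono mult_right_mono) auto
    also have "\<dots> = 2 * (K * R * R) * (e * c)" by simp
    also have "\<dots> \<le> 2 * (K * R * R * W) * (e * c)"
      using KRRW e0 that by (intro mult_right_mono) auto
    finally show ?thesis by (simp add: mult.assoc)
  qed
  have gyz: "norm (y t - z t) \<le> \<delta>" if "t \<in> {0..T}" for t using yz(1)[OF that] .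

  show "norm (g (y t) - g (z t)) \<le> 6 * (K * R * R * W) * \<delta> powr ((1 - \<kappa>) * \<gamma>)" if t: "t \<in> {0..T}" for t
  proof -
    have "norm (g (y t) - g (z t)) \<le> K * norm (y t - z t)"
      by (rule lipschitz_from_derivative_bound[OF g' K])
    also have "\<dots> \<le> K * (R * (R * e))"
      using gyz[OF t] \<delta>_le \<delta>\<gamma>_le R0
      by (intro mult_left_mono K0 order_trans[OF gyz[OF t]] order_trans[OF \<delta>_le] mult_left_mono) auto
    also have "\<dots> \<le> (K * R * R * W) * e"
      using mult_right_mono[OF KRRW e0] by (simp add: mult_ac)
    also have "\<dots> \<le> 6 * (K * R * R * W) * e"
      by (intro mult_right_mono) (use P0 e0 in \<open>linarith | simp\<close>)+
    finally show ?thesis by (simp add: e_def \<eta>_def)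
  qed
  show "norm (g' (y t) (y' t u) - g' (z t) (z' t u)) \<le> 6 * (K * R * R * W) * \<delta> powr ((1 - \<kappa>) * \<gamma>) * norm u"
    if t: "t \<in> {0..T}" for t u
  proof -
    have "norm (g' (y t) (y' t u) - g' (z t) (z' t u)) \<le> 2 * (K * R * R * W) * e * norm u"
      by (intro g'diff_e gyz t) (use y(2) yz(2) t in auto)
    also have "\<dots> \<le> 6 * (K * R * R * W) * e * norm u"
      by (intro mult_right_mono) (use P0 e0 in \<open>linarith | simp\<close>)+
    finally show ?thesis by (simp add: e_def \<eta>_def)
  qed

  have pow: "(R * \<omega> s t powr \<alpha>) powr \<gamma> \<le> R * \<omega> s t powr (\<gamma> * \<alpha>)"
    if st: "0 \<le> s" "s < t" "t \<le> T" for s t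
  proof -
    have "(R * \<omega> s t powr \<alpha>) powr \<gamma> = R powr \<gamma> * \<omega> s t powr (\<gamma> * \<alpha>)"
      using R0 by (simp add: powr_mult powr_powr mult.commute)
    also have "\<dots> \<le> R powr 1 * \<omega> s t powr (\<gamma> * \<alpha>)"
      using R \<gamma> by (intro mult_right_mono powr_mono) auto
    finally show ?thesis using R0 by simp
  qed

  \<comment> \<open>For one path alone, the moving base point has order \<gamma> \<alpha> and the
    increment of \<open>v'\<close> has order \<beta>. Both are at least
    \<open>\<gamma> * \<mu>\<close>, the exponent that interpolation multiplies by \<kappa>.\<close>
  have dag: "norm (g' (v t) (v' t u) - g' (v s) (v' s u)) \<le> 2 * (K * R * R * W) * norm u * \<omega> s t powr (\<gamma> * \<mu>)"
    if v: "controlled_bound \<beta> \<rho> R v v'" and st: "0 \<le> s" "s < t" "t \<le> T" for v v' s t u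
  proof -
    note v = controlled_boundD[OF v]
    have "norm (g' (v t) (v' t u) - g' (v s) (v' s u))
        \<le> norm (g' (v t) (v' t u) - g' (v s) (v' t u)) + norm (g' (v s) (v' t u - v' s u))"
      using norm_triangle_ineq[of "g' (v t) (v' t u) - g' (v s) (v' t u)" "g' (v s) (v' t u - v' s u)"]
      by (simp add: linear_diff[OF lin])
    also have "\<dots> \<le> K * norm (v t - v s) powr \<gamma> * norm (v' t u) + K * norm (v' t u - v' s u)"
      by (intro add_mono H K)
    also have "\<dots> \<le> K * (R * \<omega> s t powr \<alpha>) powr \<gamma> * (R * norm u) + K * (R * norm u * \<omega> s t powr \<beta>)"
      using v(2)[of t u] v(3)[OF st] v(4)[OF st, of u] st K0 \<gamma> R0
      by (intro add_mono mult_mono mult_left_mono powr_mono2) auto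
    also have "\<dots> \<le> K * (R * (W * \<omega> s t powr (\<gamma> * \<mu>))) * (R * norm u)
        + K * (R * norm u * (W * \<omega> s t powr (\<gamma> * \<mu>)))"
    proof (intro add_mono mult_left_mono mult_right_mono)
      have "\<omega> s t powr (\<gamma> * \<alpha>) \<le> W * \<omega> s t powr (\<gamma> * \<mu>)"
        using \<gamma> \<mu> \<alpha>_pos \<alpha>_le_1 mult_mono[of \<gamma> 1 \<alpha> 1] mult_nonneg_nonneg[of \<gamma> \<mu>]
        by (intro \<omega>_le st mult_left_mono) linarith+
      then show "(R * \<omega> s t powr \<alpha>) powr \<gamma> \<le> R * (W * \<omega> s t powr (\<gamma> * \<mu>))"
        using pow[OF st] R0 by (meson mult_left_mono order_trans)
      have "\<gamma> * \<mu> \<le> 1 * \<mu>" using \<gamma> \<mu> by (intro mult_right_mono) auto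
      then show "\<omega> s t powr \<beta> \<le> W * \<omega> s t powr (\<gamma> * \<mu>)"
        using \<gamma> \<mu> \<beta> mult_nonneg_nonneg[of \<gamma> \<mu>] by (intro \<omega>_le st) linarith+
    qed (use K0 R0 in auto)
    also have "\<dots> = (K * R * R * W) * norm u * \<omega> s t powr (\<gamma> * \<mu>) + (K * R * W) * norm u * \<omega> s t powr (\<gamma> * \<mu>)"
      by (simp add: mult_ac)
    also have "(K * R * W) * norm u * \<omega> s t powr (\<gamma> * \<mu>) \<le> (K * R * R * W) * norm u * \<omega> s t powr (\<gamma> * \<mu>)"
      by (intro mult_right_mono KRR W0) auto
    finally show ?thesis by simp
  qed

  show "norm (g' (y t) (y' t u) - g' (z t) (z' t u) - (g' (y s) (y' s u) - g' (z s) (z' s u)))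
      \<le> 6 * (K * R * R * W) * \<delta> powr ((1 - \<kappa>) * \<gamma>) * norm u * \<omega> s t powr \<beta>'"
    (is "norm ?d \<le> _") if st: "0 \<le> s" "s < t" "t \<le> T" for s t u
  proof -
    let ?C = "4 * (K * R * R * W) * norm u"
    have C0: "0 \<le> ?C" using KR R0 W0 by simp
    have A: "norm ?d \<le> ?C * \<omega> s t powr (\<gamma> * \<mu>)"
      using norm_triangle_ineq4[of "g' (y t) (y' t u) - g' (y s) (y' s u)" "g' (z t) (z' t u) - g' (z s) (z' s u)"]
        dag[OF assms(9) st, of u] dag[OF assms(10) st, of u]
      by (simp add: algebra_simps)
    have two: "norm (g' (y t) (y' t u) - g' (z t) (z' t u)) \<le> 2 * (K * R * (\<delta> powr \<gamma> * norm u))"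
      if t: "t \<in> {0..T}" for t
      using g'diff[OF gyz[OF t] y(2)[OF t, of u] yz(2)[OF t] norm_ge_zero] by linarith
    have "norm ?d \<le> 4 * (K * R * (\<delta> powr \<gamma> * norm u))"
      using norm_triangle_ineq4[of "g' (y t) (y' t u) - g' (z t) (z' t u)" "g' (y s) (y' s u) - g' (z s) (z' s u)"]
        two[of s] two[of t] st by simp
    also have "\<dots> = 4 * (K * R) * (\<delta> powr \<gamma> * norm u)" by simp
    also have "\<dots> \<le> 4 * (K * R * R * W) * (\<delta> powr \<gamma> * norm u)"
      using KRR KRRW by (intro mult_right_mono) auto
    finally have B: "norm ?d \<le> ?C * \<delta> powr \<gamma>" by (simp add: mult_ac)
    have "norm ?d \<le> ?C * ((\<omega> s t powr (\<gamma> * \<mu>)) powr \<kappa> * (\<delta> powr \<gamma>) powr (1 - \<kappa>))"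
      by (rule le_powr_interpolation[OF A B]) (use C0 \<kappa> in auto)
    also have "\<dots> = ?C * (\<omega> s t powr \<beta>' * e)"
      by (simp add: powr_powr \<beta>'_def \<mu>_def e_def \<eta>_def mult_ac)
    also have "\<dots> \<le> 6 * (K * R * R * W) * norm u * (\<omega> s t powr \<beta>' * e)"
      by (intro mult_right_mono) (use P0 e0 in \<open>linarith | simp\<close>)+
    finally show ?thesis by (simp add: e_def \<eta>_def mult_ac)
  qed

  have G1: "norm (g b - g a - g' a (b - a)) \<le> K * norm (b - a) powr \<gamma> * norm (b - a)" for a b
  proof -
    have "norm (g (a + 1 *\<^sub>R (b - a)) - g (a + 0 *\<^sub>R (b - a)) - g' a (b - a)) \<le> K * norm (b - a) powr \<gamma> * norm (b - a)"
    proof (rule mean_value_affine_bound[OF has_derivative_along_line[OF g']])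
      fix \<theta> :: real assume \<theta>: "\<theta> \<in> {0..1}"
      have "norm (g' (a + \<theta> *\<^sub>R (b - a)) (b - a) - g' a (b - a)) \<le> K * norm (\<theta> *\<^sub>R (b - a)) powr \<gamma> * norm (b - a)"
        using H[of "a + \<theta> *\<^sub>R (b - a)" "b - a" a] by simp
      also have "\<dots> \<le> K * norm (b - a) powr \<gamma> * norm (b - a)"
        using K0 \<gamma> \<theta> by (intro mult_right_mono mult_left_mono powr_mono2) (auto intro: mult_left_le_one_le)
      finally show "norm (g' (a + \<theta> *\<^sub>R (b - a)) (b - a) - g' a (b - a)) \<le> K * norm (b - a) powr \<gamma> * norm (b - a)" .
    qed
    then show ?thesis by simp
  qed
  have taylor: "norm (g (v t) - g (v s) - g' (v s) (v t - v s)) \<le> K * R * R * \<omega> s t powr ((1 + \<gamma>) * \<alpha>)"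
    if v: "controlled_bound \<beta> \<rho> R v v'" and st: "0 \<le> s" "s < t" "t \<le> T" for v v' s t
  proof -
    note vst = controlled_boundD(3)[OF v st]
    have "norm (g (v t) - g (v s) - g' (v s) (v t - v s)) \<le> K * norm (v t - v s) powr \<gamma> * norm (v t - v s)"
      by (rule G1)
    also have "\<dots> \<le> K * (R * \<omega> s t powr \<alpha>) powr \<gamma> * (R * \<omega> s t powr \<alpha>)"
      using vst K0 \<gamma> R0 by (intro mult_mono mult_left_mono powr_mono2) auto
    also have "\<dots> \<le> K * (R * \<omega> s t powr (\<gamma> * \<alpha>)) * (R * \<omega> s t powr \<alpha>)"
      using pow[OF st] K0 R0 by (intro mult_right_mono mult_left_mono) auto
    also have "\<dots> = K * R * R * (\<omega> s t powr \<alpha> * \<omega> s t powr (\<gamma> * \<alpha>))" by simp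
    also have "\<omega> s t powr \<alpha> * \<omega> s t powr (\<gamma> * \<alpha>) = \<omega> s t powr ((1 + \<gamma>) * \<alpha>)"
      by (simp flip: powr_add add: distrib_right)
    finally show ?thesis .
  qed

  show "norm (g (y t) - g (z t) - (g (y s) - g (z s)) - (g' (y s) (y' s (X s t)) - g' (z s) (z' s (X s t))))
      \<le> 6 * (K * R * R * W) * \<delta> powr ((1 - \<kappa>) * \<gamma>) * \<omega> s t powr \<rho>'"
    if st: "0 \<le> s" "s < t" "t \<le> T" for s t
  proof -
    have ms: "s \<in> {0..T}" and mt: "t \<in> {0..T}" using st by auto
    \<comment> \<open>The remainder of the composed path is the Taylor error \<open>?G\<close> plus
      \<open>g'\<close> applied to the remainder of the path. Only the Taylor error is interpolated,
      with constant 4. The other part has order \<rho> and is small with \<delta> at the same time,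
      with constant 2. This is the origin of the 6.\<close>
    let ?G = "\<lambda>v. g (v t) - g (v s) - g' (v s) (v t - v s)"
    let ?r = "\<lambda>v v'. g' (v s) (v t - v s - v' s (X s t))"
    let ?C = "4 * (K * R * R)"
    have C0: "0 \<le> ?C" using KR R0 by simp
    have A: "norm (?G y - ?G z) \<le> ?C * \<omega> s t powr ((1 + \<gamma>) * \<alpha>)"
    proof -
      have "norm (?G y - ?G z) \<le> 2 * (K * R * R * \<omega> s t powr ((1 + \<gamma>) * \<alpha>))"
        using norm_triangle_ineq4[of "?G y" "?G z"] taylor[OF assms(9) st] taylor[OF assms(10) st] by linarith
      also have "\<dots> \<le> ?C * \<omega> s t powr ((1 + \<gamma>) * \<alpha>)" using K0 R0 by simp
      finally show ?thesis .
    qed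
    have B: "norm (?G y - ?G z) \<le> ?C * (\<delta> powr \<gamma> * \<omega> s t powr \<alpha>)"
    proof -
      \<comment> \<open>Points with equal parameter on the segments from \<open>y s\<close> to
        \<open>y t\<close> and from \<open>z s\<close> to \<open>z t\<close> are at most \<delta>
        apart: their difference is a convex combination of the differences at the end
        points.\<close>
      have d: "norm (g' (y s + \<theta> *\<^sub>R (y t - y s)) (y t - y s) - g' (z s + \<theta> *\<^sub>R (z t - z s)) (z t - z s))
          \<le> 2 * (K * R * (\<delta> powr \<gamma> * \<omega> s t powr \<alpha>))" if \<theta>: "\<theta> \<in> {0..1}" for \<theta> :: real
      proof -
        have "y s + \<theta> *\<^sub>R (y t - y s) - (z s + \<theta> *\<^sub>R (z t - z s)) = (1 - \<theta>) *\<^sub>R (y s - z s) + \<theta> *\<^sub>R (y t - z t)"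
          by (simp add: algebra_simps)
        also have "norm \<dots> \<le> (1 - \<theta>) * norm (y s - z s) + \<theta> * norm (y t - z t)"
          using \<theta> by (intro order_trans[OF norm_triangle_ineq]) simp
        also have "\<dots> \<le> (1 - \<theta>) * \<delta> + \<theta> * \<delta>"
          using \<theta> gyz[OF ms] gyz[OF mt] by (intro add_mono mult_left_mono) auto
        finally have 1: "norm (y s + \<theta> *\<^sub>R (y t - y s) - (z s + \<theta> *\<^sub>R (z t - z s))) \<le> \<delta>"
          by (simp add: algebra_simps)
        have 2: "norm (y t - y s - (z t - z s)) \<le> \<delta> * \<omega> s t powr \<alpha>"
          using yz(3)[OF st] by (simp add: algebra_simps)
        from g'diff[OF 1 y(3)[OF st] 2] show ?thesis by simp
      qed
      let ?\<phi> = "\<lambda>\<theta>::real. g (y s + \<theta> *\<^sub>R (y t - y s)) - g (z s + \<theta> *\<^sub>R (z t - z s))"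
      have "norm (?\<phi> 1 - ?\<phi> 0 - (g' (y s) (y t - y s) - g' (z s) (z t - z s)))
          \<le> 4 * (K * R * (\<delta> powr \<gamma> * \<omega> s t powr \<alpha>))"
      proof (rule mean_value_affine_bound[OF has_vector_derivative_diff[OF
              has_derivative_along_line[OF g'] has_derivative_along_line[OF g']]])
        fix \<theta> :: real assume \<theta>: "\<theta> \<in> {0..1}"
        show "norm (g' (y s + \<theta> *\<^sub>R (y t - y s)) (y t - y s) - g' (z s + \<theta> *\<^sub>R (z t - z s)) (z t - z s)
            - (g' (y s) (y t - y s) - g' (z s) (z t - z s))) \<le> 4 * (K * R * (\<delta> powr \<gamma> * \<omega> s t powr \<alpha>))"
          using norm_triangle_ineq4[of "g' (y s + \<theta> *\<^sub>R (y t - y s)) (y t - y s) - g' (z s + \<theta> *\<^sub>R (z t - z s)) (z t - z s)"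
              "g' (y s) (y t - y s) - g' (z s) (z t - z s)"] d[OF \<theta>] d[of 0] by simp
      qed
      also have "\<dots> = 4 * (K * R) * (\<delta> powr \<gamma> * \<omega> s t powr \<alpha>)" by simp
      also have "\<dots> \<le> ?C * (\<delta> powr \<gamma> * \<omega> s t powr \<alpha>)"
        using KRR by (intro mult_right_mono) auto
      finally show ?thesis by (simp add: algebra_simps)
    qed
    have "norm (?G y - ?G z) \<le> ?C * ((\<omega> s t powr ((1 + \<gamma>) * \<alpha>)) powr \<kappa> * (\<delta> powr \<gamma> * \<omega> s t powr \<alpha>) powr (1 - \<kappa>))"
      by (rule le_powr_interpolation[OF A B]) (use C0 \<kappa> in auto)
    also have "(\<omega> s t powr ((1 + \<gamma>) * \<alpha>)) powr \<kappa> * (\<delta> powr \<gamma> * \<omega> s t powr \<alpha>) powr (1 - \<kappa>)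
        = \<delta> powr \<eta> * \<omega> s t powr ((1 + \<gamma>) * \<alpha> * \<kappa> + \<alpha> * (1 - \<kappa>))"
      using \<delta>0 weight_nonneg[OF st] by (simp add: powr_powr powr_mult powr_add \<eta>_def mult_ac)
    also have "(1 + \<gamma>) * \<alpha> * \<kappa> + \<alpha> * (1 - \<kappa>) = (1 + \<kappa> * \<gamma>) * \<alpha>" by (simp add: algebra_simps)
    also have "?C * (\<delta> powr \<eta> * \<omega> s t powr ((1 + \<kappa> * \<gamma>) * \<alpha>)) \<le> ?C * (e * (W * \<omega> s t powr \<rho>'))"
    proof -
      have "0 < \<rho>'" "(1 + \<kappa> * \<gamma>) * \<alpha> \<le> \<alpha> + 1 * 1" "\<alpha> \<le> \<rho>'"
        using \<kappa>\<gamma> \<alpha>_pos \<alpha>_le_1 \<rho> mult_mono[of "\<kappa> * \<gamma>" 1 \<alpha> 1] mult_pos_pos[OF \<kappa>\<gamma>(1) \<alpha>_pos]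
        unfolding \<rho>'_def distrib_right by linarith+
      then show ?thesis
        using C0 e0 unfolding e_def[symmetric]
        by (intro mult_left_mono \<omega>_le st) (auto simp: \<rho>'_def)
    qed
    finally have 1: "norm (?G y - ?G z) \<le> 4 * (K * R * R * W) * e * \<omega> s t powr \<rho>'"
      by (simp add: mult_ac)
    have 2: "norm (?r y y' - ?r z z') \<le> 2 * (K * R * R * W) * e * \<omega> s t powr \<rho>'"
    proof -
      have "norm (?r y y' - ?r z z') \<le> 2 * (K * R * (\<delta> powr \<gamma> * \<omega> s t powr \<rho>))"
      proof -
        have "norm (y t - y s - y' s (X s t) - (z t - z s - z' s (X s t))) \<le> \<delta> * \<omega> s t powr \<rho>"
          using yz(5)[OF st] by (simp add: algebra_simps)
        from g'diff[OF gyz[OF ms] y(5)[OF st] this] show ?thesis by simp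
      qed
      also have "\<dots> \<le> 2 * (K * R * ((R * e) * (W * \<omega> s t powr \<rho>')))"
      proof -
        have "\<rho>' \<le> \<rho>" "\<alpha> \<le> \<rho>'"
          using \<rho> \<alpha>_pos mult_pos_pos[OF \<kappa>\<gamma>(1) \<alpha>_pos] unfolding \<rho>'_def distrib_right by linarith+
        then show ?thesis
          using \<delta>\<gamma>_le KR R0 e0 \<rho> \<alpha>_pos by (intro mult_left_mono mult_mono \<omega>_le st) auto
      qed
      finally show ?thesis by (simp add: mult_ac)
    qed
    have "norm ((?G y - ?G z) + (?r y y' - ?r z z')) \<le> 6 * (K * R * R * W) * e * \<omega> s t powr \<rho>'"
      using norm_triangle_ineq[of "?G y - ?G z" "?r y y' - ?r z z'"] 1 2 by linarith
    moreover have "g (y t) - g (z t) - (g (y s) - g (z s)) - (g' (y s) (y' s (X s t)) - g' (z s) (z' s (X s t)))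
        = (?G y - ?G z) + (?r y y' - ?r z z')"
      by (simp add: linear_diff[OF lin])
    ultimately show ?thesis unfolding e_def \<eta>_def by (simp only:)
  qed
  show "\<alpha> \<le> \<rho>'" "\<rho>' \<le> \<alpha> + 1"
    using \<rho> \<alpha>_pos mult_pos_pos[OF \<kappa>\<gamma>(1) \<alpha>_pos] unfolding \<rho>'_def distrib_right by linarith+
qed

text \<open>Increments of \<open>A\<close> and \<open>z\<close>, of order \<alpha>, enter the
  Gubinelli derivative of the product, whence \<open>\<beta> \<le> \<alpha>\<close>; the product of
  two increments enters its remainder, whence \<open>\<rho> \<le> 2 * \<alpha>\<close>. Bounding
  \<open>A\<close> for every constant \<open>h\<close>, linearly in \<open>norm h\<close>, expresses
  operator norms without forming operators.\<close>

lemma controlled_bound_bilinear: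
  fixes A :: "real \<Rightarrow> 'b::real_normed_vector \<Rightarrow> 'c::real_normed_vector"
  assumes A: "\<And>h. controlled_bound \<beta> \<rho> (M * norm h) (\<lambda>t. A t h) (\<lambda>t u. B t u h)"
    and linA: "\<And>t. t \<in> {0..T} \<Longrightarrow> linear (A t)" and linB: "\<And>t u. t \<in> {0..T} \<Longrightarrow> linear (B t u)"
    and z: "controlled_bound \<beta> \<rho> N z z'"
    and M: "0 \<le> M" and \<beta>: "\<beta> \<le> \<alpha>" "0 \<le> \<beta>" and \<rho>: "\<rho> \<le> 2 * \<alpha>" "\<alpha> \<le> \<rho>"
  shows "controlled_bound \<beta> \<rho> ((C\<^sub>X + W) * (4 * W * (M * N)))
    (\<lambda>t. A t (z t)) (\<lambda>t u. B t u (z t) + A t (z' t u))"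
proof (rule controlled_boundI)
  note N = controlled_bound_nonneg[OF z]
  note z = controlled_boundD[OF z] and A = controlled_boundD[OF A]
  have MN: "0 \<le> M * N" using M N by simp
  have W0: "0 \<le> W" using W_ge_1 by simp
  have MNW: "M * N \<le> W * (M * N)" using mult_right_mono[OF W_ge_1 MN] by simp
  have \<omega>_le: "\<omega> s t powr a \<le> W * \<omega> s t powr b" if "0 \<le> s" "s < t" "t \<le> T" "b \<le> a" "a \<le> b + 1" for s t a b
    using powr_le_const_mult_powr[OF weight_nonneg weight_le W_ge_1] that by blast
  have up: "a \<le> M * (N * c)" if "a \<le> M * b" "b \<le> N * c" for a b c
    using that mult_left_mono[OF that(2) M] by linarith
  show "norm (A t (z t)) \<le> 4 * W * (M * N)" if t: "t \<in> {0..T}" for t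
    using up[OF A(1)[OF t], of "z t" 1] z(1)[OF t] MNW MN by simp
  show "norm (B t u (z t) + A t (z' t u)) \<le> 4 * W * (M * N) * norm u" if t: "t \<in> {0..T}" for t u
  proof -
    have "norm (B t u (z t)) \<le> M * (N * norm u)"
      using up[of _ "norm (z t) * norm u" "norm u"] A(2)[OF t, of u "z t"] mult_right_mono[OF z(1)[OF t] norm_ge_zero[of u]]
      by (simp add: mult_ac)
    moreover have "norm (A t (z' t u)) \<le> M * (N * norm u)"
      by (rule up[OF A(1)[OF t] z(2)[OF t]])
    ultimately have "norm (B t u (z t) + A t (z' t u)) \<le> 2 * ((M * N) * norm u)"
      using norm_triangle_ineq[of "B t u (z t)" "A t (z' t u)"] by (simp add: mult_ac)
    also have "\<dots> \<le> 4 * ((W * (M * N)) * norm u)"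
      using mult_right_mono[OF MNW norm_ge_zero[of u]] mult_nonneg_nonneg[OF MN norm_ge_zero[of u]] by linarith
    finally show ?thesis by (simp add: mult_ac)
  qed
  fix s t u assume st: "0 \<le> s" "s < t" "t \<le> T"
  then have ms: "s \<in> {0..T}" and mt: "t \<in> {0..T}" by auto
  note dA = linear_diff[OF linA[OF ms]] linear_diff[OF linA[OF mt]]
    and dB = linear_diff[OF linB[OF ms]] linear_diff[OF linB[OF mt]]
  show "norm (B t u (z t) + A t (z' t u) - (B s u (z s) + A s (z' s u))) \<le> 4 * W * (M * N) * norm u * \<omega> s t powr \<beta>"
  proof -
    have a\<beta>: "\<omega> s t powr \<alpha> \<le> W * \<omega> s t powr \<beta>" using \<beta> \<alpha>_le_1 by (intro \<omega>_le st) auto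
    have \<beta>\<beta>: "\<omega> s t powr \<beta> \<le> W * \<omega> s t powr \<beta>" by (intro \<omega>_le st) auto
    have le: "a \<le> W * (M * N) * norm u * \<omega> s t powr \<beta>"
      if "a \<le> M * b" "b \<le> N * norm u * c" "c \<le> W * \<omega> s t powr \<beta>" for a b c
    proof -
      have "a \<le> (M * N * norm u) * c" using up[OF that(1), of "norm u * c"] that(2) by (simp add: mult_ac)
      also have "\<dots> \<le> (M * N * norm u) * (W * \<omega> s t powr \<beta>)" using that(3) MN by (intro mult_left_mono) auto
      finally show ?thesis by (simp add: mult_ac)
    qed
    have 1: "norm (B t u (z t) - B s u (z t)) \<le> W * (M * N) * norm u * \<omega> s t powr \<beta>"
      by (rule le[of _ "norm (z t) * norm u * \<omega> s t powr \<beta>" "\<omega> s t powr \<beta>"])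
         (use A(4)[OF st, of u "z t"] z(1)[OF mt] \<beta>\<beta> in \<open>auto simp: mult.assoc intro!: mult_right_mono\<close>)
    have 2: "norm (B s u (z t - z s)) \<le> W * (M * N) * norm u * \<omega> s t powr \<beta>"
      by (rule le[of _ "norm (z t - z s) * norm u" "\<omega> s t powr \<alpha>"])
         (use A(2)[OF ms, of u "z t - z s"] mult_right_mono[OF z(3)[OF st] norm_ge_zero[of u]] a\<beta> in \<open>auto simp: mult_ac\<close>)
    have 3: "norm (A t (z' t u) - A s (z' t u)) \<le> W * (M * N) * norm u * \<omega> s t powr \<beta>"
      by (rule le[of _ "norm (z' t u) * \<omega> s t powr \<alpha>" "\<omega> s t powr \<alpha>"])
         (use A(3)[OF st, of "z' t u"] z(2)[OF mt, of u] a\<beta> in \<open>auto simp: mult.assoc intro!: mult_right_mono\<close>,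
          use mult_right_mono[OF z(2)[OF mt, of u], of "\<omega> s t powr \<alpha>"] in \<open>simp add: mult.assoc\<close>)
    have 4: "norm (A s (z' t u - z' s u)) \<le> W * (M * N) * norm u * \<omega> s t powr \<beta>"
      by (rule le[of _ "norm (z' t u - z' s u)" "\<omega> s t powr \<beta>"])
         (use A(1)[OF ms] z(4)[OF st, of u] \<beta>\<beta> in auto)
    \<comment> \<open>One factor moves at a time in each of the two products; the four terms give
      the 4 of the constant.\<close>
    have "B t u (z t) + A t (z' t u) - (B s u (z s) + A s (z' s u))
        = ((B t u (z t) - B s u (z t)) + B s u (z t - z s)) + ((A t (z' t u) - A s (z' t u)) + A s (z' t u - z' s u))"
      by (simp add: dA dB)
    also have "norm \<dots> \<le> 4 * (W * (M * N) * norm u * \<omega> s t powr \<beta>)"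
      using norm_triangle_mono[OF norm_triangle_mono[OF 1 2] norm_triangle_mono[OF 3 4]] by linarith
    finally show ?thesis by (simp add: mult_ac)
  qed
  show "norm (A t (z t) - A s (z s) - (B s (X s t) (z s) + A s (z' s (X s t)))) \<le> 4 * W * (M * N) * \<omega> s t powr \<rho>"
  proof -
    have "norm (A t (z t - z s) - A s (z t - z s)) \<le> M * norm (z t - z s) * \<omega> s t powr \<alpha>"
      by (rule A(3)[OF st])
    also have "\<dots> \<le> M * (N * \<omega> s t powr \<alpha>) * \<omega> s t powr \<alpha>"
      using z(3)[OF st] M by (intro mult_right_mono mult_left_mono) auto
    also have "\<dots> = (M * N) * \<omega> s t powr (2 * \<alpha>)"
      by (simp flip: powr_add add: mult.assoc)
    also have "\<dots> \<le> (M * N) * (W * \<omega> s t powr \<rho>)"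
      using MN \<rho> \<alpha>_le_1 by (intro mult_left_mono \<omega>_le st) auto
    finally have 1: "norm (A t (z t - z s) - A s (z t - z s)) \<le> W * (M * N) * \<omega> s t powr \<rho>"
      by (simp add: mult_ac)
    have "norm (A t (z s) - A s (z s) - B s (X s t) (z s)) \<le> M * norm (z s) * \<omega> s t powr \<rho>"
      by (rule A(5)[OF st])
    also have "\<dots> \<le> (M * N) * \<omega> s t powr \<rho>"
      using z(1)[OF ms] M by (intro mult_right_mono mult_left_mono) auto
    also have "\<dots> \<le> W * (M * N) * \<omega> s t powr \<rho>" using MNW by (intro mult_right_mono) auto
    finally have 2: "norm (A t (z s) - A s (z s) - B s (X s t) (z s)) \<le> W * (M * N) * \<omega> s t powr \<rho>" .
    have "norm (A s (z t - z s - z' s (X s t))) \<le> M * (N * \<omega> s t powr \<rho>)"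
      by (rule up[OF A(1)[OF ms] z(5)[OF st]])
    also have "\<dots> = (M * N) * \<omega> s t powr \<rho>" by simp
    also have "\<dots> \<le> W * (M * N) * \<omega> s t powr \<rho>" using MNW by (intro mult_right_mono) auto
    finally have 3: "norm (A s (z t - z s - z' s (X s t))) \<le> W * (M * N) * \<omega> s t powr \<rho>" .
    have "A t (z t) - A s (z s) - (B s (X s t) (z s) + A s (z' s (X s t)))
        = (A t (z t - z s) - A s (z t - z s)) + (A t (z s) - A s (z s) - B s (X s t) (z s)) + A s (z t - z s - z' s (X s t))"
      by (simp add: dA)
    also have "norm \<dots> \<le> 3 * (W * (M * N) * \<omega> s t powr \<rho>)"
      using norm_triangle_mono[OF norm_triangle_mono[OF 1 2] 3] by linarith
    also have "\<dots> \<le> 4 * (W * (M * N) * \<omega> s t powr \<rho>)"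
      by (intro mult_right_mono mult_nonneg_nonneg W0 MN) auto
    finally show ?thesis by (simp add: mult_ac)
  qed
qed (use \<rho> \<alpha>_le_1 in auto)

end

section \<open>Multilinear families\<close>

definition multilinear_list :: "nat \<Rightarrow> ('b::real_vector list \<Rightarrow> 'c::real_vector) \<Rightarrow> bool"
  where "multilinear_list n M \<longleftrightarrow> (\<forall>hs i. length hs = n \<longrightarrow> i < n \<longrightarrow> linear (\<lambda>a. M (hs[i := a])))"

lemma multilinear_list_linear:
  "multilinear_list n M \<Longrightarrow> length hs = n \<Longrightarrow> i < n \<Longrightarrow> linear (\<lambda>a. M (hs[i := a]))"
  by (simp add: multilinear_list_def)

lemma multilinear_list_hd: "multilinear_list (Suc n) M \<Longrightarrow> length hs = n \<Longrightarrow> linear (\<lambda>a. M (a # hs))"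
  using multilinear_list_linear[of "Suc n" M "undefined # hs" 0] by simp

lemma multilinear_list_Cons: "multilinear_list (Suc n) M \<Longrightarrow> multilinear_list n (\<lambda>hs. M (a # hs))"
  unfolding multilinear_list_def
proof (intro allI impI)
  fix hs :: "'a list" and i
  assume M: "\<forall>hs i. length hs = Suc n \<longrightarrow> i < Suc n \<longrightarrow> linear (\<lambda>a. M (hs[i := a]))"
    and "length hs = n" "i < n"
  then show "linear (\<lambda>b. M (a # hs[i := b]))"
    using M[rule_format, of "a # hs" "Suc i"] by simp
qed

lemma multilinear_list_add:
  "multilinear_list n M \<Longrightarrow> multilinear_list n M' \<Longrightarrow> multilinear_list n (\<lambda>hs. M hs + M' hs)"
  unfolding multilinear_list_def by (auto intro: linear_compose_add)

lemma multilinear_list_diff: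
  "multilinear_list n M \<Longrightarrow> multilinear_list n M' \<Longrightarrow> multilinear_list n (\<lambda>hs. M hs - M' hs)"
  unfolding multilinear_list_def by (auto intro: linear_compose_sub)

text \<open>
  For a path \<open>A\<close> of multilinear maps with Gubinelli derivative \<open>B\<close>, these are the path
  \<open>A\<^sub>t[z\<^sub>1\<^sub>t, \<dots>, z\<^sub>n\<^sub>t]\<close> and its Gubinelli derivative, given by the Leibniz rule.
\<close>

definition multilinear_path ::
  "(real \<Rightarrow> 'b list \<Rightarrow> 'c) \<Rightarrow> ((real \<Rightarrow> 'b) \<times> 'd) list \<Rightarrow> real \<Rightarrow> 'c"
  where "multilinear_path A zs t = A t (map (\<lambda>z. fst z t) zs)"

definition multilinear_dagger ::
  "(real \<Rightarrow> 'b list \<Rightarrow> 'c) \<Rightarrow> (real \<Rightarrow> 'u \<Rightarrow> 'b list \<Rightarrow> 'c) \<Rightarrow>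
    ((real \<Rightarrow> 'b::real_normed_vector) \<times> (real \<Rightarrow> 'u::real_normed_vector \<Rightarrow>\<^sub>L 'b)) list \<Rightarrow>
    real \<Rightarrow> 'u \<Rightarrow> 'c::real_normed_vector"
  where "multilinear_dagger A B zs t u = B t u (map (\<lambda>z. fst z t) zs) +
    (\<Sum>i<length zs. A t ((map (\<lambda>z. fst z t) zs)[i := blinfun_apply (snd (zs ! i) t) u]))"

lemma multilinear_path_Cons:
  "multilinear_path A (z # zs) = multilinear_path (\<lambda>t hs. A t (fst z t # hs)) zs"
  by (simp add: multilinear_path_def fun_eq_iff)

lemma multilinear_dagger_Cons:
  "multilinear_dagger A B (z # zs) = multilinear_dagger (\<lambda>t hs. A t (fst z t # hs))
    (\<lambda>t u hs. B t u (fst z t # hs) + A t (blinfun_apply (snd z t) u # hs)) zs"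
  by (simp add: multilinear_dagger_def fun_eq_iff sum.lessThan_Suc_shift add.assoc del: sum.lessThan_Suc)

text \<open>The summand of index 0 in the Leibniz sum is moved into the Gubinelli derivative of the
  maps whose first slot is filled by \<open>z\<close>. In this form the product rule for linear maps
  inserts one path after the other.\<close>

lemma multilinear_dagger_diff:
  "multilinear_dagger (\<lambda>t hs. A t hs - A' t hs) (\<lambda>t u hs. B t u hs - B' t u hs) zs t u =
    multilinear_dagger A B zs t u - multilinear_dagger A' B' zs t u"
  by (simp add: multilinear_dagger_def sum_subtractf)

context weighted_increments
begin

text \<open>Induction on the paths, with \<open>A\<close>, \<open>B\<close> and \<open>M\<close>
  arbitrary: inserting the first path by the product rule gives again a path of multilinear maps,
  with one slot less, and multiplies the constant by the bound of that path and by
  \<open>(C\<^sub>X + W) * (4 * W)\<close>.\<close>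

lemma controlled_bound_multilinear:
  fixes A :: "real \<Rightarrow> 'b::real_normed_vector list \<Rightarrow> 'c::real_normed_vector"
  assumes A: "\<And>hs. length hs = length zs \<Longrightarrow>
      controlled_bound \<beta> \<rho> (M * prod_list (map norm hs)) (\<lambda>t. A t hs) (\<lambda>t u. B t u hs)"
    and mA: "\<And>t. t \<in> {0..T} \<Longrightarrow> multilinear_list (length zs) (A t)"
    and mB: "\<And>t u. t \<in> {0..T} \<Longrightarrow> multilinear_list (length zs) (B t u)"
    and z: "\<And>z. z \<in> set zs \<Longrightarrow> controlled_bound \<beta> \<rho> (N z) (fst z) (\<lambda>t. blinfun_apply (snd z t))"
    and M: "0 \<le> M" and \<beta>: "\<beta> \<le> \<alpha>" "0 \<le> \<beta>" and \<rho>: "\<rho> \<le> 2 * \<alpha>" "\<alpha> \<le> \<rho>"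
  shows "controlled_bound \<beta> \<rho> (((C\<^sub>X + W) * (4 * W)) ^ length zs * (M * prod_list (map N zs)))
    (multilinear_path A zs) (multilinear_dagger A B zs)"
  using A mA mB z M
proof (induction zs arbitrary: A B M)
  case Nil
  then show ?case using Nil(1)[of "[]"] by (simp add: multilinear_path_def[abs_def] multilinear_dagger_def[abs_def])
next
  case (Cons z zs)
  let ?C = "(C\<^sub>X + W) * (4 * W)"
  have C0: "0 \<le> ?C" using CX_nonneg W_ge_1 by simp
  have z: "controlled_bound \<beta> \<rho> (N z) (fst z) (\<lambda>t. blinfun_apply (snd z t))" using Cons.prems by simp
  have N0: "0 \<le> N z" by (rule controlled_bound_nonneg[OF z])
  have "controlled_bound \<beta> \<rho> (?C ^ length zs * ((?C * (M * N z)) * prod_list (map N zs)))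
    (multilinear_path (\<lambda>t hs. A t (fst z t # hs)) zs)
    (multilinear_dagger (\<lambda>t hs. A t (fst z t # hs))
      (\<lambda>t u hs. B t u (fst z t # hs) + A t (blinfun_apply (snd z t) u # hs)) zs)"
  proof (rule Cons.IH)
    fix hs :: "'b list" assume l: "length hs = length zs"
    have P0: "0 \<le> prod_list (map norm hs)" by (rule prod_list_nonneg) auto
    have "controlled_bound \<beta> \<rho> ((C\<^sub>X + W) * (4 * W * ((M * prod_list (map norm hs)) * N z)))
       (\<lambda>t. A t (fst z t # hs)) (\<lambda>t u. B t u (fst z t # hs) + A t (blinfun_apply (snd z t) u # hs))"
    proof (rule controlled_bound_bilinear[where A = "\<lambda>t a. A t (a # hs)" and B = "\<lambda>t u a. B t u (a # hs)", OF _ _ _ z])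
      show "controlled_bound \<beta> \<rho> (M * prod_list (map norm hs) * norm h) (\<lambda>t. A t (h # hs)) (\<lambda>t u. B t u (h # hs))" for h
        using Cons.prems(1)[of "h # hs"] l by (simp add: mult_ac)
    qed (use Cons.prems(2,3,5) l P0 \<beta> \<rho> in \<open>auto intro!: multilinear_list_hd[where n = "length zs"]\<close>)
    then show "controlled_bound \<beta> \<rho> (?C * (M * N z) * prod_list (map norm hs))
       (\<lambda>t. A t (fst z t # hs)) (\<lambda>t u. B t u (fst z t # hs) + A t (blinfun_apply (snd z t) u # hs))"
      by (simp only: mult_ac)
  qed (use Cons.prems C0 N0 in \<open>auto intro!: multilinear_list_Cons multilinear_list_add\<close>)
  then show ?case
    unfolding multilinear_path_Cons multilinear_dagger_Cons by (simp add: mult_ac)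
qed

end

section \<open>Families of derivatives and their lift to paths\<close>

text \<open>One constant \<open>K\<close> serves all orders, and the Hoelder bound is required at
  each of them, because the composition estimate is applied to \<open>D j\<close> with derivative
  \<open>D (Suc j)\<close> for every \<open>j \<le> k\<close>.\<close>

locale smooth_family =
  fixes D :: "nat \<Rightarrow> 'v::real_normed_vector \<Rightarrow> 'v list \<Rightarrow> 'w::real_normed_vector"
    and k :: nat and K \<gamma> :: real
  assumes D_multilinear: "\<And>j v. j \<le> Suc k \<Longrightarrow> multilinear_list j (D j v)"
    and D_deriv: "\<And>j v hs. j \<le> k \<Longrightarrow> length hs = j \<Longrightarrow>
      ((\<lambda>v. D j v hs) has_derivative (\<lambda>h. D (Suc j) v (h # hs))) (at v)"
    and D_bound: "\<And>j v hs. j \<le> Suc k \<Longrightarrow> length hs = j \<Longrightarrow> norm (D j v hs) \<le> K * prod_list (map norm hs)"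
    and D_holder: "\<And>j v w hs. j \<le> Suc k \<Longrightarrow> length hs = j \<Longrightarrow>
      norm (D j v hs - D j w hs) \<le> K * norm (v - w) powr \<gamma> * prod_list (map norm hs)"
    and K_nonneg: "0 \<le> K" and \<gamma>_pos: "0 < \<gamma>" and \<gamma>_le_1: "\<gamma> \<le> 1"
begin

text \<open>With \<open>hs\<close> frozen, \<open>D j\<close> is a function of one variable whose
  second derivative is the form of order \<open>j + 2\<close>. This order is at most
  \<open>k + 1\<close>, so the Hoelder bound makes that derivative continuous.\<close>

lemma D_symmetric:
  assumes "Suc j \<le> k" "length hs = j"
  shows "D (Suc (Suc j)) v (a # b # hs) = D (Suc (Suc j)) v (b # a # hs)"
proof (rule second_derivative_symmetric[where g'' = "\<lambda>v b a. D (Suc (Suc j)) v (b # a # hs)"])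
  show "((\<lambda>v. D j v hs) has_derivative (\<lambda>h. D (Suc j) v (h # hs))) (at v)" for v
    using assms by (intro D_deriv) auto
  show "((\<lambda>v. D (Suc j) v (a # hs)) has_derivative (\<lambda>b. D (Suc (Suc j)) v (b # a # hs))) (at v)" for v a
    using assms by (intro D_deriv) auto
  fix a b
  let ?L = "\<lambda>v. D (Suc (Suc j)) v (b # a # hs)"
  let ?C = "K * prod_list (map norm (b # a # hs))"
  have "((\<lambda>w. ?L w - ?L v) \<longlongrightarrow> 0) (at v)"
  proof (rule Lim_null_comparison)
    show "\<forall>\<^sub>F w in at v. norm (?L w - ?L v) \<le> ?C * norm (w - v) powr \<gamma>"
      using assms D_holder[of "Suc (Suc j)" "b # a # hs"] by (intro always_eventually allI) (simp add: mult_ac)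
    have "((\<lambda>w. norm (w - v) powr \<gamma>) \<longlongrightarrow> 0 powr \<gamma>) (at v)"
      using \<gamma>_pos by (intro tendsto_powr2) (auto intro!: tendsto_eq_intros always_eventually)
    then show "((\<lambda>w. ?C * norm (w - v) powr \<gamma>) \<longlongrightarrow> 0) (at v)"
      using \<gamma>_pos tendsto_mult_right_zero by fastforce
  qed
  then show "isCont ?L v" unfolding isCont_def by (rule LIM_zero_cancel)
qed

definition lift_path :: "nat \<Rightarrow> (real \<Rightarrow> 'v) \<times> 'd \<Rightarrow> ((real \<Rightarrow> 'v) \<times> 'd) list \<Rightarrow> real \<Rightarrow> 'w"
  where "lift_path j y = multilinear_path (\<lambda>t. D j (fst y t))"

text \<open>By the chain rule the maps \<open>D j (fst y t)\<close> form a path whose Gubinelli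
  derivative is \<open>D (Suc j) (fst y t)\<close> with the Gubinelli derivative of \<open>y\<close>
  in the first slot.\<close>

definition lift_dagger :: "nat \<Rightarrow> (real \<Rightarrow> 'v) \<times> (real \<Rightarrow> 'u::real_normed_vector \<Rightarrow>\<^sub>L 'v) \<Rightarrow>
    ((real \<Rightarrow> 'v) \<times> (real \<Rightarrow> 'u \<Rightarrow>\<^sub>L 'v)) list \<Rightarrow> real \<Rightarrow> 'u \<Rightarrow> 'w"
  where "lift_dagger j y = multilinear_dagger (\<lambda>t. D j (fst y t))
    (\<lambda>t u hs. D (Suc j) (fst y t) (blinfun_apply (snd y t) u # hs))"

lemma lift_path_deriv:
  assumes j: "j < k" and zs: "length zs = j"
  shows "((\<lambda>\<theta>. lift_path j (y + \<theta> *\<^sub>R h) zs t) has_vector_derivative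
    lift_path (Suc j) (y + \<theta> *\<^sub>R h) (h # zs) t) (at \<theta> within S)"
  unfolding lift_path_def multilinear_path_def
  using has_derivative_along_line[OF D_deriv[of j "map (\<lambda>z. fst z t) zs"], of "fst y t" "fst h t"] j zs
  by (simp add: scaleR_fun_def)

text \<open>Differentiating the chain rule term in direction \<open>h\<close> puts \<open>h\<close>
  in front of the Gubinelli derivative of \<open>y\<close>, whereas the lift of order
  \<open>Suc j\<close> has them in the opposite order; symmetry reconciles the two. The term with
  the Gubinelli derivative of \<open>h\<close> becomes the summand of index 0 in the Leibniz sum
  over \<open>h # zs\<close>.\<close>

lemma lift_dagger_deriv:
  assumes j: "j < k" and zs: "length zs = j"
  shows "((\<lambda>\<theta>. lift_dagger j (y + \<theta> *\<^sub>R h) zs t u) has_vector_derivative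
    lift_dagger (Suc j) (y + \<theta> *\<^sub>R h) (h # zs) t u) (at \<theta> within S)"
proof -
  define hs where "hs = map (\<lambda>z. fst z t) zs"
  define a where "a = blinfun_apply (snd y t) u"
  define b where "b = blinfun_apply (snd h t) u"
  define v where "v \<theta> = fst y t + \<theta> *\<^sub>R fst h t" for \<theta> :: real
  define h0 where "h0 = fst h t"
  define c where "c i = blinfun_apply (snd (zs ! i) t) u" for i
  have hs: "length hs = j" using zs by (simp add: hs_def)
  have dv: "((\<lambda>\<theta>. D i (v \<theta>) gs) has_vector_derivative D (Suc i) (v \<theta>) (h0 # gs)) (at \<theta> within S)"
    if "i \<le> k" "length gs = i" for i gs
    unfolding v_def h0_def using that by (intro has_derivative_along_line D_deriv)
  have lin: "linear (\<lambda>a. D (Suc j) v (a # hs))" for v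
    using j hs by (intro multilinear_list_hd[OF D_multilinear]) auto
  have lin2: "linear (\<lambda>a. D (Suc (Suc j)) v (a # h0 # hs))" for v
    using j hs by (intro multilinear_list_hd[OF D_multilinear]) auto
  have sym: "D (Suc (Suc j)) v (h0 # a # hs) = D (Suc (Suc j)) v (a # h0 # hs)" for v a
    using j hs by (intro D_symmetric) auto
  have da: "((\<lambda>\<theta>. D (Suc j) (v \<theta>) (c # hs)) has_vector_derivative
      D (Suc (Suc j)) (v \<theta>) (c # h0 # hs)) (at \<theta> within S)" for c
    using dv[of "Suc j" "c # hs"] j hs sym[of "v \<theta>" c] by simp
  \<comment> \<open>The first slot \<open>a + \<theta> *\<^sub>R b\<close> moves with \<theta> as
    well. It is split by linearity so that the product rule in \<theta> applies.\<close>
  have 1: "((\<lambda>\<theta>. D (Suc j) (v \<theta>) (a # hs) + \<theta> *\<^sub>R D (Suc j) (v \<theta>) (b # hs)) has_vector_derivative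
      D (Suc (Suc j)) (v \<theta>) ((a + \<theta> *\<^sub>R b) # h0 # hs) + D (Suc j) (v \<theta>) (b # hs)) (at \<theta> within S)"
    by (auto intro!: derivative_eq_intros da simp: linear_add[OF lin2] linear_scale[OF lin2])
  have 2: "((\<lambda>\<theta>. \<Sum>i<length zs. D j (v \<theta>) (hs[i := c i])) has_vector_derivative
      (\<Sum>i<length zs. D (Suc j) (v \<theta>) (h0 # hs[i := c i]))) (at \<theta> within S)"
    using j hs by (intro has_vector_derivative_sum dv) auto
  have "((\<lambda>\<theta>. (D (Suc j) (v \<theta>) (a # hs) + \<theta> *\<^sub>R D (Suc j) (v \<theta>) (b # hs))
      + (\<Sum>i<length zs. D j (v \<theta>) (hs[i := c i]))) has_vector_derivative
      (D (Suc (Suc j)) (v \<theta>) ((a + \<theta> *\<^sub>R b) # h0 # hs) + D (Suc j) (v \<theta>) (b # hs))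
      + (\<Sum>i<length zs. D (Suc j) (v \<theta>) (h0 # hs[i := c i]))) (at \<theta> within S)"
    by (rule has_vector_derivative_add[OF 1 2])
  moreover have "lift_dagger j (y + \<theta> *\<^sub>R h) zs t u = (D (Suc j) (v \<theta>) (a # hs) + \<theta> *\<^sub>R D (Suc j) (v \<theta>) (b # hs))
      + (\<Sum>i<length zs. D j (v \<theta>) (hs[i := c i]))" for \<theta>
    by (simp add: lift_dagger_def multilinear_dagger_def scaleR_fun_def v_def a_def b_def c_def hs_def[symmetric]
        blinfun.add_left blinfun.scaleR_left linear_add[OF lin] linear_scale[OF lin])
  moreover have "lift_dagger (Suc j) (y + \<theta> *\<^sub>R h) (h # zs) t u =
      (D (Suc (Suc j)) (v \<theta>) ((a + \<theta> *\<^sub>R b) # h0 # hs) + D (Suc j) (v \<theta>) (b # hs))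
      + (\<Sum>i<length zs. D (Suc j) (v \<theta>) (h0 # hs[i := c i]))" for \<theta>
    by (simp add: lift_dagger_def multilinear_dagger_def scaleR_fun_def v_def a_def b_def c_def h0_def hs_def[symmetric]
        blinfun.add_left blinfun.scaleR_left sum.lessThan_Suc_shift del: sum.lessThan_Suc)
  ultimately show ?thesis by simp
qed

end

section \<open>Boundedness, Hoelder and Taylor estimates for the lifted derivatives\<close>

text \<open>All exponents are reciprocals: \<beta> and \<rho> are 1 / q and 1 / r, while
  \<open>\<beta>'\<close> and \<open>\<rho>'\<close> belong to the target space, so that its maxima
  turn into minima. The condition \<open>\<alpha> < \<rho>\<close> is r < p.\<close>

locale nemytskii_family = weighted_increments T \<omega> X W C\<^sub>X \<alpha> + smooth_family D k K \<gamma>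
  for T \<omega> and X :: "real \<Rightarrow> real \<Rightarrow> 'u::real_normed_vector" and W C\<^sub>X \<alpha>
    and D :: "nat \<Rightarrow> 'v::real_normed_vector \<Rightarrow> 'v list \<Rightarrow> 'w::real_normed_vector" and k K \<gamma> +
  fixes \<beta> \<rho> \<kappa> \<beta>' \<rho>' :: real
  assumes \<beta>_pos: "0 < \<beta>" and \<beta>_le_1: "\<beta> \<le> 1" and \<rho>_gt: "\<alpha> < \<rho>" and \<rho>_le_1: "\<rho> \<le> 1"
    and \<kappa>_pos: "0 < \<kappa>" and \<kappa>_less_1: "\<kappa> < 1"
    and \<beta>'_def: "\<beta>' = \<kappa> * \<gamma> * min \<alpha> \<beta>" and \<rho>'_def: "\<rho>' = min \<rho> ((1 + \<kappa> * \<gamma>) * \<alpha>)"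
begin

abbreviation path_bound :: "real \<Rightarrow> (real \<Rightarrow> 'b::real_normed_vector) \<times> (real \<Rightarrow> 'u \<Rightarrow>\<^sub>L 'b) \<Rightarrow> bool"
  where "path_bound N z \<equiv> controlled_bound \<beta> \<rho> N (fst z) (\<lambda>t. blinfun_apply (snd z t))"

lemma path_bound_zero: "0 \<le> R \<Longrightarrow> path_bound R 0"
  by (simp add: controlled_bound_def)

lemma path_bound_add: "path_bound N y \<Longrightarrow> path_bound N' z \<Longrightarrow> path_bound (N + N') (y + z)"
  using controlled_bound_add[of \<beta> \<rho> N "fst y" "\<lambda>t. blinfun_apply (snd y t)" N' "fst z" "\<lambda>t. blinfun_apply (snd z t)"]
  by (simp add: controlled_bound_def blinfun.add_left)

lemma path_bound_scaleR: "path_bound N y \<Longrightarrow> path_bound (\<bar>c\<bar> * N) (c *\<^sub>R y)"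
  using controlled_bound_scaleR[of \<beta> \<rho> N "fst y" "\<lambda>t. blinfun_apply (snd y t)" c]
  by (simp add: controlled_bound_def scaleR_fun_def blinfun.scaleR_left)

lemma path_bound_diff_iff: "path_bound N (y - z) \<longleftrightarrow>
    controlled_bound \<beta> \<rho> N (\<lambda>t. fst y t - fst z t) (\<lambda>t u. blinfun_apply (snd y t) u - blinfun_apply (snd z t) u)"
  by (simp add: controlled_bound_def blinfun.diff_left)

text \<open>As \<kappa> \<gamma> lies in (0, 1], the target exponents do not exceed those of the
  source and meet the conditions of the product rule, \<open>\<beta>' \<le> \<alpha>\<close> and
  \<open>\<rho>' \<le> 2 * \<alpha>\<close>.\<close>

lemma exponent_bounds:
  "0 < \<beta>'" "\<beta>' \<le> \<alpha>" "\<beta>' \<le> \<beta>" "\<alpha> \<le> \<rho>'" "\<rho>' \<le> \<rho>" "\<rho>' \<le> 2 * \<alpha>"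
proof -
  have "0 < \<kappa> * \<gamma>" "\<kappa> * \<gamma> \<le> 1"
    using \<kappa>_pos \<kappa>_less_1 \<gamma>_pos \<gamma>_le_1 by (auto intro: mult_le_one)
  moreover from this have "\<kappa> * \<gamma> * min \<alpha> \<beta> \<le> 1 * min \<alpha> \<beta>" "\<kappa> * \<gamma> * \<alpha> \<le> 1 * \<alpha>"
      "0 < \<kappa> * \<gamma> * \<alpha>" "0 < \<kappa> * \<gamma> * min \<alpha> \<beta>"
    using \<alpha>_pos \<beta>_pos by (intro mult_right_mono mult_pos_pos[of "\<kappa> * \<gamma>"]; simp only: min_less_iff_conj; linarith)+
  ultimately show "0 < \<beta>'" "\<beta>' \<le> \<alpha>" "\<beta>' \<le> \<beta>" "\<alpha> \<le> \<rho>'" "\<rho>' \<le> \<rho>" "\<rho>' \<le> 2 * \<alpha>"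
    using \<alpha>_pos \<beta>_pos \<rho>_gt unfolding \<beta>'_def \<rho>'_def distrib_right by linarith+
qed

text \<open>Each direction contributes a factor from the product rule and a \<open>W\<close> for
  weakening its exponents to those of the target.\<close>

definition lift_const :: "nat \<Rightarrow> real"
  where "lift_const j = ((C\<^sub>X + W) * (4 * W)) ^ j * W ^ j"

lemma lift_const_nonneg: "0 \<le> lift_const j"
  using CX_nonneg W_ge_1 by (simp add: lift_const_def)

lemma path_bound_multilinear:
  fixes A :: "real \<Rightarrow> 'v list \<Rightarrow> 'w"
  assumes A: "\<And>hs. length hs = length zs \<Longrightarrow>
      controlled_bound \<beta>' \<rho>' (M * prod_list (map norm hs)) (\<lambda>t. A t hs) (\<lambda>t u. B t u hs)"
    and mA: "\<And>t. t \<in> {0..T} \<Longrightarrow> multilinear_list (length zs) (A t)"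
    and mB: "\<And>t u. t \<in> {0..T} \<Longrightarrow> multilinear_list (length zs) (B t u)"
    and z: "\<And>z. z \<in> set zs \<Longrightarrow> path_bound (N z) z"
    and M: "0 \<le> M"
  shows "controlled_bound \<beta>' \<rho>' (lift_const (length zs) * (M * prod_list (map N zs)))
    (multilinear_path A zs) (multilinear_dagger A B zs)"
proof -
  have P: "prod_list (map (\<lambda>z. W * N z) zs) = W ^ length zs * prod_list (map N zs)"
    by (induction zs) simp_all
  have "controlled_bound \<beta>' \<rho>' (((C\<^sub>X + W) * (4 * W)) ^ length zs * (M * prod_list (map (\<lambda>z. W * N z) zs)))
    (multilinear_path A zs) (multilinear_dagger A B zs)"
  proof (rule controlled_bound_multilinear[OF A mA mB])
    show "controlled_bound \<beta>' \<rho>' (W * N z) (fst z) (\<lambda>t. blinfun_apply (snd z t))" if "z \<in> set zs" for z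
      by (rule controlled_bound_weaken[OF z[OF that]])
         (use exponent_bounds \<beta>_le_1 \<rho>_le_1 \<alpha>_pos in linarith)+
  qed (use exponent_bounds M in auto)
  then show ?thesis unfolding P by (simp add: lift_const_def mult_ac)
qed

lemma lift_multilinear:
  assumes "j \<le> k"
  shows "multilinear_list j (D j v)" "multilinear_list j (\<lambda>hs. D (Suc j) v (a # hs))"
  using assms D_multilinear[of j v] multilinear_list_Cons[OF D_multilinear[of "Suc j" v]] by auto

text \<open>For frozen directions \<open>hs\<close>, the function \<open>D j _ hs\<close> has the
  constant \<open>K\<close> times the product of their norms. The composition estimate then has
  exactly the shape that the product rule needs in order to replace \<open>hs\<close> by
  paths.\<close>

lemma derivative_compose_diff:
  fixes y z :: "(real \<Rightarrow> 'v) \<times> (real \<Rightarrow> 'u \<Rightarrow>\<^sub>L 'v)"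
  assumes j: "j \<le> k" and hs: "length hs = j"
    and y: "path_bound R y" "path_bound R z" "path_bound \<delta> (y - z)" and R: "1 \<le> R" "\<delta> \<le> R"
  shows "controlled_bound \<beta>' \<rho>'
    ((C\<^sub>X + W) * (6 * (K * R * R * W) * \<delta> powr ((1 - \<kappa>) * \<gamma>)) * prod_list (map norm hs))
    (\<lambda>t. D j (fst y t) hs - D j (fst z t) hs)
    (\<lambda>t u. D (Suc j) (fst y t) (blinfun_apply (snd y t) u # hs) - D (Suc j) (fst z t) (blinfun_apply (snd z t) u # hs))"
proof -
  let ?P = "prod_list (map norm hs)"
  have P0: "0 \<le> ?P" by (rule prod_list_nonneg) auto
  have "controlled_bound \<beta>' \<rho>' ((C\<^sub>X + W) * (6 * ((K * ?P) * R * R * W) * \<delta> powr ((1 - \<kappa>) * \<gamma>)))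
    (\<lambda>t. D j (fst y t) hs - D j (fst z t) hs)
    (\<lambda>t u. D (Suc j) (fst y t) (blinfun_apply (snd y t) u # hs) - D (Suc j) (fst z t) (blinfun_apply (snd z t) u # hs))"
  proof (rule controlled_bound_compose_diff[where g' = "\<lambda>v h. D (Suc j) v (h # hs)"])
    show "norm (D (Suc j) v (h # hs)) \<le> K * ?P * norm h" for v h
      using D_bound[of "Suc j" "h # hs"] j hs by (simp add: mult_ac)
    show "norm (D (Suc j) v (h # hs) - D (Suc j) w (h # hs)) \<le> K * ?P * norm (v - w) powr \<gamma> * norm h" for v w h
      using D_holder[of "Suc j" "h # hs"] j hs by (simp add: mult_ac)
    show "controlled_bound \<beta> \<rho> \<delta> (\<lambda>t. fst y t - fst z t) (\<lambda>t u. blinfun_apply (snd y t) u - blinfun_apply (snd z t) u)"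
      using y(3) by (simp only: path_bound_diff_iff)
  qed (use D_deriv[OF j hs] y R P0 K_nonneg \<gamma>_pos \<gamma>_le_1 \<kappa>_pos \<kappa>_less_1 \<beta>_pos \<beta>_le_1 \<rho>_gt \<rho>_le_1 \<beta>'_def \<rho>'_def in auto)
  then show ?thesis by (simp add: mult_ac)
qed

text \<open>Both lifts have the same directions \<open>zs\<close>, so their difference is the
  multilinear path of the differences of the maps, and the composition estimate controls
  those.\<close>

lemma lift_diff:
  assumes j: "length zs \<le> k"
    and y: "path_bound R y" "path_bound R z" "path_bound \<delta> (y - z)" and R: "1 \<le> R" "\<delta> \<le> R"
    and zs: "\<And>z. z \<in> set zs \<Longrightarrow> path_bound (N z) z"
  shows "controlled_bound \<beta>' \<rho>' (lift_const (length zs) *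
      ((C\<^sub>X + W) * (6 * (K * R * R * W) * \<delta> powr ((1 - \<kappa>) * \<gamma>)) * prod_list (map N zs)))
    (\<lambda>t. lift_path (length zs) y zs t - lift_path (length zs) z zs t)
    (\<lambda>t u. lift_dagger (length zs) y zs t u - lift_dagger (length zs) z zs t u)"
  unfolding lift_path_def lift_dagger_def multilinear_dagger_diff[symmetric]
  using path_bound_multilinear[OF derivative_compose_diff[OF j _ y R] multilinear_list_diff multilinear_list_diff zs,
      OF _ lift_multilinear(1)[OF j] lift_multilinear(1)[OF j] lift_multilinear(2)[OF j] lift_multilinear(2)[OF j]]
    K_nonneg CX_nonneg W_ge_1 R
  by (simp add: multilinear_path_def[abs_def])

definition lift_growth :: "real \<Rightarrow> real"
  where "lift_growth R = (C\<^sub>X + W) * (6 * (K * R * R * W) * R powr ((1 - \<kappa>) * \<gamma>)) + K"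

text \<open>The path is compared with the zero path, at distance \<open>\<delta> = R\<close>. The
  lift of the zero path with constant directions is constant, is bounded through \<open>K\<close>
  and has Gubinelli derivative 0. These are the two summands of \<open>lift_growth\<close>.\<close>

lemma lift_bound:
  assumes j: "length zs \<le> k" and y: "path_bound R y" and R: "1 \<le> R"
    and zs: "\<And>z. z \<in> set zs \<Longrightarrow> path_bound (N z) z"
  shows "controlled_bound \<beta>' \<rho>' (lift_const (length zs) * (lift_growth R * prod_list (map N zs)))
    (lift_path (length zs) y zs) (lift_dagger (length zs) y zs)"
  unfolding lift_path_def lift_dagger_def
proof (rule path_bound_multilinear[OF _ lift_multilinear(1)[OF j] lift_multilinear(2)[OF j] zs])
  fix hs :: "'v list" assume hs: "length hs = length zs"
  let ?j = "length zs"
  have lin: "linear (\<lambda>a. D (Suc ?j) v (a # hs))" for v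
    using j hs by (intro multilinear_list_hd[OF D_multilinear]) auto
  have 0: "path_bound R (0 :: (real \<Rightarrow> 'v) \<times> (real \<Rightarrow> 'u \<Rightarrow>\<^sub>L 'v))"
    using R by (intro path_bound_zero) simp
  have "controlled_bound \<beta>' \<rho>' ((C\<^sub>X + W) * (6 * (K * R * R * W) * R powr ((1 - \<kappa>) * \<gamma>)) * prod_list (map norm hs)
      + K * prod_list (map norm hs))
    (\<lambda>t. D ?j (fst y t) hs - D ?j 0 hs + D ?j 0 hs)
    (\<lambda>t u. D (Suc ?j) (fst y t) (blinfun_apply (snd y t) u # hs) - 0 + 0)"
    using controlled_bound_add[OF derivative_compose_diff[OF j hs y 0 _ R order_refl]
        controlled_bound_const[OF D_bound[where v = 0, OF _ hs]]] y j linear_0[OF lin]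
    by simp
  then show "controlled_bound \<beta>' \<rho>' (lift_growth R * prod_list (map norm hs)) (\<lambda>t. D ?j (fst y t) hs)
      (\<lambda>t u. D (Suc ?j) (fst y t) (blinfun_apply (snd y t) u # hs))"
    by (simp add: lift_growth_def distrib_right)
qed (use K_nonneg CX_nonneg W_ge_1 R in \<open>auto simp: lift_growth_def\<close>)

text \<open>Along \<open>y + \<theta> *\<^sub>R h\<close> the lift has as derivative the lift of the
  next order in the directions \<open>h # zs\<close>. Its deviation from the value at \<theta> = 0
  is a difference of lifts at distance at most \<open>N h\<close>; \<open>R'\<close> bounds all
  paths on the segment.\<close>

lemma lift_taylor:
  assumes j: "length zs < k"
    and y: "path_bound R y" and R: "1 \<le> R" and R': "R + N h \<le> R'"
    and zs: "\<And>z. z \<in> set (h # zs) \<Longrightarrow> path_bound (N z) z"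
  shows "controlled_bound \<beta>' \<rho>' (lift_const (Suc (length zs)) *
      ((C\<^sub>X + W) * (6 * (K * R' * R' * W) * N h powr ((1 - \<kappa>) * \<gamma>)) * (N h * prod_list (map N zs))))
    (\<lambda>t. lift_path (length zs) (y + h) zs t - lift_path (length zs) y zs t - lift_path (Suc (length zs)) y (h # zs) t)
    (\<lambda>t u. lift_dagger (length zs) (y + h) zs t u - lift_dagger (length zs) y zs t u
      - lift_dagger (Suc (length zs)) y (h # zs) t u)"
proof -
  let ?j = "length zs"
  let ?B = "lift_const (Suc ?j) * ((C\<^sub>X + W) * (6 * (K * R' * R' * W) * N h powr ((1 - \<kappa>) * \<gamma>)) * (N h * prod_list (map N zs)))"
  have h: "path_bound (N h) h" using zs by simp
  have h0: "0 \<le> N h" by (rule controlled_bound_nonneg[OF h])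
  have "controlled_bound \<beta>' \<rho>' ?B
    (\<lambda>t. lift_path ?j (y + 1 *\<^sub>R h) zs t - lift_path ?j (y + 0 *\<^sub>R h) zs t - lift_path (Suc ?j) y (h # zs) t)
    (\<lambda>t u. lift_dagger ?j (y + 1 *\<^sub>R h) zs t u - lift_dagger ?j (y + 0 *\<^sub>R h) zs t u - lift_dagger (Suc ?j) y (h # zs) t u)"
  proof (rule controlled_bound_mean_value)
    fix \<theta> :: real assume \<theta>: "\<theta> \<in> {0..1}"
    have sh: "path_bound (N h) (\<theta> *\<^sub>R h)"
      by (rule controlled_bound_mono[OF path_bound_scaleR[OF h]]) (use \<theta> h0 in \<open>simp add: mult_left_le_one_le\<close>)
    have yh: "path_bound R' (y + \<theta> *\<^sub>R h)"
      by (rule controlled_bound_mono[OF path_bound_add[OF y sh] R'])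
    have R1: "1 \<le> R'" "N h \<le> R'" using R R' h0 by linarith+
    have y': "path_bound R' y"
      by (rule controlled_bound_mono[OF y]) (use h0 R' in simp)
    show "controlled_bound \<beta>' \<rho>' ?B
      (\<lambda>t. lift_path (Suc ?j) (y + \<theta> *\<^sub>R h) (h # zs) t - lift_path (Suc ?j) y (h # zs) t)
      (\<lambda>t u. lift_dagger (Suc ?j) (y + \<theta> *\<^sub>R h) (h # zs) t u - lift_dagger (Suc ?j) y (h # zs) t u)"
      using lift_diff[of "h # zs" R' "y + \<theta> *\<^sub>R h" y "N h" N] j yh y' sh zs R1 by simp
  qed (use j in \<open>auto intro: lift_path_deriv lift_dagger_deriv\<close>)
  then show ?thesis by simp
qed

end

section \<open>Normed spaces with explicit carrier\<close>

text \<open>Where \<open>b i\<close> is positive, dividing by it turns every admissible constant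
  into an upper bound of \<open>a i / b i\<close>, which passes to the infimum; where it is 0, any
  admissible constant already gives \<open>a i \<le> 0\<close>. Operator norms and the seminorms in
  the control are both infima of this kind.\<close>

lemma Inf_of_bounds_attained:
  fixes a b :: "'i \<Rightarrow> real"
  assumes b: "\<And>i. i \<in> I \<Longrightarrow> 0 \<le> b i" and ne: "{C. 0 \<le> C \<and> (\<forall>i\<in>I. a i \<le> C * b i)} \<noteq> {}"
  shows "0 \<le> Inf {C. 0 \<le> C \<and> (\<forall>i\<in>I. a i \<le> C * b i)}"
    and "i \<in> I \<Longrightarrow> a i \<le> Inf {C. 0 \<le> C \<and> (\<forall>i\<in>I. a i \<le> C * b i)} * b i"
proof -
  let ?S = "{C. 0 \<le> C \<and> (\<forall>i\<in>I. a i \<le> C * b i)}"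
  show "0 \<le> Inf ?S" by (rule cInf_greatest[OF ne]) auto
  assume i: "i \<in> I"
  show "a i \<le> Inf ?S * b i"
  proof (cases "b i = 0")
    case True
    then show ?thesis using ne i by auto
  next
    case False
    then have bi: "0 < b i" using b[OF i] by simp
    have "a i / b i \<le> Inf ?S"
      by (rule cInf_greatest[OF ne]) (use i bi in \<open>auto simp: divide_le_eq\<close>)
    then show ?thesis using bi by (simp add: divide_le_eq)
  qed
qed

lemma Inf_of_bounds_le:
  fixes a b :: "'i \<Rightarrow> real"
  assumes "0 \<le> C" "\<And>i. i \<in> I \<Longrightarrow> a i \<le> C * b i"
  shows "Inf {C. 0 \<le> C \<and> (\<forall>i\<in>I. a i \<le> C * b i)} \<le> C"
  by (rule cInf_lower) (use assms in \<open>auto intro: bdd_belowI[of _ 0]\<close>)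

text \<open>These are the axioms of a seminormed subspace. Homogeneity is an inequality, the half
  that is direct for infima; applied to a nonzero scalar and its inverse it gives equality.\<close>

definition normed_carrier :: "'a::real_vector nspace \<Rightarrow> bool"
  where "normed_carrier E \<longleftrightarrow> 0 \<in> carr E \<and>
    (\<forall>a\<in>carr E. 0 \<le> nrm E a) \<and>
    (\<forall>a\<in>carr E. \<forall>b\<in>carr E. a + b \<in> carr E \<and> nrm E (a + b) \<le> nrm E a + nrm E b) \<and>
    (\<forall>c. \<forall>a\<in>carr E. c *\<^sub>R a \<in> carr E \<and> nrm E (c *\<^sub>R a) \<le> \<bar>c\<bar> * nrm E a)"

lemma normed_carrierD:
  assumes "normed_carrier E"
  shows "0 \<in> carr E" and "a \<in> carr E \<Longrightarrow> 0 \<le> nrm E a"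
    and "a \<in> carr E \<Longrightarrow> b \<in> carr E \<Longrightarrow> a + b \<in> carr E"
    and "a \<in> carr E \<Longrightarrow> b \<in> carr E \<Longrightarrow> nrm E (a + b) \<le> nrm E a + nrm E b"
    and "a \<in> carr E \<Longrightarrow> c *\<^sub>R a \<in> carr E"
    and "a \<in> carr E \<Longrightarrow> nrm E (c *\<^sub>R a) \<le> \<bar>c\<bar> * nrm E a"
  using assms unfolding normed_carrier_def by blast+

lemma normed_carrier_diff:
  assumes "normed_carrier E" "a \<in> carr E" "b \<in> carr E"
  shows "a - b \<in> carr E" and "nrm E (a - b) \<le> nrm E a + nrm E b"
    and "nrm E (a - b) = nrm E (b - a)"
proof -
  note n = normed_carrierD[OF assms(1)]
  have m: "- c \<in> carr E \<and> nrm E (- c) \<le> nrm E c" if "c \<in> carr E" for c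
    using n(5)[OF that, of "-1"] n(6)[OF that, of "-1"] by simp
  have d: "c - d \<in> carr E \<and> nrm E (c - d) \<le> nrm E c + nrm E d" if "c \<in> carr E" "d \<in> carr E" for c d
    using n(3)[OF that(1), of "- d"] n(4)[OF that(1), of "- d"] m[OF that(2)] by auto
  show "a - b \<in> carr E" "nrm E (a - b) \<le> nrm E a + nrm E b" using d assms by auto
  show "nrm E (a - b) = nrm E (b - a)"
    using m[of "a - b"] m[of "b - a"] d assms by (auto intro: antisym)
qed

lemma normed_carrier_type: "normed_carrier (type_nspace :: 'a::real_normed_vector nspace)"
  by (simp add: normed_carrier_def type_nspace_def norm_triangle_ineq)

lemma tuples_type: "tuples type_nspace n = {hs. length hs = n}"
  by (simp add: tuples_def type_nspace_def)

lemma tuples_Cons_iff: "a # hs \<in> tuples E (Suc n) \<longleftrightarrow> a \<in> carr E \<and> hs \<in> tuples E n"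
  by (auto simp: tuples_def)

lemma tuples_update: "hs \<in> tuples E n \<Longrightarrow> a \<in> carr E \<Longrightarrow> hs[i := a] \<in> tuples E n"
  using set_update_subset_insert[of hs i a] by (auto simp: tuples_def)

lemma tuples_prod_nonneg:
  assumes "normed_carrier E" "hs \<in> tuples E n"
  shows "0 \<le> prod_list (map (nrm E) hs)"
  using assms normed_carrierD(2)[OF assms(1)] by (intro prod_list_nonneg) (auto simp: tuples_def)

lemma multilinear_nrm_le:
  assumes "0 \<le> C" "\<And>hs. hs \<in> tuples E n \<Longrightarrow> nrm F (M hs) \<le> C * prod_list (map (nrm E) hs)"
  shows "nrm (multilinear_nspace E n F) M \<le> C"
  unfolding multilinear_nspace_def using Inf_of_bounds_le[OF assms] by simp

lemma multilinear_nrm_bound: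
  assumes E: "normed_carrier E"
    and C: "\<And>hs. hs \<in> tuples E n \<Longrightarrow> nrm F (M hs) \<le> C * prod_list (map (nrm E) hs)"
  shows "0 \<le> nrm (multilinear_nspace E n F) M"
    and "hs \<in> tuples E n \<Longrightarrow> nrm F (M hs) \<le> nrm (multilinear_nspace E n F) M * prod_list (map (nrm E) hs)"
proof -
  \<comment> \<open>\<open>C\<close> may be negative, whereas the constants in the operator norm are
    not.\<close>
  have "nrm F (M hs) \<le> max C 0 * prod_list (map (nrm E) hs)" if "hs \<in> tuples E n" for hs
    using C[OF that] mult_right_mono[of C "max C 0", OF _ tuples_prod_nonneg[OF E that]] by linarith
  then have ne: "{C. 0 \<le> C \<and> (\<forall>hs\<in>tuples E n. nrm F (M hs) \<le> C * prod_list (map (nrm E) hs))} \<noteq> {}"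
    by (auto intro!: exI[of _ "max C 0"])
  show "0 \<le> nrm (multilinear_nspace E n F) M"
    and "hs \<in> tuples E n \<Longrightarrow> nrm F (M hs) \<le> nrm (multilinear_nspace E n F) M * prod_list (map (nrm E) hs)"
    unfolding multilinear_nspace_def
    using Inf_of_bounds_attained[OF tuples_prod_nonneg[OF E] ne] by simp_all
qed

lemma multilinear_carrD:
  assumes "M \<in> carr (multilinear_nspace E n F)"
  shows "hs \<in> tuples E n \<Longrightarrow> M hs \<in> carr F" and "hs \<notin> tuples E n \<Longrightarrow> M hs = 0"
    and "hs \<in> tuples E n \<Longrightarrow> i < n \<Longrightarrow> a \<in> carr E \<Longrightarrow> b \<in> carr E \<Longrightarrow>
      M (hs[i := a + b]) = M (hs[i := a]) + M (hs[i := b])"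
    and "hs \<in> tuples E n \<Longrightarrow> i < n \<Longrightarrow> a \<in> carr E \<Longrightarrow> M (hs[i := c *\<^sub>R a]) = c *\<^sub>R M (hs[i := a])"
    and "\<exists>C. \<forall>hs\<in>tuples E n. nrm F (M hs) \<le> C * prod_list (map (nrm E) hs)"
  using assms unfolding multilinear_nspace_def by auto

lemma multilinear_carr_bound:
  assumes "normed_carrier E" "M \<in> carr (multilinear_nspace E n F)"
  shows "0 \<le> nrm (multilinear_nspace E n F) M"
    and "hs \<in> tuples E n \<Longrightarrow> nrm F (M hs) \<le> nrm (multilinear_nspace E n F) M * prod_list (map (nrm E) hs)"
proof -
  obtain C where C: "\<And>hs. hs \<in> tuples E n \<Longrightarrow> nrm F (M hs) \<le> C * prod_list (map (nrm E) hs)"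
    using multilinear_carrD(5)[OF assms(2)] by blast
  from multilinear_nrm_bound[where M = M, OF assms(1) C]
  show "0 \<le> nrm (multilinear_nspace E n F) M"
    and "hs \<in> tuples E n \<Longrightarrow> nrm F (M hs) \<le> nrm (multilinear_nspace E n F) M * prod_list (map (nrm E) hs)"
    by blast+
qed

text \<open>The definition of a derivative asks for a bounded linear map into forms of order
  \<open>n\<close>; freezing the first slot of a form of order \<open>n + 1\<close> gives one, with
  the norm of the form as constant.\<close>

lemma multilinear_curry_bounded_linear:
  assumes E: "normed_carrier E" and M: "M \<in> carr (multilinear_nspace E (Suc n) F)"
  shows "nspace_bounded_linear E (multilinear_nspace E n F) (\<lambda>h hs. M (h # hs))"
proof -
  let ?K = "nrm (multilinear_nspace E (Suc n) F) M"
  note e = normed_carrierD[OF E] and m = multilinear_carrD[OF M]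
  note K = multilinear_carr_bound[OF E M]
  have b: "nrm F (M (a # hs)) \<le> (?K * nrm E a) * prod_list (map (nrm E) hs)"
    if "a \<in> carr E" "hs \<in> tuples E n" for a hs
    using K(2)[of "a # hs"] that by (simp add: tuples_Cons_iff mult_ac)
  have out: "M (a # hs) = 0" if "hs \<notin> tuples E n" for a hs
    by (rule m(2)) (simp add: that tuples_Cons_iff)
  have c: "(\<lambda>hs. M (a # hs)) \<in> carr (multilinear_nspace E n F)" if a: "a \<in> carr E" for a
  proof -
    have "M (a # hs[i := c + d]) = M (a # hs[i := c]) + M (a # hs[i := d])"
      if "hs \<in> tuples E n" "i < n" "c \<in> carr E" "d \<in> carr E" for hs i c d
      using m(3)[of "a # hs" "Suc i" c d] that a by (simp add: tuples_Cons_iff)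
    moreover have "M (a # hs[i := r *\<^sub>R c]) = r *\<^sub>R M (a # hs[i := c])"
      if "hs \<in> tuples E n" "i < n" "c \<in> carr E" for hs i r c
      using m(4)[of "a # hs" "Suc i" c r] that a by (simp add: tuples_Cons_iff)
    moreover have "M (a # hs) \<in> carr F" if "hs \<in> tuples E n" for hs
      using m(1)[of "a # hs"] that a by (simp add: tuples_Cons_iff)
    ultimately show ?thesis
      unfolding multilinear_nspace_def using out b[OF a]
      by (auto intro!: exI[of _ "?K * nrm E a"])
  qed
  have add: "(\<lambda>hs. M ((a + b) # hs)) = (\<lambda>hs. M (a # hs)) + (\<lambda>hs. M (b # hs))"
    if ab: "a \<in> carr E" "b \<in> carr E" for a b
  proof
    \<comment> \<open>The 0 in \<open>0 # hs\<close> is an element of the carrier that the update in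
      slot 0 overwrites. Off the tuples both sides vanish, as forms are extended by zero.\<close>
    fix hs show "M ((a + b) # hs) = ((\<lambda>hs. M (a # hs)) + (\<lambda>hs. M (b # hs))) hs"
      using m(3)[of "0 # hs" 0 a b] ab e(1) out[of hs] by (cases "hs \<in> tuples E n") (auto simp: tuples_Cons_iff)
  qed
  have scale: "(\<lambda>hs. M ((c *\<^sub>R a) # hs)) = c *\<^sub>R (\<lambda>hs. M (a # hs))" if a: "a \<in> carr E" for a c
  proof
    fix hs show "M ((c *\<^sub>R a) # hs) = (c *\<^sub>R (\<lambda>hs. M (a # hs))) hs"
      using m(4)[of "0 # hs" 0 a c] a e(1) out[of hs]
      by (cases "hs \<in> tuples E n") (auto simp: tuples_Cons_iff scaleR_fun_def)
  qed
  have "nrm (multilinear_nspace E n F) (\<lambda>hs. M (a # hs)) \<le> ?K * nrm E a" if "a \<in> carr E" for a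
    by (rule multilinear_nrm_le) (use b that K(1) e(2) in auto)
  then show ?thesis
    unfolding nspace_bounded_linear_def using c add scale by blast
qed

lemma nspace_continuous_on_holder:
  assumes E: "normed_carrier E" and \<Omega>: "\<Omega> \<subseteq> carr E" and \<eta>: "0 < \<eta>"
    and H: "\<And>x y. x \<in> \<Omega> \<Longrightarrow> y \<in> \<Omega> \<Longrightarrow> nrm F (g y - g x) \<le> C * nrm E (y - x) powr \<eta>"
  shows "nspace_continuous_on E F \<Omega> g"
  unfolding nspace_continuous_on_def
proof (intro ballI allI impI)
  fix x \<epsilon> assume x: "x \<in> \<Omega>" and \<epsilon>: "(0::real) < \<epsilon>"
  \<comment> \<open>Chosen so that
    \<open>(\<bar>C\<bar> + 1) * \<delta> powr \<eta> = \<epsilon>\<close>; the constant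
    \<open>C\<close> may be zero or negative.\<close>
  define \<delta> where "\<delta> = (\<epsilon> / (\<bar>C\<bar> + 1)) powr (1 / \<eta>)"
  have q: "0 < \<epsilon> / (\<bar>C\<bar> + 1)" using \<epsilon> by simp
  have "nrm F (g y - g x) < \<epsilon>" if y: "y \<in> \<Omega>" "nrm E (y - x) < \<delta>" for y
  proof -
    have n0: "0 \<le> nrm E (y - x)"
      using normed_carrierD(2)[OF E] normed_carrier_diff(1)[OF E] y x \<Omega> by blast
    have "nrm F (g y - g x) \<le> C * nrm E (y - x) powr \<eta>" by (rule H[OF x y(1)])
    also have "\<dots> \<le> (\<bar>C\<bar> + 1) * nrm E (y - x) powr \<eta>"
      by (intro mult_right_mono) auto
    also have "\<dots> < (\<bar>C\<bar> + 1) * \<delta> powr \<eta>"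
      using y n0 \<eta> by (intro mult_strict_left_mono powr_less_mono2) auto
    also have "\<delta> powr \<eta> = \<epsilon> / (\<bar>C\<bar> + 1)"
      unfolding \<delta>_def powr_powr using \<eta> \<epsilon> by simp
    also have "(\<bar>C\<bar> + 1) * (\<epsilon> / (\<bar>C\<bar> + 1)) = \<epsilon>" by simp
    finally show ?thesis .
  qed
  moreover have "0 < \<delta>" unfolding \<delta>_def powr_gt_zero using q by (rule less_imp_neq[symmetric])
  ultimately show "\<exists>\<delta>>0. \<forall>y\<in>\<Omega>. nrm E (y - x) < \<delta> \<longrightarrow> nrm F (g y - g x) < \<epsilon>" by blast
qed

lemma has_fderiv_of_order:
  assumes E: "normed_carrier E" and L: "nspace_bounded_linear E F L" and \<eta>: "0 < \<eta>" and d: "0 < d"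
    and H: "\<And>h. h \<in> carr E \<Longrightarrow> x + h \<in> \<Omega> \<Longrightarrow> nrm E h < d \<Longrightarrow>
      nrm F (g (x + h) - g x - L h) \<le> C * nrm E h powr \<eta> * nrm E h"
  shows "has_fderiv E F \<Omega> g L x"
  unfolding has_fderiv_def
proof (intro conjI L allI impI)
  fix \<epsilon> :: real assume \<epsilon>: "0 < \<epsilon>"
  define \<delta> where "\<delta> = (\<epsilon> / (\<bar>C\<bar> + 1)) powr (1 / \<eta>)"
  have q: "0 < \<epsilon> / (\<bar>C\<bar> + 1)" using \<epsilon> by simp
  have "nrm F (g (x + h) - g x - L h) \<le> \<epsilon> * nrm E h"
    if h: "h \<in> carr E" "x + h \<in> \<Omega> \<and> nrm E h < min d \<delta>" for h
  proof -
    have n0: "0 \<le> nrm E h" using normed_carrierD(2)[OF E h(1)] .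
    have "C * nrm E h powr \<eta> \<le> (\<bar>C\<bar> + 1) * nrm E h powr \<eta>"
      by (intro mult_right_mono) auto
    also have "\<dots> \<le> (\<bar>C\<bar> + 1) * \<delta> powr \<eta>"
      using h n0 \<eta> by (intro mult_left_mono powr_mono2) auto
    also have "\<delta> powr \<eta> = \<epsilon> / (\<bar>C\<bar> + 1)"
      unfolding \<delta>_def powr_powr using \<eta> \<epsilon> by simp
    also have "(\<bar>C\<bar> + 1) * (\<epsilon> / (\<bar>C\<bar> + 1)) = \<epsilon>" by simp
    finally have "C * nrm E h powr \<eta> * nrm E h \<le> \<epsilon> * nrm E h" using n0 by (rule mult_right_mono)
    then show ?thesis using H[OF h(1)] h(2) by simp
  qed
  moreover have "0 < min d \<delta>"
    unfolding \<delta>_def min_less_iff_conj powr_gt_zero using d less_imp_neq[OF q] by simp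
  ultimately show "\<exists>\<delta>>0. \<forall>h\<in>carr E. x + h \<in> \<Omega> \<and> nrm E h < \<delta> \<longrightarrow> nrm F (g (x + h) - g x - L h) \<le> \<epsilon> * nrm E h"
    by blast
qed

section \<open>Families of derivatives from maps of class C^(k+1+\<gamma>)\<close>

text \<open>Differentiability in the operator norm of forms becomes ordinary differentiability once
  the directions are frozen. The class gives the Hoelder bound at the top order only; below it,
  \<open>D j\<close> is bounded, and Lipschitz by the bound of the next order, which together yield
  every exponent \<gamma> \<le> 1.\<close>

lemma holder_class_smooth_family:
  fixes f :: "'v::real_normed_vector \<Rightarrow> 'w::real_normed_vector"
  assumes f: "holder_class type_nspace type_nspace UNIV (Suc k) \<gamma> f" and \<gamma>: "0 < \<gamma>" "\<gamma> \<le> 1"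
  obtains D K where "smooth_family D k K \<gamma>" "\<And>v. D 0 v [] = f v"
proof -
  let ?V = "type_nspace :: 'v nspace" and ?W = "type_nspace :: 'w nspace"
  let ?M = "\<lambda>j. multilinear_nspace ?V j ?W"
  obtain D where D0: "\<And>v. D 0 v [] = f v" and DM: "\<And>j v. j \<le> Suc k \<Longrightarrow> D j v \<in> carr (?M j)"
    and DD: "\<And>j v. j < Suc k \<Longrightarrow> has_fderiv ?V (?M j) UNIV (D j) (\<lambda>h hs. D (Suc j) v (h # hs)) v"
    and DB: "\<And>j. j \<le> Suc k \<Longrightarrow> \<exists>C. \<forall>v. nrm (?M j) (D j v) \<le> C"
    and DH: "\<exists>C. \<forall>v w. nrm (?M (Suc k)) (D (Suc k) v - D (Suc k) w) \<le> C * nrm ?V (v - w) powr \<gamma>"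
    using f unfolding holder_class_def ball_UNIV by (erule_tac exE, elim conjE) (rule that; simp)
  note tV = normed_carrier_type[where 'a = 'v] and tW = normed_carrier_type[where 'a = 'w]
  have nV: "nrm ?V = norm" "carr ?V = UNIV" and nW: "nrm ?W = norm"
    by (simp_all add: type_nspace_def)
  obtain B where B: "\<And>j v. j \<le> Suc k \<Longrightarrow> nrm (?M j) (D j v) \<le> B j" using DB by metis
  obtain H where H: "\<And>v w. nrm (?M (Suc k)) (D (Suc k) v - D (Suc k) w) \<le> H * norm (v - w) powr \<gamma>"
    using DH by (auto simp: nV)
  define K1 where "K1 = (\<Sum>j\<le>Suc k. \<bar>B j\<bar>)"
  have K10: "0 \<le> K1" unfolding K1_def by (intro sum_nonneg) auto
  have BK: "B j \<le> K1" if "j \<le> Suc k" for j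
    using member_le_sum[of j "{..Suc k}" "\<lambda>j. \<bar>B j\<bar>"] that unfolding K1_def by (auto simp del: sum.atMost_Suc)
  have P0: "0 \<le> prod_list (map norm hs)" for hs :: "'v list" by (rule prod_list_nonneg) auto
  have mul: "multilinear_list j (D j v)" if "j \<le> Suc k" for j v
    unfolding multilinear_list_def
    using multilinear_carrD(3,4)[OF DM[OF that]] by (auto intro!: linearI simp: tuples_type nV)
  \<comment> \<open>The operator norm is an infimum and dominates the values of a form only if some
    bound exists. The premise \<open>ex\<close> provides one, since differences of forms are not
    known beforehand to lie in the carrier.\<close>
  have app: "norm (M hs) \<le> C * prod_list (map norm hs)"
    if M: "nrm (?M j) M \<le> C" and ex: "\<exists>C. \<forall>hs. length hs = j \<longrightarrow> norm (M hs) \<le> C * prod_list (map norm hs)"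
      and hs: "length hs = j"
    for M j C hs
  proof -
    obtain C' where "\<And>hs. length hs = j \<Longrightarrow> norm (M hs) \<le> C' * prod_list (map norm hs)" using ex by blast
    then have "norm (M hs) \<le> nrm (?M j) M * prod_list (map norm hs)"
      using multilinear_nrm_bound(2)[OF tV, of j ?W M C' hs] hs by (simp add: tuples_type nV nW)
    also have "\<dots> \<le> C * prod_list (map norm hs)" by (rule mult_right_mono[OF M P0])
    finally show ?thesis .
  qed
  have bd1: "norm (D j v hs) \<le> K1 * prod_list (map norm hs)" if "j \<le> Suc k" "length hs = j" for j v hs
    by (rule app[OF order_trans[OF B BK]])
       (use that multilinear_carrD(5)[OF DM[OF that(1), of v]] in \<open>auto simp: tuples_type nV nW\<close>)
  have bdiff: "norm (D j v hs - D j w hs) \<le> (2 * K1) * prod_list (map norm hs)" if "j \<le> Suc k" "length hs = j" for j v w hs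
    using norm_triangle_ineq4[of "D j v hs" "D j w hs"] bd1[OF that, of v] bd1[OF that, of w] by simp
  have der: "((\<lambda>v. D j v hs) has_derivative (\<lambda>h. D (Suc j) v (h # hs))) (at v)"
    if j: "j \<le> k" and hs: "length hs = j" for j v hs
    unfolding has_derivative_at_alt
  proof (intro conjI allI impI)
    have lin: "linear (\<lambda>h. D (Suc j) v (h # hs))"
      using j hs by (intro multilinear_list_hd[OF mul]) auto
    show "bounded_linear (\<lambda>h. D (Suc j) v (h # hs))"
      by (rule bounded_linear_intro[where K = "K1 * prod_list (map norm hs)"])
         (use bd1[of "Suc j" "_ # hs"] j hs in \<open>auto simp: linear_add[OF lin] linear_scale[OF lin] mult_ac\<close>)
    fix \<epsilon> :: real assume \<epsilon>: "0 < \<epsilon>"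
    let ?P = "prod_list (map norm hs)"
    \<comment> \<open>The 1 keeps the denominator positive when one of the directions is 0.\<close>
    have "0 < \<epsilon> / (?P + 1)" using \<epsilon> P0[of hs] by (simp add: add_nonneg_pos)
    then obtain \<delta> where \<delta>: "\<delta> > 0"
      and est: "\<And>h. norm h < \<delta> \<Longrightarrow> nrm (?M j) (D j (v + h) - D j v - (\<lambda>hs. D (Suc j) v (h # hs))) \<le> \<epsilon> / (?P + 1) * norm h"
      using DD[of j v] j unfolding has_fderiv_def nV by fastforce
    have "norm (D j w hs - D j v hs - D (Suc j) v ((w - v) # hs)) \<le> \<epsilon> * norm (w - v)" if w: "norm (w - v) < \<delta>" for w
    proof -
      have "norm ((D j (v + (w - v)) - D j v - (\<lambda>hs. D (Suc j) v ((w - v) # hs))) hs) \<le> \<epsilon> / (?P + 1) * norm (w - v) * ?P"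
      proof (rule app[OF est[OF w] _ hs], intro exI[of _ "2 * K1 + K1 * norm (w - v)"] allI impI)
        fix gs :: "'v list" assume gs: "length gs = j"
        have "norm (D j w gs - D j v gs - D (Suc j) v ((w - v) # gs)) \<le>
            (2 * K1) * prod_list (map norm gs) + K1 * (norm (w - v) * prod_list (map norm gs))"
          using norm_triangle_ineq4[of "D j w gs - D j v gs" "D (Suc j) v ((w - v) # gs)"]
            bdiff[of j gs w v] bd1[of "Suc j" "(w - v) # gs" v] j gs by simp
        then show "norm ((D j (v + (w - v)) - D j v - (\<lambda>hs. D (Suc j) v ((w - v) # hs))) gs)
            \<le> (2 * K1 + K1 * norm (w - v)) * prod_list (map norm gs)"
          by (simp add: algebra_simps)
      qed
      also have "\<dots> = \<epsilon> * norm (w - v) * (?P / (?P + 1))" by simp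
      also have "\<dots> \<le> \<epsilon> * norm (w - v) * 1"
        using \<epsilon> P0[of hs] by (intro mult_left_mono) auto
      finally show ?thesis by simp
    qed
    then show "\<exists>\<delta>>0. \<forall>w. norm (w - v) < \<delta> \<longrightarrow>
        norm (D j w hs - D j v hs - D (Suc j) v ((w - v) # hs)) \<le> \<epsilon> * norm (w - v)"
      using \<delta> by blast
  qed
  \<comment> \<open>The summand \<open>2 * K1\<close> serves bounds and differences at lower orders,
    \<open>\<bar>H\<bar>\<close> the Hoelder bound of the top order.\<close>
  define K where "K = 2 * K1 + \<bar>H\<bar>"
  have K: "2 * K1 \<le> K" "\<bar>H\<bar> \<le> K" "K1 \<le> K" "0 \<le> K" using K10 by (auto simp: K_def)
  have hol: "norm (D j v hs - D j w hs) \<le> K * norm (v - w) powr \<gamma> * prod_list (map norm hs)"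
    if j: "j \<le> Suc k" and hs: "length hs = j" for j v w hs
  proof (cases "j = Suc k")
    case True
    have "norm ((D (Suc k) v - D (Suc k) w) hs) \<le> H * norm (v - w) powr \<gamma> * prod_list (map norm hs)"
      by (rule app[OF H], rule exI[of _ "2 * K1"]) (use bdiff[of "Suc k"] hs True in auto)
    also have "\<dots> \<le> K * norm (v - w) powr \<gamma> * prod_list (map norm hs)"
      using K P0 by (intro mult_right_mono) auto
    finally show ?thesis by (simp add: True)
  next
    case False
    then have j: "j \<le> k" using j by simp
    let ?P = "prod_list (map norm hs)"
    have "norm (D j v hs - D j w hs) \<le> (2 * K1 * ?P) * norm (v - w) powr \<gamma>"
    \<comment> \<open>At distance at most 1 the Lipschitz bound is stronger than the Hoelder bound;
      beyond 1 the trivial bound suffices.\<close>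
    proof (cases "norm (v - w) \<le> 1")
      case True
      have "norm (D j v hs - D j w hs) \<le> (K1 * ?P) * norm (v - w)"
        by (rule lipschitz_from_derivative_bound[OF der[OF j hs]])
           (use bd1[of "Suc j" "_ # hs"] j hs in \<open>auto simp: mult_ac\<close>)
      also have "\<dots> \<le> (2 * K1 * ?P) * norm (v - w) powr \<gamma>"
        using powr_le_const_mult_powr[of "norm (v - w)" 1 \<gamma> 1] True \<gamma> K10 P0
        by (intro mult_mono) (auto intro: mult_right_mono)
      finally show ?thesis .
    next
      case False
      then have "1 \<le> norm (v - w) powr \<gamma>" using \<gamma> by (intro ge_one_powr_ge_zero) auto
      then have "(2 * K1 * ?P) * 1 \<le> (2 * K1 * ?P) * norm (v - w) powr \<gamma>"
        using K10 P0 by (intro mult_left_mono) auto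
      then show ?thesis using bdiff[of j hs v w] j hs by simp
    qed
    also have "\<dots> = 2 * K1 * (norm (v - w) powr \<gamma> * ?P)" by simp
    also have "\<dots> \<le> K * (norm (v - w) powr \<gamma> * ?P)"
      using K(1) P0 by (intro mult_right_mono) auto
    finally show ?thesis by (simp add: mult.assoc)
  qed
  have "smooth_family D k K \<gamma>"
  proof
    show "norm (D j v hs) \<le> K * prod_list (map norm hs)" if "j \<le> Suc k" "length hs = j" for j v hs
      using bd1[OF that, of v] mult_right_mono[OF K(3) P0[of hs]] by linarith
  qed (use mul der hol K \<gamma> in auto)
  then show thesis using D0 by (rule that)
qed

section \<open>The seminorms in the control and the norm of controlled paths\<close>

lemma pvar_finite_bound:
  assumes "pvar_finite T \<omega> p X"
  shows "0 \<le> pvar_norm T \<omega> p X"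
    and "0 \<le> s \<Longrightarrow> s < t \<Longrightarrow> t \<le> T \<Longrightarrow> norm (X s t) \<le> pvar_norm T \<omega> p X * \<omega> s t powr (1 / p)"
proof -
  let ?I = "{(s, t). 0 \<le> s \<and> s < t \<and> t \<le> T}"
  have S: "pvar_bounds T \<omega> p X =
      {C. 0 \<le> C \<and> (\<forall>i\<in>?I. (\<lambda>(s, t). norm (X s t)) i \<le> C * (\<lambda>(s, t). \<omega> s t powr (1 / p)) i)}"
    unfolding pvar_bounds_def by auto
  note A = Inf_of_bounds_attained[of ?I "\<lambda>(s, t). \<omega> s t powr (1 / p)" "\<lambda>(s, t). norm (X s t)", folded S]
  show "0 \<le> pvar_norm T \<omega> p X"
    unfolding pvar_norm_def by (rule A(1)) (use assms in \<open>auto simp: pvar_finite_def\<close>)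
  show "norm (X s t) \<le> pvar_norm T \<omega> p X * \<omega> s t powr (1 / p)" if "0 \<le> s" "s < t" "t \<le> T"
    using A(2)[of "(s, t)"] that assms unfolding pvar_norm_def pvar_finite_def by auto
qed

lemma pvar_norm_le:
  assumes "0 \<le> C" "\<And>s t. 0 \<le> s \<Longrightarrow> s < t \<Longrightarrow> t \<le> T \<Longrightarrow> norm (X s t) \<le> C * \<omega> s t powr (1 / p)"
  shows "pvar_finite T \<omega> p X" "pvar_norm T \<omega> p X \<le> C"
proof -
  have C: "C \<in> pvar_bounds T \<omega> p X" using assms by (simp add: pvar_bounds_def)
  then show "pvar_finite T \<omega> p X" by (auto simp: pvar_finite_def)
  show "pvar_norm T \<omega> p X \<le> C"
    unfolding pvar_norm_def by (rule cInf_lower[OF C]) (auto simp: pvar_bounds_def intro: bdd_belowI[of _ 0])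
qed

lemma pvar_add:
  assumes "pvar_finite T \<omega> p X" "pvar_finite T \<omega> p Y" "\<And>s t. Z s t = X s t + Y s t"
  shows "pvar_finite T \<omega> p Z" "pvar_norm T \<omega> p Z \<le> pvar_norm T \<omega> p X + pvar_norm T \<omega> p Y"
proof -
  have "norm (Z s t) \<le> (pvar_norm T \<omega> p X + pvar_norm T \<omega> p Y) * \<omega> s t powr (1 / p)"
    if "0 \<le> s" "s < t" "t \<le> T" for s t
    unfolding assms(3) distrib_right
    by (rule norm_triangle_mono[OF pvar_finite_bound(2)[OF assms(1)] pvar_finite_bound(2)[OF assms(2)]]) (use that in auto)
  then show "pvar_finite T \<omega> p Z" "pvar_norm T \<omega> p Z \<le> pvar_norm T \<omega> p X + pvar_norm T \<omega> p Y"
    using pvar_norm_le[of "pvar_norm T \<omega> p X + pvar_norm T \<omega> p Y" T Z \<omega> p]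
      pvar_finite_bound(1)[OF assms(1)] pvar_finite_bound(1)[OF assms(2)] by auto
qed

lemma pvar_scaleR:
  assumes "pvar_finite T \<omega> p X" "\<And>s t. Z s t = c *\<^sub>R X s t"
  shows "pvar_finite T \<omega> p Z" "pvar_norm T \<omega> p Z \<le> \<bar>c\<bar> * pvar_norm T \<omega> p X"
proof -
  have "norm (Z s t) \<le> \<bar>c\<bar> * pvar_norm T \<omega> p X * \<omega> s t powr (1 / p)" if "0 \<le> s" "s < t" "t \<le> T" for s t
    using pvar_finite_bound(2)[OF assms(1) that] by (simp add: assms(2) mult.assoc mult_left_mono)
  then show "pvar_finite T \<omega> p Z" "pvar_norm T \<omega> p Z \<le> \<bar>c\<bar> * pvar_norm T \<omega> p X"
    using pvar_norm_le[of "\<bar>c\<bar> * pvar_norm T \<omega> p X" T Z \<omega> p] pvar_finite_bound(1)[OF assms(1)] by auto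
qed

text \<open>Increments and remainders depend linearly on the pair of path and Gubinelli derivative,
  so each summand of the norm is a seminorm.\<close>

lemma normed_carrier_controlled:
  fixes x :: "'u::banach two_level"
  shows "normed_carrier (controlled_nspace T \<omega> q r x :: ('u, 'v::banach) cpath nspace)"
proof -
  let ?E = "controlled_nspace T \<omega> q r x :: ('u, 'v) cpath nspace"
  have i: "increment (snd (a + b)) s t = increment (snd a) s t + increment (snd b) s t"
    "increment (snd (c *\<^sub>R a)) s t = c *\<^sub>R increment (snd a) s t" for a b :: "('u, 'v) cpath" and c s t :: real
    by (simp_all add: increment_def scaleR_fun_def scaleR_diff_right)
  have r: "remainder x (a + b) s t = remainder x a s t + remainder x b s t"
    "remainder x (c *\<^sub>R a) s t = c *\<^sub>R remainder x a s t" for a b :: "('u, 'v) cpath" and c s t :: real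
    by (simp_all add: remainder_def increment_def scaleR_fun_def scaleR_diff_right blinfun.add_left blinfun.scaleR_left)
  show ?thesis
    unfolding normed_carrier_def
  proof (intro conjI ballI allI)
    show "0 \<in> carr ?E"
      by (auto simp: controlled_nspace_def increment_def remainder_def intro!: pvar_norm_le(1)[of 0])
    fix a b :: "('u, 'v) cpath" and c :: real
    assume a: "a \<in> carr ?E"
    then have fa: "pvar_finite T \<omega> q (increment (snd a))" "pvar_finite T \<omega> r (remainder x a)"
      by (auto simp: controlled_nspace_def)
    show "0 \<le> nrm ?E a"
      using fa[THEN pvar_finite_bound(1)] by (simp add: controlled_nspace_def)
    show "c *\<^sub>R a \<in> carr ?E"
      using a pvar_scaleR(1)[OF fa(1) i(2)] pvar_scaleR(1)[OF fa(2) r(2)]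
      by (auto simp: controlled_nspace_def scaleR_fun_def)
    show "nrm ?E (c *\<^sub>R a) \<le> \<bar>c\<bar> * nrm ?E a"
      using pvar_scaleR(2)[OF fa(1) i(2)[of c a]] pvar_scaleR(2)[OF fa(2) r(2)[of c a]]
      by (simp add: controlled_nspace_def scaleR_fun_def distrib_left)
    assume b: "b \<in> carr ?E"
    then have fb: "pvar_finite T \<omega> q (increment (snd b))" "pvar_finite T \<omega> r (remainder x b)"
      by (auto simp: controlled_nspace_def)
    show "a + b \<in> carr ?E"
      using a b pvar_add(1)[OF fa(1) fb(1) i(1)] pvar_add(1)[OF fa(2) fb(2) r(1)]
      by (auto simp: controlled_nspace_def)
    show "nrm ?E (a + b) \<le> nrm ?E a + nrm ?E b"
      using pvar_add(2)[OF fa(1) fb(1) i(1)] pvar_add(2)[OF fa(2) fb(2) r(1)]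
        norm_triangle_ineq[of "fst a 0" "fst b 0"] norm_triangle_ineq[of "snd a 0" "snd b 0"]
      by (simp add: controlled_nspace_def)
  qed
qed

section \<open>Derivatives of the composition operator\<close>

text \<open>The witness \<open>c\<close> is the product over the other slots. It turns the bound of
  a multilinear form into a bound for the linear map in a single slot.\<close>

lemma prod_list_map_update_mult:
  fixes g :: "'a \<Rightarrow> 'b::comm_monoid_mult"
  shows "i < length hs \<Longrightarrow> \<exists>c. \<forall>a. prod_list (map g (hs[i := a])) = g a * c"
proof (induction hs arbitrary: i)
  case (Cons h hs)
  show ?case
  proof (cases i)
    case (Suc m)
    then obtain c where "\<forall>a. prod_list (map g (hs[m := a])) = g a * c" using Cons by auto
    then show ?thesis using Suc by (auto intro!: exI[of _ "g h * c"] simp: mult_ac)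
  qed auto
qed simp

lemma (in smooth_family) D_bounded_linear:
  assumes "j \<le> Suc k" "length hs = j" "i < j"
  shows "bounded_linear (\<lambda>a. D j v (hs[i := a]))"
proof -
  obtain c where c: "\<And>a. prod_list (map norm (hs[i := a])) = norm a * c"
    using prod_list_map_update_mult[of i hs norm] assms by auto
  have lin: "linear (\<lambda>a. D j v (hs[i := a]))"
    using assms by (intro multilinear_list_linear[OF D_multilinear])
  show ?thesis
    by (rule bounded_linear_intro[where K = "K * c"])
       (use D_bound[OF assms(1), of "hs[i := _]" v] assms c in
         \<open>auto simp: linear_add[OF lin] linear_scale[OF lin] mult_ac\<close>)
qed

text \<open>This justifies bundling the Leibniz formula by \<open>Blinfun\<close> into an element of
  L(U, W).\<close>

lemma (in smooth_family) lift_dagger_bounded_linear: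
  assumes j: "j \<le> k" and zs: "length zs = j"
  shows "bounded_linear (lift_dagger j y zs t)"
proof -
  let ?hs = "map (\<lambda>z. fst z t) zs"
  have "bounded_linear (\<lambda>a. D (Suc j) (fst y t) ((undefined # ?hs)[0 := a]))"
    using j zs by (intro D_bounded_linear) auto
  then have 1: "bounded_linear (\<lambda>u. D (Suc j) (fst y t) (blinfun_apply (snd y t) u # ?hs))"
    using bounded_linear_compose[OF _ blinfun.bounded_linear_right] by fastforce
  have 2: "bounded_linear (\<lambda>u. D j (fst y t) (?hs[i := blinfun_apply (snd (zs ! i) t) u]))" if "i < length zs" for i
    using j zs that
    by (intro bounded_linear_compose[OF D_bounded_linear blinfun.bounded_linear_right]) auto
  show ?thesis
    unfolding lift_dagger_def multilinear_dagger_def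
    by (intro bounded_linear_add bounded_linear_sum 1 2) auto
qed

lemma (in smooth_family) lift_path_linear:
  assumes j: "j \<le> k" and zs: "length zs = j" and i: "i < j"
  shows "lift_path j y (zs[i := a + b]) t = lift_path j y (zs[i := a]) t + lift_path j y (zs[i := b]) t"
    and "lift_path j y (zs[i := c *\<^sub>R a]) t = c *\<^sub>R lift_path j y (zs[i := a]) t"
proof -
  have lin: "linear (\<lambda>a. D j (fst y t) ((map (\<lambda>z. fst z t) zs)[i := a]))"
    using assms by (intro multilinear_list_linear[OF D_multilinear]) auto
  show "lift_path j y (zs[i := a + b]) t = lift_path j y (zs[i := a]) t + lift_path j y (zs[i := b]) t"
    "lift_path j y (zs[i := c *\<^sub>R a]) t = c *\<^sub>R lift_path j y (zs[i := a]) t"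
    by (simp_all add: lift_path_def multilinear_path_def map_update scaleR_fun_def
        linear_add[OF lin] linear_scale[OF lin])
qed

text \<open>The direction in slot \<open>i\<close> enters the summand \<open>l = i\<close> through
  its Gubinelli derivative and all other terms through its value; each dependence is linear, so
  every summand \<open>?s\<close> is treated by one of two cases.\<close>

lemma (in smooth_family) lift_dagger_linear:
  assumes j: "j \<le> k" and zs: "length zs = j" and i: "i < j"
  shows "lift_dagger j y (zs[i := a + b]) t u = lift_dagger j y (zs[i := a]) t u + lift_dagger j y (zs[i := b]) t u"
    and "lift_dagger j y (zs[i := c *\<^sub>R a]) t u = c *\<^sub>R lift_dagger j y (zs[i := a]) t u"
proof -
  let ?hs = "map (\<lambda>z. fst z t) zs"
  let ?s = "\<lambda>a l. D j (fst y t) (?hs[i := fst a t, l := blinfun_apply (snd (zs[i := a] ! l) t) u])"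
  have lin1: "linear (\<lambda>a. D (Suc j) (fst y t) (blinfun_apply (snd y t) u # ?hs[i := a]))"
    using multilinear_list_linear[OF D_multilinear[of "Suc j"], of "blinfun_apply (snd y t) u # ?hs" "Suc i"] assms by simp
  have lin2: "linear (\<lambda>a. D j (fst y t) (hs[l := a]))" if "length hs = j" "l < j" for hs l
    using assms that by (intro multilinear_list_linear[OF D_multilinear]) auto
  have swap: "?s a l = D j (fst y t) ((?hs[l := blinfun_apply (snd (zs ! l) t) u])[i := fst a t])" if "l \<noteq> i" for a l
    using that by (simp add: list_update_swap)
  have add: "?s (a + b) l = ?s a l + ?s b l" if l: "l < j" for l
  proof (cases "l = i")
    case True
    then show ?thesis using linear_add[OF lin2[of ?hs i]] assms by (simp add: blinfun.add_left)
  next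
    case False
    have "linear (\<lambda>a. D j (fst y t) ((?hs[l := blinfun_apply (snd (zs ! l) t) u])[i := a]))"
      using assms by (intro lin2) auto
    from linear_add[OF this] show ?thesis unfolding swap[OF False] by simp
  qed
  have scale: "?s (c *\<^sub>R a) l = c *\<^sub>R ?s a l" if l: "l < j" for l
  proof (cases "l = i")
    case True
    then show ?thesis using linear_scale[OF lin2[of ?hs i]] assms by (simp add: scaleR_fun_def blinfun.scaleR_left)
  next
    case False
    have "linear (\<lambda>a. D j (fst y t) ((?hs[l := blinfun_apply (snd (zs ! l) t) u])[i := a]))"
      using assms by (intro lin2) auto
    from linear_scale[OF this] show ?thesis unfolding swap[OF False] by (simp add: scaleR_fun_def)
  qed
  have e: "lift_dagger j y (zs[i := a]) t u =
      D (Suc j) (fst y t) (blinfun_apply (snd y t) u # ?hs[i := fst a t]) + (\<Sum>l<j. ?s a l)" for a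
    using zs by (simp add: lift_dagger_def multilinear_dagger_def map_update)
  show "lift_dagger j y (zs[i := a + b]) t u = lift_dagger j y (zs[i := a]) t u + lift_dagger j y (zs[i := b]) t u"
    unfolding e using add by (simp add: linear_add[OF lin1] sum.distrib)
  show "lift_dagger j y (zs[i := c *\<^sub>R a]) t u = c *\<^sub>R lift_dagger j y (zs[i := a]) t u"
    unfolding e using scale
    by (simp add: linear_scale[OF lin1] scaleR_fun_def[of c "fst a"] scaleR_right_distrib scaleR_sum_right)
qed

section \<open>The composition operator between the two spaces of controlled paths\<close>

locale controlled_nemytskii =
  nemytskii_family T \<omega> "fst x" W C\<^sub>X \<alpha> D k K \<gamma> \<beta> \<rho> \<kappa> \<beta>' \<rho>'
  for T \<omega> and x :: "'u::banach two_level" and W C\<^sub>X \<alpha>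
    and D :: "nat \<Rightarrow> 'v::banach \<Rightarrow> 'v list \<Rightarrow> 'w::banach" and k K \<gamma> \<beta> \<rho> \<kappa> \<beta>' \<rho>' +
  fixes q r q' r' :: real
  assumes exponents: "\<beta> = 1 / q" "\<rho> = 1 / r" "\<beta>' = 1 / q'" "\<rho>' = 1 / r'"
begin

abbreviation PV :: "('u, 'v) cpath nspace" where "PV \<equiv> controlled_nspace T \<omega> q r x"
abbreviation QW :: "('u, 'w) cpath nspace" where "QW \<equiv> controlled_nspace T \<omega> q' r' x"
abbreviation Forms :: "nat \<Rightarrow> (('u, 'v) cpath list \<Rightarrow> ('u, 'w) cpath) nspace"
  where "Forms j \<equiv> multilinear_nspace PV j QW"

text \<open>This is the cost of passing from the norm of the source space, which contains initial
  values and seminorms, to the uniform bound of \<open>controlled_boundI_initial\<close>.\<close>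

definition C\<^sub>0 :: real where "C\<^sub>0 = (C\<^sub>X + W) * (1 + W + (1 + W) * (C\<^sub>X * W))"

definition \<eta> :: real where "\<eta> = (1 - \<kappa>) * \<gamma>"

lemma C0_nonneg: "0 \<le> C\<^sub>0"
  using CX_nonneg W_ge_1 by (simp add: C\<^sub>0_def)

lemma \<eta>_pos: "0 < \<eta>"
  using \<kappa>_less_1 \<gamma>_pos by (simp add: \<eta>_def)

lemmas PV_normed = normed_carrier_controlled[of T \<omega> q r x, where 'v = 'v]
lemmas PV_nonneg = normed_carrierD(2)[OF PV_normed]

lemma path_bound_carr:
  assumes y: "y \<in> carr PV"
  shows "path_bound (C\<^sub>0 * nrm PV y) y"
proof -
  have f: "pvar_finite T \<omega> q (increment (snd y))" "pvar_finite T \<omega> r (remainder x y)"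
    using y by (auto simp: controlled_nspace_def)
  note b = f[THEN pvar_finite_bound(1)]
  let ?N = "nrm PV y"
  have N: "?N = norm (fst y 0) + norm (snd y 0) + pvar_norm T \<omega> q (increment (snd y)) + pvar_norm T \<omega> r (remainder x y)"
    by (simp add: controlled_nspace_def)
  have "controlled_bound \<beta> \<rho> ((C\<^sub>X + W) * ((1 + W + (1 + W) * (C\<^sub>X * W)) * ?N)) (fst y) (\<lambda>t. blinfun_apply (snd y t))"
  proof (rule controlled_boundI_initial)
    show "norm (fst y 0) \<le> ?N" unfolding N using b by simp
    have "norm (snd y 0) \<le> ?N" unfolding N using b by simp
    then show "norm (blinfun_apply (snd y 0) u) \<le> ?N * norm u" for u
      using norm_blinfun[of "snd y 0" u] mult_right_mono[of _ ?N "norm u"] by fastforce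
    fix s t u assume st: "0 \<le> s" "s < t" "t \<le> T"
    have "norm (blinfun_apply (snd y t) u - blinfun_apply (snd y s) u) \<le> norm (increment (snd y) s t) * norm u"
      using norm_blinfun[of "snd y t - snd y s" u] by (simp add: increment_def blinfun.diff_left)
    also have "\<dots> \<le> (pvar_norm T \<omega> q (increment (snd y)) * \<omega> s t powr (1 / q)) * norm u"
      by (intro mult_right_mono pvar_finite_bound(2)[OF f(1) st]) auto
    also have "\<dots> \<le> (?N * \<omega> s t powr (1 / q)) * norm u"
      unfolding N using b by (intro mult_right_mono) auto
    finally show "norm (blinfun_apply (snd y t) u - blinfun_apply (snd y s) u) \<le> ?N * norm u * \<omega> s t powr \<beta>"
      by (simp add: exponents mult_ac)
    have "norm (remainder x y s t) \<le> pvar_norm T \<omega> r (remainder x y) * \<omega> s t powr (1 / r)"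
      by (rule pvar_finite_bound(2)[OF f(2) st])
    also have "\<dots> \<le> ?N * \<omega> s t powr (1 / r)"
      unfolding N using b by (intro mult_right_mono) auto
    finally show "norm (fst y t - fst y s - blinfun_apply (snd y s) (fst x s t)) \<le> ?N * \<omega> s t powr \<rho>"
      by (simp add: exponents remainder_def increment_def)
  qed (use \<rho>_gt \<rho>_le_1 \<beta>_pos \<beta>_le_1 in auto)
  then show ?thesis by (simp add: C\<^sub>0_def mult.assoc)
qed

text \<open>The way back from uniform bounds to the norm costs a factor 4, one for each of its
  summands.\<close>

lemma carr_of_controlled_bound:
  assumes b: "controlled_bound \<beta>' \<rho>' N Y Z"
    and w: "\<And>t. t \<in> {0..T} \<Longrightarrow> fst w t = Y t" "\<And>t u. t \<in> {0..T} \<Longrightarrow> blinfun_apply (snd w t) u = Z t u"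
    and off: "\<And>t. t \<notin> {0..T} \<Longrightarrow> fst w t = 0" "\<And>t. t \<notin> {0..T} \<Longrightarrow> snd w t = 0"
  shows "w \<in> carr QW" "nrm QW w \<le> 4 * N"
proof -
  have N: "0 \<le> N" by (rule controlled_bound_nonneg[OF b])
  have b: "controlled_bound \<beta>' \<rho>' N (fst w) (\<lambda>t. blinfun_apply (snd w t))"
    using controlled_bound_cong[of "fst w" Y "\<lambda>t. blinfun_apply (snd w t)" Z \<beta>' \<rho>' N] w b by blast
  note b = controlled_boundD[OF b]
  have 1: "norm (increment (snd w) s t) \<le> N * \<omega> s t powr (1 / q')" if st: "0 \<le> s" "s < t" "t \<le> T" for s t
  proof (rule norm_blinfun_bound)
    show "norm (blinfun_apply (increment (snd w) s t) u) \<le> N * \<omega> s t powr (1 / q') * norm u" for u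
      using b(4)[OF st, of u] by (simp add: increment_def blinfun.diff_left exponents mult_ac)
  qed (use N in simp)
  have 2: "norm (remainder x w s t) \<le> N * \<omega> s t powr (1 / r')" if st: "0 \<le> s" "s < t" "t \<le> T" for s t
    using b(5)[OF st] by (simp add: remainder_def increment_def exponents)
  note p1 = pvar_norm_le[of N T "increment (snd w)" \<omega> q', OF N 1]
    and p2 = pvar_norm_le[of N T "remainder x w" \<omega> r', OF N 2]
  show "w \<in> carr QW" using off p1(1) p2(1) by (simp add: controlled_nspace_def)
  have "norm (snd w 0) \<le> N"
    by (rule norm_blinfun_bound[OF N]) (use b(2)[of 0] T_nonneg in auto)
  then show "nrm QW w \<le> 4 * N"
    using p1(2) p2(2) b(1)[of 0] T_nonneg by (simp add: controlled_nspace_def)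
qed

text \<open>This is the derivative of order \<open>j\<close> of the composition operator. It is 0
  off [0, T] and off the tuples, as the carriers of the path and form spaces demand.\<close>

definition lift :: "nat \<Rightarrow> ('u, 'v) cpath \<Rightarrow> ('u, 'v) cpath list \<Rightarrow> ('u, 'w) cpath"
  where "lift j y zs = (if zs \<in> tuples PV j then
    ((\<lambda>t. if t \<in> {0..T} then lift_path j y zs t else 0),
     (\<lambda>t. if t \<in> {0..T} then Blinfun (lift_dagger j y zs t) else 0)) else 0)"

lemma tuplesD: "zs \<in> tuples PV j \<Longrightarrow> length zs = j" "zs \<in> tuples PV j \<Longrightarrow> z \<in> set zs \<Longrightarrow> z \<in> carr PV"
  by (auto simp: tuples_def)

lemma lift_apply:
  assumes "zs \<in> tuples PV j" "j \<le> k"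
  shows "fst (lift j y zs) t = (if t \<in> {0..T} then lift_path j y zs t else 0)"
    and "blinfun_apply (snd (lift j y zs) t) u = (if t \<in> {0..T} then lift_dagger j y zs t u else 0)"
  using assms bounded_linear_Blinfun_apply[OF lift_dagger_bounded_linear[OF assms(2) tuplesD(1)[OF assms(1)]]]
  by (auto simp: lift_def)

lemma lift_inside:
  assumes "zs \<in> tuples PV j" "j \<le> k" "t \<in> {0..T}"
  shows "fst (lift j y zs) t = lift_path j y zs t"
    and "blinfun_apply (snd (lift j y zs) t) u = lift_dagger j y zs t u"
  using lift_apply[OF assms(1,2)] assms(3) by simp_all

lemma lift_outside:
  assumes "t \<notin> {0..T}" shows "fst (lift j y zs) t = 0" "snd (lift j y zs) t = 0"
  using assms by (auto simp: lift_def)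

lemma prod_list_C0: "prod_list (map (\<lambda>z. C\<^sub>0 * nrm PV z) zs) = C\<^sub>0 ^ length zs * prod_list (map (nrm PV) zs)"
  by (induction zs) simp_all

lemma lift_estimate:
  assumes zs: "zs \<in> tuples PV j" and j: "j \<le> k" and y: "y \<in> carr PV" and R: "1 \<le> R" "C\<^sub>0 * nrm PV y \<le> R"
  shows "lift j y zs \<in> carr QW"
    and "nrm QW (lift j y zs) \<le> 4 * (lift_const j * lift_growth R * C\<^sub>0 ^ j) * prod_list (map (nrm PV) zs)"
proof -
  have "controlled_bound \<beta>' \<rho>' (lift_const j * (lift_growth R * (C\<^sub>0 ^ j * prod_list (map (nrm PV) zs))))
      (lift_path j y zs) (lift_dagger j y zs)"
    using lift_bound[of zs R y "\<lambda>z. C\<^sub>0 * nrm PV z"] controlled_bound_mono[OF path_bound_carr[OF y] R(2)]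
      tuplesD[OF zs] path_bound_carr R j by (simp add: prod_list_C0)
  from carr_of_controlled_bound[OF this, of "lift j y zs"]
  show "lift j y zs \<in> carr QW"
    and "nrm QW (lift j y zs) \<le> 4 * (lift_const j * lift_growth R * C\<^sub>0 ^ j) * prod_list (map (nrm PV) zs)"
    by (simp_all add: lift_inside[OF zs j] lift_outside mult.assoc)
qed

lemma lift_in_Forms:
  assumes j: "j \<le> k" and y: "y \<in> carr PV"
  shows "lift j y \<in> carr (Forms j)"
proof -
  let ?R = "max 1 (C\<^sub>0 * nrm PV y)"
  have R: "1 \<le> ?R" "C\<^sub>0 * nrm PV y \<le> ?R" by auto
  note e = lift_estimate[OF _ j y R]
  note c = normed_carrierD[OF PV_normed]
  have add: "lift j y (hs[i := a + b]) = lift j y (hs[i := a]) + lift j y (hs[i := b])"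
    if hs: "hs \<in> tuples PV j" "i < j" "a \<in> carr PV" "b \<in> carr PV" for hs i a b
  proof -
    have t: "hs[i := a + b] \<in> tuples PV j" "hs[i := a] \<in> tuples PV j" "hs[i := b] \<in> tuples PV j"
      by (intro tuples_update c(3,5) hs)+
    show ?thesis
      by (intro prod_eqI ext blinfun_eqI)
         (simp_all add: lift_apply[OF t(1) j] lift_apply[OF t(2) j] lift_apply[OF t(3) j] blinfun.add_left
           lift_path_linear(1)[OF j tuplesD(1)[OF hs(1)] hs(2)] lift_dagger_linear(1)[OF j tuplesD(1)[OF hs(1)] hs(2)]
           del: fst_conv snd_conv)
  qed
  have scale: "lift j y (hs[i := r *\<^sub>R a]) = r *\<^sub>R lift j y (hs[i := a])"
    if hs: "hs \<in> tuples PV j" "i < j" "a \<in> carr PV" for hs i r a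
  proof -
    have t: "hs[i := r *\<^sub>R a] \<in> tuples PV j" "hs[i := a] \<in> tuples PV j"
      by (intro tuples_update c(3,5) hs)+
    show ?thesis
      by (intro prod_eqI ext blinfun_eqI)
         (simp_all add: lift_apply[OF t(1) j] lift_apply[OF t(2) j] scaleR_fun_def blinfun.scaleR_left
           lift_path_linear(2)[OF j tuplesD(1)[OF hs(1)] hs(2)] lift_dagger_linear(2)[OF j tuplesD(1)[OF hs(1)] hs(2)])
  qed
  show ?thesis
    unfolding multilinear_nspace_def using e add scale by (auto simp: lift_def intro!: exI)
qed

lemma lift_nrm:
  assumes j: "j \<le> k" and y: "y \<in> carr PV" and R: "1 \<le> R" "C\<^sub>0 * nrm PV y \<le> R"
  shows "nrm (Forms j) (lift j y) \<le> 4 * (lift_const j * lift_growth R * C\<^sub>0 ^ j)"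
proof (rule multilinear_nrm_le[OF _ lift_estimate(2)[OF _ j y R]])
  show "0 \<le> 4 * (lift_const j * lift_growth R * C\<^sub>0 ^ j)"
    using lift_const_nonneg C0_nonneg K_nonneg CX_nonneg W_ge_1 R by (simp add: lift_growth_def)
qed

text \<open>The 4 comes from the norm of the target, \<open>lift_const\<close> from the insertion of
  directions, the inner factor from the composition estimate, and the powers of
  \<open>C\<^sub>0\<close> from the distance of the paths and from the \<open>j\<close>
  directions.\<close>

definition holder_const :: "nat \<Rightarrow> real \<Rightarrow> real"
  where "holder_const j R = 4 * lift_const j * ((C\<^sub>X + W) * (6 * (K * R * R * W)) * C\<^sub>0 powr \<eta>) * C\<^sub>0 ^ j"

lemma holder_const_nonneg: "0 \<le> R \<Longrightarrow> 0 \<le> holder_const j R"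
  using lift_const_nonneg C0_nonneg K_nonneg CX_nonneg W_ge_1 by (simp add: holder_const_def)

lemma lift_holder:
  assumes j: "j \<le> k" and y: "y \<in> carr PV" "z \<in> carr PV"
    and R: "1 \<le> R" "C\<^sub>0 * nrm PV y \<le> R" "C\<^sub>0 * nrm PV z \<le> R" "C\<^sub>0 * nrm PV (y - z) \<le> R"
  shows "nrm (Forms j) (lift j y - lift j z) \<le> holder_const j R * nrm PV (y - z) powr \<eta>"
proof (rule multilinear_nrm_le)
  let ?\<delta> = "nrm PV (y - z)"
  have yz: "y - z \<in> carr PV" by (rule normed_carrier_diff(1)[OF PV_normed y])
  show "0 \<le> holder_const j R * ?\<delta> powr \<eta>" using holder_const_nonneg R by simp
  fix zs assume zs: "zs \<in> tuples PV j"
  have "controlled_bound \<beta>' \<rho>' (lift_const j *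
      ((C\<^sub>X + W) * (6 * (K * R * R * W) * (C\<^sub>0 * ?\<delta>) powr \<eta>) * (C\<^sub>0 ^ j * prod_list (map (nrm PV) zs))))
    (\<lambda>t. lift_path j y zs t - lift_path j z zs t) (\<lambda>t u. lift_dagger j y zs t u - lift_dagger j z zs t u)"
    using lift_diff[of zs R y z "C\<^sub>0 * ?\<delta>" "\<lambda>z. C\<^sub>0 * nrm PV z"] controlled_bound_mono[OF path_bound_carr[OF y(1)] R(2)]
      controlled_bound_mono[OF path_bound_carr[OF y(2)] R(3)] path_bound_carr[OF yz]
      tuplesD[OF zs] path_bound_carr R j by (simp add: prod_list_C0 \<eta>_def)
  from carr_of_controlled_bound(2)[OF this, of "(lift j y - lift j z) zs"]
  have "nrm QW ((lift j y - lift j z) zs) \<le> 4 * (lift_const j *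
      ((C\<^sub>X + W) * (6 * (K * R * R * W) * (C\<^sub>0 * ?\<delta>) powr \<eta>) * (C\<^sub>0 ^ j * prod_list (map (nrm PV) zs))))"
    by (simp add: lift_inside[OF zs j] lift_outside blinfun.diff_left)
  also have "(C\<^sub>0 * ?\<delta>) powr \<eta> = C\<^sub>0 powr \<eta> * ?\<delta> powr \<eta>"
    using C0_nonneg PV_nonneg[OF yz] by (simp add: powr_mult)
  finally show "nrm QW ((lift j y - lift j z) zs) \<le> holder_const j R * ?\<delta> powr \<eta> * prod_list (map (nrm PV) zs)"
    by (simp only: holder_const_def mult_ac)
qed

text \<open>Here \<open>h\<close> counts both as the distance of the paths, with exponent \<eta>,
  and as one further direction. Therefore the constant is the one of order
  \<open>Suc j\<close>.\<close>

lemma lift_taylor_nrm: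
  assumes j: "j < k" and y: "y \<in> carr PV" and h: "h \<in> carr PV"
    and R: "1 \<le> R" "C\<^sub>0 * nrm PV y \<le> R" and R': "R + C\<^sub>0 * nrm PV h \<le> R'"
  shows "nrm (Forms j) (lift j (y + h) - lift j y - (\<lambda>zs. lift (Suc j) y (h # zs)))
    \<le> holder_const (Suc j) R' * nrm PV h powr \<eta> * nrm PV h"
proof (rule multilinear_nrm_le)
  let ?\<delta> = "nrm PV h"
  have \<delta>: "0 \<le> ?\<delta>" by (rule PV_nonneg[OF h])
  have "0 \<le> R'" using R R' mult_nonneg_nonneg[OF C0_nonneg \<delta>] by linarith
  then show "0 \<le> holder_const (Suc j) R' * ?\<delta> powr \<eta> * ?\<delta>" using holder_const_nonneg \<delta> by simp
  fix zs assume zs: "zs \<in> tuples PV j"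
  have hzs: "h # zs \<in> tuples PV (Suc j)" using zs h by (simp add: tuples_Cons_iff)
  have j': "j \<le> k" "Suc j \<le> k" using j by auto
  have "controlled_bound \<beta>' \<rho>' (lift_const (Suc j) *
      ((C\<^sub>X + W) * (6 * (K * R' * R' * W) * (C\<^sub>0 * ?\<delta>) powr \<eta>) * (C\<^sub>0 * ?\<delta> * (C\<^sub>0 ^ j * prod_list (map (nrm PV) zs)))))
    (\<lambda>t. lift_path j (y + h) zs t - lift_path j y zs t - lift_path (Suc j) y (h # zs) t)
    (\<lambda>t u. lift_dagger j (y + h) zs t u - lift_dagger j y zs t u - lift_dagger (Suc j) y (h # zs) t u)"
    using lift_taylor[of zs R y "\<lambda>z. C\<^sub>0 * nrm PV z" h R', OF _ _ R(1) R' path_bound_carr[OF tuplesD(2)[OF hzs]]]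
      controlled_bound_mono[OF path_bound_carr[OF y] R(2)] tuplesD(1)[OF zs] j
    by (simp add: prod_list_C0 \<eta>_def)
  from carr_of_controlled_bound(2)[OF this, of "(lift j (y + h) - lift j y - (\<lambda>zs. lift (Suc j) y (h # zs))) zs"]
  have "nrm QW ((lift j (y + h) - lift j y - (\<lambda>zs. lift (Suc j) y (h # zs))) zs) \<le> 4 * (lift_const (Suc j) *
      ((C\<^sub>X + W) * (6 * (K * R' * R' * W) * (C\<^sub>0 * ?\<delta>) powr \<eta>) * (C\<^sub>0 * ?\<delta> * (C\<^sub>0 ^ j * prod_list (map (nrm PV) zs)))))"
    by (simp add: lift_inside[OF zs j'(1)] lift_inside[OF hzs j'(2)] lift_outside blinfun.diff_left)
  also have "(C\<^sub>0 * ?\<delta>) powr \<eta> = C\<^sub>0 powr \<eta> * ?\<delta> powr \<eta>"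
    using C0_nonneg \<delta> by (simp add: powr_mult)
  finally show "nrm QW ((lift j (y + h) - lift j y - (\<lambda>zs. lift (Suc j) y (h # zs))) zs)
      \<le> holder_const (Suc j) R' * ?\<delta> powr \<eta> * ?\<delta> * prod_list (map (nrm PV) zs)"
    by (simp only: holder_const_def mult_ac power_Suc)
qed

lemma lift_fderiv:
  assumes j: "j < k" and y: "y \<in> carr PV"
  shows "has_fderiv PV (Forms j) \<Omega> (lift j) (\<lambda>h zs. lift (Suc j) y (h # zs)) y"
proof (rule has_fderiv_of_order[OF PV_normed _ \<eta>_pos zero_less_one])
  show "nspace_bounded_linear PV (Forms j) (\<lambda>h zs. lift (Suc j) y (h # zs))"
    using j y by (intro multilinear_curry_bounded_linear[OF PV_normed] lift_in_Forms) auto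
  let ?R = "max 1 (C\<^sub>0 * nrm PV y)"
  fix h assume h: "h \<in> carr PV" "nrm PV h < 1"
  \<comment> \<open>For increments \<open>h\<close> of norm below 1 the bound
    \<open>?R + C\<^sub>0\<close> covers the whole segment, so a single constant serves all of
    them.\<close>
  have "C\<^sub>0 * nrm PV h \<le> C\<^sub>0 * 1" using h C0_nonneg by (intro mult_left_mono) auto
  then show "nrm (Forms j) (lift j (y + h) - lift j y - (\<lambda>zs. lift (Suc j) y (h # zs)))
      \<le> holder_const (Suc j) (?R + C\<^sub>0) * nrm PV h powr \<eta> * nrm PV h"
    by (intro lift_taylor_nrm[where R = ?R] j y h) auto
qed

lemma f_derivative:
  assumes "\<And>v. D 0 v [] = f v"
  shows "(f has_derivative (\<lambda>h. D (Suc 0) v [h])) (at v)" "frechet_derivative f (at v) = (\<lambda>h. D (Suc 0) v [h])"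
proof -
  show d: "(f has_derivative (\<lambda>h. D (Suc 0) v [h])) (at v)"
    using D_deriv[of 0 "[]" v] assms by simp
  show "frechet_derivative f (at v) = (\<lambda>h. D (Suc 0) v [h])"
    by (rule frechet_derivative_at[OF d, symmetric])
qed

lemma lift_0_eq_nemytskii:
  assumes f: "\<And>v. D 0 v [] = f v"
  shows "lift 0 y [] = nemytskii T f y"
proof -
  have e: "[] \<in> tuples PV 0" by (simp add: tuples_def)
  have bl: "bounded_linear (\<lambda>h. D (Suc 0) v [h])" for v
    by (rule has_derivative_bounded_linear[OF f_derivative(1)[OF f]])
  show ?thesis
    by (intro prod_eqI ext blinfun_eqI)
       (simp_all add: lift_apply[OF e] nemytskii_def lift_path_def lift_dagger_def multilinear_path_def
         multilinear_dagger_def f f_derivative(2)[OF f] bounded_linear_Blinfun_apply[OF bl])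
qed

text \<open>The constants grow with the bound \<open>R\<close> on the paths, so uniform estimates
  are obtained on a ball, where \<open>R\<close> can be fixed.\<close>

lemma holder_class_nemytskii:
  assumes f: "\<And>v. D 0 v [] = f v" and y0: "y0 \<in> carr PV"
  shows "holder_class PV QW {y \<in> carr PV. nrm PV (y - y0) < 1} k \<eta> (nemytskii T f)"
proof -
  let ?\<Omega> = "{y \<in> carr PV. nrm PV (y - y0) < 1}"
  \<comment> \<open>On the unit ball around \<open>y0\<close> a path has norm below
    \<open>nrm PV y0 + 1\<close> and two paths have distance below 2; \<open>nrm PV y0 + 2\<close>
    covers both, and the leading 1 gives \<open>1 \<le> R\<close>.\<close>
  define R where "R = 1 + C\<^sub>0 * (nrm PV y0 + 2)"
  note c = normed_carrierD[OF PV_normed] and cd = normed_carrier_diff[OF PV_normed]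
  have R1: "1 \<le> R" unfolding R_def using C0_nonneg PV_nonneg[OF y0] by simp
  have Ry: "C\<^sub>0 * nrm PV y \<le> R" if y: "y \<in> ?\<Omega>" for y
  proof -
    have "nrm PV (y - y0 + y0) \<le> nrm PV (y - y0) + nrm PV y0" using y y0 cd(1) by (intro c(4)) auto
    then have "nrm PV y \<le> nrm PV y0 + 2" using y by simp
    then have "C\<^sub>0 * nrm PV y \<le> C\<^sub>0 * (nrm PV y0 + 2)" using C0_nonneg by (rule mult_left_mono)
    then show ?thesis by (simp add: R_def)
  qed
  have Ryz: "C\<^sub>0 * nrm PV (y - z) \<le> R" if y: "y \<in> ?\<Omega>" "z \<in> ?\<Omega>" for y z
  proof -
    have "nrm PV ((y - y0) - (z - y0)) \<le> nrm PV (y - y0) + nrm PV (z - y0)" using y y0 cd(1) by (intro cd(2)) auto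
    then have "nrm PV (y - z) \<le> nrm PV y0 + 2" using y PV_nonneg[OF y0] by simp
    then have "C\<^sub>0 * nrm PV (y - z) \<le> C\<^sub>0 * (nrm PV y0 + 2)" using C0_nonneg by (rule mult_left_mono)
    then show ?thesis by (simp add: R_def)
  qed
  have H: "nrm (Forms j) (lift j y - lift j z) \<le> holder_const j R * nrm PV (y - z) powr \<eta>"
    if "j \<le> k" "y \<in> ?\<Omega>" "z \<in> ?\<Omega>" for j y z
    using that Ry Ryz by (intro lift_holder R1) auto
  have B: "nrm (Forms j) (lift j y) \<le> 4 * (lift_const j * lift_growth R * C\<^sub>0 ^ j)"
    if "j \<le> k" "y \<in> ?\<Omega>" for j y
    using that Ry by (intro lift_nrm R1) auto
  have cont: "nspace_continuous_on PV (Forms j) ?\<Omega> (lift j)" if "j \<le> k" for j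
    by (rule nspace_continuous_on_holder[OF PV_normed _ \<eta>_pos, of _ _ _ "holder_const j R"]) (use H that in auto)
  show ?thesis
    unfolding holder_class_def
  proof (intro exI[of _ lift] conjI)
    show "\<forall>y\<in>?\<Omega>. lift 0 y [] = nemytskii T f y" using lift_0_eq_nemytskii[OF f] by blast
    show "\<forall>j\<le>k. \<forall>y\<in>?\<Omega>. lift j y \<in> carr (Forms j)" using lift_in_Forms by blast
    show "\<forall>j<k. \<forall>y\<in>?\<Omega>. has_fderiv PV (Forms j) ?\<Omega> (lift j) (\<lambda>h hs. lift (Suc j) y (h # hs)) y"
      using lift_fderiv by blast
    show "\<forall>j\<le>k. \<exists>C. \<forall>y\<in>?\<Omega>. nrm (Forms j) (lift j y) \<le> C" using B by blast
    show "\<forall>j\<le>k. nspace_continuous_on PV (Forms j) ?\<Omega> (lift j)" using cont by blast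
    show "\<exists>C. \<forall>y\<in>?\<Omega>. \<forall>z\<in>?\<Omega>. nrm (Forms k) (lift k y - lift k z) \<le> C * nrm PV (y - z) powr \<eta>"
      using H by blast
  qed
qed

lemma nspace_open_ball:
  assumes y0: "y0 \<in> carr PV"
  shows "nspace_open PV {y \<in> carr PV. nrm PV (y - y0) < 1}"
  unfolding nspace_open_def
proof (intro conjI ballI)
  fix y assume y: "y \<in> {y \<in> carr PV. nrm PV (y - y0) < 1}"
  have "nrm PV (z - y0) < 1" if z: "z \<in> carr PV" "nrm PV (z - y) < 1 - nrm PV (y - y0)" for z
    using normed_carrierD(4)[OF PV_normed normed_carrier_diff(1)[OF PV_normed z(1), of y] normed_carrier_diff(1)[OF PV_normed _ y0, of y]] y z
    by simp
  then show "\<exists>\<delta>>0. \<forall>z\<in>carr PV. nrm PV (z - y) < \<delta> \<longrightarrow> z \<in> {y \<in> carr PV. nrm PV (y - y0) < 1}"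
    using y by (intro exI[of _ "1 - nrm PV (y - y0)"]) auto
qed auto

lemma locally_holder_class_nemytskii:
  assumes f: "\<And>v. D 0 v [] = f v"
  shows "locally_holder_class PV QW (carr PV) k \<eta> (nemytskii T f)"
  unfolding locally_holder_class_def
proof
  fix y assume y: "y \<in> carr PV"
  have "nrm PV (y - y) = 0"
    using normed_carrierD(6)[OF PV_normed y, of 0] PV_nonneg[OF normed_carrierD(1)[OF PV_normed]] by simp
  then show "\<exists>\<Omega>. nspace_open PV \<Omega> \<and> y \<in> \<Omega> \<and> \<Omega> \<subseteq> carr PV \<and> holder_class PV QW \<Omega> k \<eta> (nemytskii T f)"
    using y holder_class_nemytskii[OF f y] nspace_open_ball[OF y]
    by (intro exI[of _ "{z \<in> carr PV. nrm PV (z - y) < 1}"]) simp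
qed

lemma nemytskii_carr:
  assumes "\<And>v. D 0 v [] = f v" "y \<in> carr PV"
  shows "nemytskii T f y \<in> carr QW"
  using lift_estimate(1)[of "[]" 0 y "max 1 (C\<^sub>0 * nrm PV y)"] assms lift_0_eq_nemytskii[of f y]
  by (simp add: tuples_def)

section \<open>The Frechet derivative of the composition operator\<close>

text \<open>The class hides its derivatives behind an existential quantifier. The formula for the
  first one is therefore derived from the Taylor bound of order 0, where a form is identified with
  its value at \<open>[]\<close>.\<close>

lemma nemytskii_fderiv:
  assumes f: "\<And>v. D 0 v [] = f v" and k: "1 \<le> k" and y: "y \<in> carr PV"
  shows "has_fderiv PV QW (carr PV) (nemytskii T f) (\<lambda>z. lift 1 y [z]) y"
proof (rule has_fderiv_of_order[OF PV_normed _ \<eta>_pos zero_less_one])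
  have e: "[] \<in> tuples PV 0" by (simp add: tuples_def)
  note app = multilinear_carr_bound(2)[OF PV_normed, of _ 0, OF _ e]
  have L: "nspace_bounded_linear PV (Forms 0) (\<lambda>z zs. lift 1 y (z # zs))"
    using multilinear_curry_bounded_linear[OF PV_normed lift_in_Forms[OF k y, unfolded One_nat_def]] by simp
  obtain C where C: "\<And>a. a \<in> carr PV \<Longrightarrow> nrm (Forms 0) (\<lambda>zs. lift 1 y (a # zs)) \<le> C * nrm PV a"
    and Lc: "\<And>a. a \<in> carr PV \<Longrightarrow> (\<lambda>zs. lift 1 y (a # zs)) \<in> carr (Forms 0)"
    using L unfolding nspace_bounded_linear_def by blast
  have add: "lift 1 y [a + b] = lift 1 y [a] + lift 1 y [b]" if "a \<in> carr PV" "b \<in> carr PV" for a b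
    using multilinear_carrD(3)[OF lift_in_Forms[OF k y], of "[0]" 0 a b] normed_carrierD(1)[OF PV_normed] that
    by (simp add: tuples_def)
  have scale: "lift 1 y [c *\<^sub>R a] = c *\<^sub>R lift 1 y [a]" if "a \<in> carr PV" for a c
    using multilinear_carrD(4)[OF lift_in_Forms[OF k y], of "[0]" 0 a c] normed_carrierD(1)[OF PV_normed] that
    by (simp add: tuples_def)
  show "nspace_bounded_linear PV QW (\<lambda>z. lift 1 y [z])"
    unfolding nspace_bounded_linear_def
  proof (intro conjI ballI allI)
    show "lift 1 y [a] \<in> carr QW" if "a \<in> carr PV" for a
      using multilinear_carrD(1)[OF Lc[OF that] e] .
    have "nrm QW (lift 1 y [a]) \<le> C * nrm PV a" if "a \<in> carr PV" for a
      using order_trans[OF app[OF Lc[OF that]]] C[OF that] by simp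
    then show "\<exists>C. \<forall>a\<in>carr PV. nrm QW (lift 1 y [a]) \<le> C * nrm PV a" by blast
  qed (use add scale in auto)
  let ?R = "max 1 (C\<^sub>0 * nrm PV y)"
  fix h assume h: "h \<in> carr PV" "nrm PV h < 1"
  have "C\<^sub>0 * nrm PV h \<le> C\<^sub>0 * 1" using h C0_nonneg by (intro mult_left_mono) auto
  then have est: "nrm (Forms 0) (lift 0 (y + h) - lift 0 y - (\<lambda>zs. lift (Suc 0) y (h # zs)))
      \<le> holder_const (Suc 0) (?R + C\<^sub>0) * nrm PV h powr \<eta> * nrm PV h"
    using k by (intro lift_taylor_nrm[where R = ?R] y h) auto
  \<comment> \<open>The empty product of norms is 1, so the value at \<open>[]\<close> is itself an
    admissible bound and the norm of a form of order 0 dominates it.\<close>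
  have "nrm QW ((lift 0 (y + h) - lift 0 y - (\<lambda>zs. lift (Suc 0) y (h # zs))) []) \<le>
      nrm (Forms 0) (lift 0 (y + h) - lift 0 y - (\<lambda>zs. lift (Suc 0) y (h # zs))) * prod_list (map (nrm PV) [])"
    by (rule multilinear_nrm_bound(2)[OF PV_normed _ e,
          of QW _ "nrm QW ((lift 0 (y + h) - lift 0 y - (\<lambda>zs. lift (Suc 0) y (h # zs))) [])"])
       (auto simp: tuples_def)
  then show "nrm QW (nemytskii T f (y + h) - nemytskii T f y - lift 1 y [h])
      \<le> holder_const (Suc 0) (?R + C\<^sub>0) * nrm PV h powr \<eta> * nrm PV h"
    using est lift_0_eq_nemytskii[OF f, of y] lift_0_eq_nemytskii[OF f, of "y + h"] by simp
qed

lemma nemytskii_derivative_apply: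
  assumes f: "\<And>v. D 0 v [] = f v" and k: "1 \<le> k" and y: "y \<in> carr PV" and z: "z \<in> carr PV"
  shows "lift 1 y [z] \<in> carr QW"
    and "t \<in> {0..T} \<Longrightarrow> fst (lift 1 y [z]) t = frechet_derivative f (at (fst y t)) (fst z t)"
    and "z \<in> starred PV \<Longrightarrow> lift 1 y [z] \<in> starred QW"
proof -
  have t: "[z] \<in> tuples PV 1" using z by (simp add: tuples_def)
  note app = lift_apply[OF t k, unfolded One_nat_def]
  show c: "lift 1 y [z] \<in> carr QW"
    by (rule lift_estimate(1)[OF t k y, of "max 1 (C\<^sub>0 * nrm PV y)"]) auto
  show d: "fst (lift 1 y [z]) t = frechet_derivative f (at (fst y t)) (fst z t)" if "t \<in> {0..T}" for t
    using that by (simp add: app lift_path_def multilinear_path_def f_derivative(2)[OF f])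
  assume "z \<in> starred PV"
  then have z0: "fst z 0 = 0" "snd z 0 = 0" by (auto simp: starred_def)
  have lin1: "linear (\<lambda>a. D 1 v [a])" for v
    using multilinear_list_hd[of 0 "D 1 v" "[]"] D_multilinear[of 1 v] by simp
  have lin2: "linear (\<lambda>b. D (Suc 1) v [a, b])" for v a
    using multilinear_list_linear[OF D_multilinear[of "Suc 1" v], of "[a, undefined]" 1] k by simp
  have "fst (lift 1 y [z]) 0 = 0"
    using T_nonneg linear_0[OF lin1] by (simp add: app lift_path_def multilinear_path_def z0)
  \<comment> \<open>At time 0 the Gubinelli derivative is a second derivative of \<open>f\<close>
    with \<open>fst z 0\<close> in its last slot plus the first derivative at \<open>snd z 0\<close>
    applied to the argument; both vanish by linearity.\<close>
  moreover have "snd (lift 1 y [z]) 0 = 0"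
    by (rule blinfun_eqI)
       (use linear_0[OF lin1] linear_0[OF lin2] in \<open>simp add: app lift_dagger_def multilinear_dagger_def z0\<close>)
  ultimately show "lift 1 y [z] \<in> starred QW" using c by (simp add: starred_def)
qed

end

theorem proposition5:
  fixes T p q r \<gamma> \<kappa> :: real and k :: nat
    and \<omega> :: "real \<Rightarrow> real \<Rightarrow> real"
    and x :: "'u::banach two_level"
    and f :: "'v::banach \<Rightarrow> 'w::banach"
  assumes "0 < T" and "control T \<omega>"
    and "2 \<le> p" "p < 3" and "1 \<le> q" and "1 \<le> r" "r < p"
    and "0 < \<gamma>" "\<gamma> \<le> 1" and "0 < \<kappa>" "\<kappa> < 1"
    and "rough_path T \<omega> p x"
    and "holder_class type_nspace type_nspace UNIV (k + 1) \<gamma> f"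
  shows "let PV = (controlled_nspace T \<omega> q r x :: ('u, 'v) cpath nspace);
             QW = (controlled_nspace T \<omega> (max q p / (\<kappa> * \<gamma>)) (max r (p / (1 + \<kappa> * \<gamma>))) x
                    :: ('u, 'w) cpath nspace)
         in
           (\<forall>y\<in>carr PV. nemytskii T f y \<in> carr QW \<and>
              (\<forall>t\<in>{0..T}. fst (nemytskii T f y) t = f (fst y t) \<and>
                 (\<forall>u. snd (nemytskii T f y) t u = frechet_derivative f (at (fst y t)) (snd y t u)))) \<and>
           locally_holder_class PV QW (carr PV) k ((1 - \<kappa>) * \<gamma>) (nemytskii T f) \<and>
           (1 \<le> k \<longrightarrow>
              (\<forall>y\<in>carr PV. \<exists>L. has_fderiv PV QW (carr PV) (nemytskii T f) L y \<and>
                 (\<forall>z\<in>carr PV. L z \<in> carr QW \<and>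
                    (\<forall>t\<in>{0..T}. fst (L z) t = frechet_derivative f (at (fst y t)) (fst z t)) \<and>
                    (z \<in> starred PV \<longrightarrow> L z \<in> starred QW))))"
proof -
  obtain D K where D: "smooth_family D k K \<gamma>" and f: "\<And>v. D 0 v [] = f v"
    using holder_class_smooth_family[of k \<gamma> f] assms by auto
  interpret smooth_family D k K \<gamma> by (rule D)
  let ?q' = "max q p / (\<kappa> * \<gamma>)" and ?r' = "max r (p / (1 + \<kappa> * \<gamma>))"
  have x: "pvar_finite T \<omega> p (fst x)" using assms by (simp add: rough_path_def)
  have \<omega>0: "0 \<le> \<omega> s t" if "0 \<le> s" "s \<le> t" "t \<le> T" for s t
    using assms(2) that unfolding control_def by blast
  \<comment> \<open>Super-additivity over 0, s, t and over 0, t, T, with the outer pieces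
    non-negative, makes the control largest on the whole interval.\<close>
  have \<omega>T: "\<omega> s t \<le> \<omega> 0 T" if "0 \<le> s" "s \<le> t" "t \<le> T" for s t
  proof -
    have add: "\<omega> a b + \<omega> b c \<le> \<omega> a c" if "0 \<le> a" "a \<le> b" "b \<le> c" "c \<le> T" for a b c
      using assms(2) that unfolding control_def by blast
    show ?thesis using add[of 0 s t] add[of 0 t T] \<omega>0[of 0 s] \<omega>0[of t T] that by linarith
  qed
  have \<kappa>\<gamma>: "0 < \<kappa> * \<gamma>" using assms by simp
  \<comment> \<open>The infimum that defines the seminorm of \<open>fst x\<close> is attained as a
    bound, so it may serve as \<open>C\<^sub>X\<close>. Taking the maximum with 1 ensures
    \<open>1 \<le> W\<close>.\<close>
  interpret controlled_nemytskii T \<omega> x "max 1 (\<omega> 0 T)" "pvar_norm T \<omega> p (fst x)" "1 / p" D k K \<gamma>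
    "1 / q" "1 / r" \<kappa> "1 / ?q'" "1 / ?r'" q r ?q' ?r'
  proof
    show "\<omega> s t \<le> max 1 (\<omega> 0 T)" if "0 \<le> s" "s < t" "t \<le> T" for s t
      using \<omega>T[of s t] that by simp
    show "norm (fst x s t) \<le> pvar_norm T \<omega> p (fst x) * \<omega> s t powr (1 / p)" if "0 \<le> s" "s < t" "t \<le> T" for s t
      by (rule pvar_finite_bound(2)[OF x that])
    show "0 \<le> pvar_norm T \<omega> p (fst x)" by (rule pvar_finite_bound(1)[OF x])
    \<comment> \<open>Taking reciprocals turns the maxima in the exponents of the target space into
      the minima of the locale.\<close>
    show "1 / ?q' = \<kappa> * \<gamma> * min (1 / p) (1 / q)"
      using assms by (auto simp: max_def min_def field_simps)
    have i: "1 / max a b = min (1 / a) (1 / b)" if "0 < a" "0 < b" for a b :: real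
      using that by (auto simp: max_def min_def field_simps)
    show "1 / ?r' = min (1 / r) ((1 + \<kappa> * \<gamma>) * (1 / p))"
      using i[of r "p / (1 + \<kappa> * \<gamma>)"] assms \<kappa>\<gamma> by simp
    show "1 / p < 1 / r" using assms by (intro divide_strict_left_mono) auto
  qed (use assms \<omega>0 in auto)
  have bl: "bounded_linear (frechet_derivative f (at v))" for v
    unfolding f_derivative(2)[OF f] by (rule has_derivative_bounded_linear[OF f_derivative(1)[OF f]])
  have app: "fst (nemytskii T f y) t = f (fst y t)"
    "blinfun_apply (snd (nemytskii T f y) t) u = frechet_derivative f (at (fst y t)) (blinfun_apply (snd y t) u)"
    if "t \<in> {0..T}" for y :: "('u, 'v) cpath" and t u
    using that by (simp_all add: nemytskii_def bounded_linear_Blinfun_apply[OF bl])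
  have der: "\<exists>L. has_fderiv PV QW (carr PV) (nemytskii T f) L y \<and>
      (\<forall>z\<in>carr PV. L z \<in> carr QW \<and>
        (\<forall>t\<in>{0..T}. fst (L z) t = frechet_derivative f (at (fst y t)) (fst z t)) \<and>
        (z \<in> starred PV \<longrightarrow> L z \<in> starred QW))" if "1 \<le> k" "y \<in> carr PV" for y
    using nemytskii_fderiv[OF f that] nemytskii_derivative_apply[OF f that]
    by (intro exI[of _ "\<lambda>z. lift 1 y [z]"]) blast
  show ?thesis
    unfolding Let_def
    using nemytskii_carr[OF f] app locally_holder_class_nemytskii[OF f, unfolded \<eta>_def] der by blast
qed

end
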